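(* Let $n \in \mathbb{N}$. (1) If $G$ is a dihedral group of order $2n$ with $n \ge 3$, then $\mathsf s(G) = 3n$ if $n$ is odd and $\mathsf s(G) = 2n$ if $n$ is even. (2) If $G$ is a dicyclic group of order $4n$ with $n \ge 2$, then $\mathsf s(G) = 6n$ if $n$ is odd and $\mathsf s(G) = 4n$ if $n$ is even.
   Context: A sequence over a finite group $G$ is a finite unordered list of elements of $G$ with repetitions allowed (an element of the free abelian monoid on $G$); its length is the number of terms, and a subsequence is a sub-multiset. A sequence is product-one if its terms can be ordered so that their product equals the identity $1_G$. $\exp(G) = \operatorname{lcm}\{\operatorname{ord}(g) \mid g \in G\}$. $\mathsf s(G)$ is the smallest integer $\ell$ such that every sequence over $G$ of length at least $\ell$ has a product-one subsequence of length $\exp(G)$. The dihedral group of order $2n$ is $\langle \alpha,\tau \mid \alpha^n=\tau^2=1,\ \tau\alpha=\alpha^{-1}\tau\rangle$; the dicyclic group of order $4n$ is $\langle \alpha,\tau \mid \alpha^{2n}=1,\ \tau^2=\alpha^n,\ \tau\alpha=\alpha^{-1}\tau\rangle$. *)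

theory Defs
  imports "HOL-Algebra.Algebra" "HOL-Library.Multiset"
begin

section \<open>The invariant s(G)\<close>

definition group_exponent :: "('a, 'b) monoid_scheme \<Rightarrow> nat" where
  "group_exponent G = Lcm (group.ord G ` carrier G)"

definition sequence_over :: "('a, 'b) monoid_scheme \<Rightarrow> 'a multiset \<Rightarrow> bool" where
  "sequence_over G S \<longleftrightarrow> set_mset S \<subseteq> carrier G"

definition product_one :: "('a, 'b) monoid_scheme \<Rightarrow> 'a multiset \<Rightarrow> bool" where
  "product_one G S \<longleftrightarrow> (\<exists>xs. mset xs = S \<and> foldr (\<lambda>x y. x \<otimes>\<^bsub>G\<^esub> y) xs \<one>\<^bsub>G\<^esub> = \<one>\<^bsub>G\<^esub>)"

definition s_property :: "('a, 'b) monoid_scheme \<Rightarrow> nat \<Rightarrow> bool" where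
  "s_property G l \<longleftrightarrow>
     (\<forall>S. sequence_over G S \<and> l \<le> size S \<longrightarrow>
        (\<exists>T. T \<subseteq># S \<and> size T = group_exponent G \<and> product_one G T))"

text \<open>The minimum exists for every finite group, see \<open>s_property_s_inv\<close> below.\<close>

definition s_inv :: "('a, 'b) monoid_scheme \<Rightarrow> nat" where
  "s_inv G = (LEAST l. s_property G l)"

lemma (in group) s_property_exists:
  assumes fin: "finite (carrier G)"
  shows "\<exists>l. s_property G l"
proof -
  let ?e = "group_exponent G"
  have "s_property G (order G * ?e + 1)"
    unfolding s_property_def
  proof (intro allI impI, elim conjE)
    fix S assume S: "sequence_over G S" and len: "order G * ?e + 1 \<le> size S"
    have "\<exists>g\<in>carrier G. ?e \<le> count S g"
    proof (rule ccontr)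
      assume "\<not> ?thesis"
      then have *: "count S g \<le> ?e" if "g \<in> carrier G" for g
        using that by (meson nle_le)
      have "size S \<le> (\<Sum>g\<in>carrier G. count S g)"
        unfolding size_multiset_overloaded_eq
        using S fin by (intro sum_mono2) (auto simp: sequence_over_def)
      also have "\<dots> \<le> (\<Sum>g\<in>carrier G. ?e)"
        by (rule sum_mono) (rule *)
      finally show False
        using len by (simp add: order_def)
    qed
    then obtain g where g: "g \<in> carrier G" "?e \<le> count S g" by blast
    have "ord g dvd ?e"
      unfolding group_exponent_def using g(1) by (intro dvd_Lcm) auto
    then have pow: "g [^] ?e = \<one>"
      using g(1) pow_eq_id by blast
    have fold: "foldr (\<otimes>) (replicate k g) \<one> = g [^] k" for k :: nat
      using g(1) by (induction k) (simp_all flip: nat_pow_Suc2)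
    show "\<exists>T. T \<subseteq># S \<and> size T = ?e \<and> product_one G T"
      using g pow fold
      by (intro exI[of _ "replicate_mset ?e g"])
        (auto simp: product_one_def count_le_replicate_mset_subset_eq
          intro!: exI[of _ "replicate ?e g"])
  qed
  then show ?thesis ..
qed

lemma (in group) s_property_s_inv:
  "finite (carrier G) \<Longrightarrow> s_property G (s_inv G)"
  unfolding s_inv_def using s_property_exists by (metis LeastI_ex)


section \<open>Groups given by generators and relations\<close>

text \<open>
  A word in the generators and their formal inverses is a list of pairs, where
  \<open>(g, True)\<close> stands for \<open>g\<close> and \<open>(g, False)\<close> for the inverse of \<open>g\<close>.
  A pair \<open>(u, v)\<close> of words in \<open>R\<close> is the relation \<open>u = v\<close>.
\<close>

type_synonym 'g word = "('g \<times> bool) list"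

inductive word_eq :: "('g word \<times> 'g word) set \<Rightarrow> 'g word \<Rightarrow> 'g word \<Rightarrow> bool"
  for R :: "('g word \<times> 'g word) set" where
  rel: "(u, v) \<in> R \<Longrightarrow> word_eq R u v"
| cancel: "word_eq R [(g, b), (g, \<not> b)] []"
| refl: "word_eq R u u"
| sym: "word_eq R u v \<Longrightarrow> word_eq R v u"
| trans: "word_eq R u v \<Longrightarrow> word_eq R v w \<Longrightarrow> word_eq R u w"
| congr: "word_eq R u v \<Longrightarrow> word_eq R (x @ u @ y) (x @ v @ y)"

definition word_class :: "('g word \<times> 'g word) set \<Rightarrow> 'g word \<Rightarrow> 'g word set" where
  "word_class R u = {v. word_eq R u v}"

definition presented_group :: "('g word \<times> 'g word) set \<Rightarrow> 'g word set monoid" where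
  "presented_group R =
     \<lparr> carrier = range (word_class R),
       monoid.mult = (\<lambda>A B. {w. \<exists>a\<in>A. \<exists>b\<in>B. word_eq R (a @ b) w}),
       monoid.one = word_class R [] \<rparr>"

datatype gen = Alpha | Tau

abbreviation \<alpha> :: "gen \<times> bool" where "\<alpha> \<equiv> (Alpha, True)"
abbreviation \<alpha>_inv :: "gen \<times> bool" where "\<alpha>_inv \<equiv> (Alpha, False)"
abbreviation \<tau> :: "gen \<times> bool" where "\<tau> \<equiv> (Tau, True)"

definition dihedral_group :: "nat \<Rightarrow> gen word set monoid" where
  "dihedral_group n = presented_group
     {(replicate n \<alpha>, []), ([\<tau>, \<tau>], []), ([\<tau>, \<alpha>], [\<alpha>_inv, \<tau>])}"

definition dicyclic_group :: "nat \<Rightarrow> gen word set monoid" where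
  "dicyclic_group n = presented_group
     {(replicate (2 * n) \<alpha>, []), ([\<tau>, \<tau>], replicate n \<alpha>), ([\<tau>, \<alpha>], [\<alpha>_inv, \<tau>])}"

lemma word_eq_append:
  assumes "word_eq R a a'" "word_eq R b b'"
  shows "word_eq R (a @ b) (a' @ b')"
proof -
  have "word_eq R (a @ b) (a' @ b)"
    using word_eq.congr[OF assms(1), of "[]" b] by simp
  moreover have "word_eq R (a' @ b) (a' @ b')"
    using word_eq.congr[OF assms(2), of a' "[]"] by simp
  ultimately show ?thesis by (rule word_eq.trans)
qed

lemma word_class_eq_iff: "word_class R u = word_class R v \<longleftrightarrow> word_eq R u v"
  unfolding word_class_def by (auto intro: word_eq.intros)

lemma mult_presented_group:
  "word_class R a \<otimes>\<^bsub>presented_group R\<^esub> word_class R b = word_class R (a @ b)"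
proof -
  have "word_eq R (a @ b) w"
    if "word_eq R a a'" "word_eq R b b'" "word_eq R (a' @ b') w" for a' b' w
    using that word_eq_append word_eq.trans by metis
  then show ?thesis
    by (auto simp: presented_group_def word_class_def intro: word_eq.refl)
qed

lemma word_inverse:
  "word_eq R (rev (map (\<lambda>(g, b). (g, \<not> b)) u) @ u) []"
proof (induction u)
  case Nil
  show ?case by (simp add: word_eq.refl)
next
  case (Cons x u)
  obtain g b where x: "x = (g, b)" by (cases x)
  let ?i = "rev (map (\<lambda>(g, b). (g, \<not> b)) u)"
  have "word_eq R (?i @ [(g, \<not> b), (g, b)] @ u) (?i @ [] @ u)"
    using word_eq.cancel[of R g "\<not> b"] by (intro word_eq.congr) simp
  with Cons show ?case by (auto simp: x intro: word_eq.trans)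
qed

lemma group_presented_group: "group (presented_group R)"
proof (rule groupI)
  fix A assume "A \<in> carrier (presented_group R)"
  then obtain u where u: "A = word_class R u" by (auto simp: presented_group_def)
  let ?i = "word_class R (rev (map (\<lambda>(g, b). (g, \<not> b)) u))"
  have "?i \<otimes>\<^bsub>presented_group R\<^esub> A = \<one>\<^bsub>presented_group R\<^esub>"
    using word_inverse unfolding u mult_presented_group
    by (simp add: presented_group_def word_class_eq_iff)
  then show "\<exists>B\<in>carrier (presented_group R).
      B \<otimes>\<^bsub>presented_group R\<^esub> A = \<one>\<^bsub>presented_group R\<^esub>"
    by (intro bexI[of _ ?i]) (auto simp: presented_group_def)
next
  have one: "\<one>\<^bsub>presented_group R\<^esub> = word_class R []"
    and carrier: "carrier (presented_group R) = range (word_class R)"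
    by (simp_all add: presented_group_def)
  show "\<one>\<^bsub>presented_group R\<^esub> \<in> carrier (presented_group R)"
    by (simp add: one carrier)
  show "\<one>\<^bsub>presented_group R\<^esub> \<otimes>\<^bsub>presented_group R\<^esub> A = A"
    if "A \<in> carrier (presented_group R)" for A
    using that by (auto simp: one carrier mult_presented_group)
next
  fix A B assume "A \<in> carrier (presented_group R)" "B \<in> carrier (presented_group R)"
  then show "A \<otimes>\<^bsub>presented_group R\<^esub> B \<in> carrier (presented_group R)"
    using mult_presented_group[of R] by (auto simp: presented_group_def)
next
  fix A B C
  assume "A \<in> carrier (presented_group R)" "B \<in> carrier (presented_group R)"
    "C \<in> carrier (presented_group R)"
  then obtain a b c where "A = word_class R a" "B = word_class R b" "C = word_class R c"
    by (auto simp: presented_group_def)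
  then show "A \<otimes>\<^bsub>presented_group R\<^esub> B \<otimes>\<^bsub>presented_group R\<^esub> C =
      A \<otimes>\<^bsub>presented_group R\<^esub> (B \<otimes>\<^bsub>presented_group R\<^esub> C)"
    by (simp add: mult_presented_group)
qed


subsection \<open>The orders of the dihedral and dicyclic groups\<close>

context
  fixes m k :: nat and R :: "(gen word \<times> gen word) set"
  assumes m: "0 < m" and k: "m dvd 2 * k"
    and R: "R = {(replicate m \<alpha>, []), ([\<tau>, \<tau>], replicate k \<alpha>), ([\<tau>, \<alpha>], [\<alpha>_inv, \<tau>])}"
begin

private definition nf :: "nat \<Rightarrow> bool \<Rightarrow> gen word" where
  "nf i b = replicate i \<alpha> @ (if b then [\<tau>] else [])"

private definition red :: "gen word \<Rightarrow> bool" where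
  "red w \<longleftrightarrow> (\<exists>i<m. \<exists>b. word_eq R w (nf i b))"

private lemma red_cong: "red v \<Longrightarrow> word_eq R u v \<Longrightarrow> red u"
  unfolding red_def by (meson word_eq.trans)

private lemma Cons_cong: "word_eq R u v \<Longrightarrow> word_eq R (x # u) (x # v)"
  using word_eq.congr[of R u v "[x]" "[]"] by simp

private lemma pre_cong: "word_eq R u v \<Longrightarrow> word_eq R (u @ y) (v @ y)"
  using word_eq.congr[of R u v "[]" y] by simp

private lemma cancel_Cons: "word_eq R ((g, b) # (g, \<not> b) # w) w"
  using pre_cong[OF word_eq.cancel[of R g b], of w] by simp

private lemma alpha_m: "word_eq R (replicate m \<alpha> @ w) w"
  using pre_cong[OF word_eq.rel[of "replicate m \<alpha>" "[]" R], of w] by (simp add: R)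

private lemma red_alpha: assumes "red w" shows "red (\<alpha> # w)"
proof -
  obtain i b where i: "i < m" "word_eq R w (nf i b)" using assms by (auto simp: red_def)
  have "word_eq R (\<alpha> # w) (nf (Suc i) b)"
    using Cons_cong[OF i(2)] by (simp add: nf_def)
  moreover have "red (nf (Suc i) b)"
  proof (cases "Suc i = m")
    case True
    then have "word_eq R (nf (Suc i) b) (nf 0 b)"
      using alpha_m by (simp add: nf_def)
    with m show ?thesis by (auto simp: red_def)
  next
    case False
    with i(1) have "Suc i < m" by simp
    then show ?thesis unfolding red_def using word_eq.refl by blast
  qed
  ultimately show ?thesis using red_cong by blast
qed

private lemma red_alpha_inv: assumes "red w" shows "red (\<alpha>_inv # w)"
proof -
  obtain i b where i: "i < m" "word_eq R w (nf i b)" using assms by (auto simp: red_def)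
  have *: "word_eq R (\<alpha>_inv # nf (Suc j) b) (nf j b)" for j
    using cancel_Cons[of Alpha False] by (simp add: nf_def)
  have "red (\<alpha>_inv # nf i b)"
  proof (cases i)
    case 0
    have "word_eq R (\<alpha>_inv # nf 0 b) (\<alpha>_inv # nf m b)"
      using alpha_m by (intro Cons_cong word_eq.sym[of _ "nf m b"]) (simp add: nf_def)
    moreover have "word_eq R (\<alpha>_inv # nf m b) (nf (m - 1) b)"
      using *[of "m - 1"] m by simp
    moreover have "red (nf (m - 1) b)"
      using m by (auto simp: red_def intro!: exI[of _ "m - 1"] word_eq.refl)
    ultimately show ?thesis using red_cong 0 by blast
  next
    case (Suc j)
    with * i(1) show ?thesis unfolding red_def by (metis Suc_lessD)
  qed
  then show ?thesis using red_cong Cons_cong i(2) by blast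
qed

private lemma red_alphas:
  "red w \<Longrightarrow> red (replicate i \<alpha> @ w)" "red w \<Longrightarrow> red (replicate i \<alpha>_inv @ w)"
  by (induction i) (auto intro: red_alpha red_alpha_inv)

private lemma red_nf: "red (nf i b)"
proof -
  have "red (nf 0 b)" using m by (auto simp: red_def intro: word_eq.refl)
  from red_alphas(1)[OF this, of i] show ?thesis by (simp add: nf_def)
qed

private lemma tau_alphas:
  "word_eq R (\<tau> # replicate i \<alpha> @ w) (replicate i \<alpha>_inv @ \<tau> # w)"
proof (induction i)
  case 0
  show ?case by (simp add: word_eq.refl)
next
  case (Suc i)
  have "word_eq R [\<tau>, \<alpha>] [\<alpha>_inv, \<tau>]" by (rule word_eq.rel) (simp add: R)
  from pre_cong[OF this, of "replicate i \<alpha> @ w"] Cons_cong[OF Suc, of \<alpha>_inv]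
  show ?case by (auto intro: word_eq.trans)
qed

private lemma tau_tau: "word_eq R (\<tau> # \<tau> # w) (replicate k \<alpha> @ w)"
  using pre_cong[OF word_eq.rel[of "[\<tau>, \<tau>]" "replicate k \<alpha>" R], of w] by (simp add: R)

private lemma red_tau: assumes "red w" shows "red (\<tau> # w)"
proof -
  obtain i b where i: "word_eq R w (nf i b)" using assms by (auto simp: red_def)
  have "red (\<tau> # nf 0 b)"
  proof (cases b)
    case True
    then show ?thesis
      using tau_tau[of "[]"] red_nf[of k False] red_cong by (auto simp: nf_def)
  next
    case False
    then show ?thesis using red_nf[of 0 True] by (simp add: nf_def)
  qed
  then have "red (replicate i \<alpha>_inv @ \<tau> # nf 0 b)" by (rule red_alphas)
  then have "red (\<tau> # nf i b)"
    using red_cong tau_alphas[of i "nf 0 b"] by (simp add: nf_def)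
  then show ?thesis using red_cong Cons_cong i by blast
qed

private lemma alpha_invs: "word_eq R (replicate i \<alpha>_inv @ replicate i \<alpha> @ w) w"
proof (induction i)
  case 0
  show ?case by (simp add: word_eq.refl)
next
  case (Suc i)
  have "word_eq R (replicate i \<alpha>_inv @ [\<alpha>_inv, \<alpha>] @ replicate i \<alpha> @ w)
      (replicate i \<alpha>_inv @ [] @ replicate i \<alpha> @ w)"
    using word_eq.cancel[of R Alpha False] by (intro word_eq.congr) simp
  with Suc show ?case
    by (auto simp: replicate_app_Cons_same intro: word_eq.trans)
qed

private lemma red_tau_inv: assumes "red w" shows "red ((Tau, False) # w)"
proof -
  let ?t = "(Tau, False)"
  have "word_eq R (replicate k \<alpha>_inv @ \<tau> # \<tau> # ?t # w) (?t # w)"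
    using word_eq_append[OF word_eq.refl tau_tau] alpha_invs word_eq.trans by blast
  moreover have "word_eq R (replicate k \<alpha>_inv @ \<tau> # \<tau> # ?t # w) (replicate k \<alpha>_inv @ \<tau> # w)"
    using cancel_Cons[of Tau True] by (intro word_eq_append word_eq.refl Cons_cong) simp
  moreover have "red (replicate k \<alpha>_inv @ \<tau> # w)"
    using assms red_tau red_alphas by blast
  ultimately show ?thesis by (meson red_cong word_eq.sym word_eq.trans)
qed

private lemma red_all: "red w"
proof (induction w)
  case Nil
  show ?case using red_nf[of 0 False] by (simp add: nf_def)
next
  case (Cons x w)
  obtain g b where "x = (g, b)" by (cases x)
  with Cons show ?case
    by (cases g; cases b) (auto intro: red_alpha red_alpha_inv red_tau red_tau_inv)
qed

private fun act :: "gen \<times> bool \<Rightarrow> int \<times> bool \<Rightarrow> int \<times> bool" where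
  "act (Alpha, s) (i, b) = ((if s then i + 1 else i - 1) mod int m, b)"
| "act (Tau, s) (i, b) = ((if b = s then int k - i else - i) mod int m, \<not> b)"

private definition D :: "(int \<times> bool) set" where "D = {0..<int m} \<times> UNIV"

private lemma act_D: "act x p \<in> D"
  using m by (cases "(x, p)" rule: act.cases) (auto simp: D_def)

private lemma run_D: "p \<in> D \<Longrightarrow> foldr act w p \<in> D"
  by (induction w) (auto intro: act_D)

private lemma run_replicate: "foldr act (replicate j \<alpha>) (i, b) = ((i + int j) mod int m, b)"
  if "(i, b) \<in> D"
  using that
proof (induction j)
  case 0
  then show ?case by (auto simp: D_def)
next
  case (Suc j)
  then show ?case by (simp add: mod_simps algebra_simps)
qed

private lemma run_word_eq:
  "word_eq R u v \<Longrightarrow> p \<in> D \<Longrightarrow> foldr act u p = foldr act v p"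
proof (induction arbitrary: p rule: word_eq.induct)
  case (rel u v)
  obtain i b where p: "p = (i, b)" by (cases p)
  have k': "(i - int k) mod int m = (i + int k) mod int m"
  proof -
    have "int m dvd int (2 * k)" using k by (simp only: of_nat_dvd_iff)
    then have "int m dvd (i + int k) - (i - int k)" by (simp add: algebra_simps)
    then show ?thesis by (metis mod_eq_dvd_iff)
  qed
  have pD: "(i, b) \<in> D" and i: "i mod int m = i" using rel(2) by (auto simp: p D_def)
  have comm: "- 1 - i = - i - 1" "int k - (i + 1) = int k - i - 1" by linarith+
  consider "u = replicate m \<alpha>" "v = []" | "u = [\<tau>, \<tau>]" "v = replicate k \<alpha>"
    | "u = [\<tau>, \<alpha>]" "v = [\<alpha>_inv, \<tau>]"
    using rel(1) by (auto simp: R)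
  then show ?case
  proof cases
    case 1
    then show ?thesis by (simp add: p run_replicate[OF pD] i del: foldr_replicate)
  next
    case 2
    then show ?thesis
      using k' unfolding 2 p run_replicate[OF pD]
      by (cases b) (simp_all add: mod_simps algebra_simps)
  next
    case 3
    then show ?thesis
      by (cases b) (simp_all add: p mod_simps comm)
  qed
next
  case (cancel g b)
  obtain i c where "p = (i, c)" by (cases p)
  with cancel show ?case
    by (cases g; cases b; cases c) (auto simp: D_def mod_simps)
next
  case (congr u v x y)
  then show ?case by (simp add: run_D)
qed auto

private lemma run_nf: "i < m \<Longrightarrow> foldr act (nf i b) (0, False) = (int i, b)"
  using m run_replicate[of 0 _ i] by (auto simp: nf_def D_def)

private lemma nf_inj:
  assumes "word_eq R (nf i b) (nf j c)" "i < m" "j < m"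
  shows "i = j \<and> b = c"
proof -
  have "foldr act (nf i b) (0, False) = foldr act (nf j c) (0, False)"
    using m by (intro run_word_eq assms(1)) (auto simp: D_def)
  then show ?thesis using assms run_nf by simp
qed

lemma order_presented_group: "order (presented_group R) = 2 * m"
proof -
  let ?f = "\<lambda>(i, b). word_class R (nf i b)"
  have "inj_on ?f ({..<m} \<times> UNIV)"
    using nf_inj by (auto simp: inj_on_def word_class_eq_iff)
  moreover have "range (word_class R) = ?f ` ({..<m} \<times> UNIV)"
  proof (intro equalityI subsetI)
    fix A assume "A \<in> range (word_class R)"
    then obtain w where "A = word_class R w" by blast
    moreover obtain i b where "i < m" "word_class R w = word_class R (nf i b)"
      using red_all[of w] by (auto simp: red_def word_class_eq_iff)
    ultimately show "A \<in> ?f ` ({..<m} \<times> UNIV)"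
      by (intro image_eqI[of _ _ "(i, b)"]) auto
  qed auto
  ultimately have "card (range (word_class R)) = card ({..<m} \<times> (UNIV :: bool set))"
    by (simp add: card_image)
  then show ?thesis by (simp add: order_def presented_group_def)
qed

end

lemma group_dihedral_group: "group (dihedral_group n)"
  by (simp add: dihedral_group_def group_presented_group)

lemma group_dicyclic_group: "group (dicyclic_group n)"
  by (simp add: dicyclic_group_def group_presented_group)

lemma order_dihedral_group: "0 < n \<Longrightarrow> order (dihedral_group n) = 2 * n"
  using order_presented_group[of n 0, OF _ _ HOL.refl] by (simp add: dihedral_group_def)

lemma order_dicyclic_group: "0 < n \<Longrightarrow> order (dicyclic_group n) = 4 * n"
  using order_presented_group[of "2 * n" n, OF _ _ HOL.refl] by (simp add: dicyclic_group_def)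

end

(* Write the group elements as a^i (rotations) and a^i t (reflections), where a has order m and
   t^2 = a^k. In every case the claim is s(G) = exp(G) + m. The sequence consisting of exp(G) - 1
   copies of 1, m - 1 copies of a and one t gives the lower bound.

   For the upper bound, orderings of a sequence that contains reflections realise all sums in which
   the rotation exponents carry arbitrary signs and half of the reflection exponents count
   negatively. At most one reflection is handled by the Erdos-Ginzburg-Ziv theorem. With few
   reflections, the signed sums of a growing set of rotations either reach the difference of two
   reflection exponents, and the rest is filled with pairs of rotations that cancel, or they are
   periodic modulo some g, and then so many of the remaining rotations are divisible by g that the
   Erdos-Ginzburg-Ziv theorem applies to them. With many reflections, the product-one subsequence
   is put together from pairs, or fours, of elements that cancel up to a central element of order
   at most 2, one surplus pair being dropped to make the central factors cancel. If m/2 is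
   even, the center is factored out: among three blocks with central product, two have the same
   product. *)

theory Submission
  imports Defs
begin

text \<open>The obstacle is parity. Once a reflection is present, the signs of the rotations are
  free, but no choice of signs changes a sum modulo 2. Factoring out the center halves
  \<open>m\<close>, and this is harmless only if the exponent is halved as well. It is not when
  \<open>m = 2 h\<close> with \<open>h \<ge> 3\<close> odd in the dihedral case: the dihedral group
  of order \<open>2 h\<close> still has exponent \<open>2 h\<close>, so its blocks already have the
  full length and two of them are too long. In the dicyclic case with odd \<open>n\<close>, three
  blocks of length \<open>2 n\<close> from the quotient would need \<open>4 n + 3 n\<close> terms,
  and only \<open>6 n\<close> are given. These two families therefore get arguments of their own, in
  which parity is repaired by rotations with an odd sum, by the choice of the dropped pair, or by
  blocks of rotations of length \<open>n\<close>. The halving also has to stop at order 8: the next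
  quotient is the Klein four-group, whose four elements contain no product-one pair.\<close>

section \<open>Pigeonhole arguments for multisets\<close>

lemma mset_pigeonhole:
  assumes "finite Z" "f ` set_mset M \<subseteq> Z" "card Z < size M"
  obtains a b where "{#a, b#} \<subseteq># M" "f a = f b"
proof (cases "\<exists>a. 2 \<le> count M a")
  case True
  \<comment> \<open>A repeated element also counts as a pair; this is why pairs are submultisets and
    not two distinct members.\<close>
  then obtain a where "2 \<le> count M a" by blast
  then have "{#a, a#} \<subseteq># M" by (auto simp: subseteq_mset_def)
  then show ?thesis using that by blast
next
  case False
  then have "count M a \<le> 1" for a by (metis not_less_eq_eq numeral_2_eq_2 One_nat_def)
  then have "size M \<le> card (set_mset M)"
    unfolding size_multiset_overloaded_eq by (metis sum_bounded_above mult.right_neutral of_nat_id)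
  moreover have "card (f ` set_mset M) \<le> card Z" using assms by (simp add: card_mono)
  ultimately have "card (f ` set_mset M) < card (set_mset M)" using assms(3) by linarith
  then have "\<not> inj_on f (set_mset M)" using card_image by fastforce
  then obtain a b where ab: "a \<in># M" "b \<in># M" "a \<noteq> b" "f a = f b" by (auto simp: inj_on_def)
  have "{#a, b#} \<subseteq># M"
    using ab by (simp add: insert_subset_eq_iff in_diff_count)
  then show ?thesis using ab that by blast
qed

lemma mset_pigeonhole_tight:
  assumes "finite Z" "f ` set_mset M \<subseteq> Z" "card Z \<le> size M"
    and "\<And>a b. {#a, b#} \<subseteq># M \<Longrightarrow> f a \<noteq> f b"
  shows "f ` set_mset M = Z"
proof (rule ccontr)
  assume "f ` set_mset M \<noteq> Z"
  then have "card (f ` set_mset M) < size M"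
    using assms(1-3) by (metis psubsetI psubset_card_mono order_less_le_trans)
  from mset_pigeonhole[OF _ subset_refl this] assms(4) show False by auto
qed

lemma add_subseteq_diff: "A \<subseteq># S \<Longrightarrow> B \<subseteq># S - A \<Longrightarrow> A + B \<subseteq># S"
  by (metis add.commute subset_mset.le_diff_conv2)

lemma subseteq_image_mset:
  assumes "M \<subseteq># image_mset f N"
  obtains Q where "Q \<subseteq># N" "M = image_mset f Q"
proof -
  obtain C where "image_mset f N = M + C" using assms by (auto simp: subset_mset.le_iff_add)
  then obtain B' C' where "N = B' + C'" "M = image_mset f B'"
    using image_mset_eq_plusD by metis
  then show ?thesis using that[of B'] by simp
qed

section \<open>Periods of sets of residues\<close>

definition stable :: "nat \<Rightarrow> int set \<Rightarrow> int \<Rightarrow> bool" where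
  "stable h A x \<longleftrightarrow> (\<forall>v\<in>A. (v + x) mod int h \<in> A)"

lemma stable_add: "stable h A x \<Longrightarrow> stable h A y \<Longrightarrow> stable h A (x + y)"
  unfolding stable_def by (metis add.assoc mod_add_left_eq)

lemma stable_mult_nat: "A \<subseteq> {0..<int h} \<Longrightarrow> stable h A x \<Longrightarrow> stable h A (int n * x)"
proof (induction n)
  case 0
  then show ?case by (auto simp: stable_def)
next
  case (Suc n)
  then show ?case using stable_add[of h A x "int n * x"] by (simp add: algebra_simps)
qed

lemma stable_cong: "int h dvd x - y \<Longrightarrow> stable h A x \<Longrightarrow> stable h A y"
  unfolding stable_def by (metis mod_add_cong mod_eq_dvd_iff)

text \<open>Negative \<open>c\<close> are covered because \<open>c\<close> may be replaced by its
  residue modulo \<open>h\<close>: modulo \<open>h\<close>, an inverse shift is a repeated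
  shift.\<close>

lemma stable_mult:
  assumes "A \<subseteq> {0..<int h}" "0 < h" "stable h A x"
  shows "stable h A (c * x)"
proof -
  have "stable h A (int (nat (c mod int h)) * x)" by (rule stable_mult_nat[OF assms(1,3)])
  moreover have "int h dvd int (nat (c mod int h)) * x - c * x"
    using assms(2) by (simp flip: left_diff_distrib) (metis dvd_mult2 mod_mod_trivial mod_eq_dvd_iff)
  ultimately show ?thesis using stable_cong by blast
qed

text \<open>The shifts that preserve \<open>A\<close> form a subgroup of the integers containing
  \<open>h\<close>. Its least positive element generates it, since the remainder of a division by it
  is again such a shift.\<close>

lemma stable_generator:
  assumes "A \<subseteq> {0..<int h}" "0 < h"
  obtains g where "0 < g" "g dvd h" "\<And>x. stable h A x \<longleftrightarrow> int g dvd x"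
proof -
  define g where "g = (LEAST g. 0 < g \<and> stable h A (int g))"
  have "stable h A (int h)" using assms by (auto simp: stable_def)
  then have g: "0 < g" "stable h A (int g)"
    using LeastI[of "\<lambda>g. 0 < g \<and> stable h A (int g)" h] assms unfolding g_def by auto
  have dvd: "int g dvd x" if "stable h A x" for x
  proof (rule ccontr)
    assume "\<not> int g dvd x"
    then have "x mod int g \<noteq> 0" by (metis mod_0_imp_dvd)
    moreover have "0 \<le> x mod int g" "x mod int g < int g" using g(1) by simp_all
    ultimately have r: "0 < x mod int g" "x mod int g < int g" by linarith+
    have "stable h A (x + (- (x div int g)) * int g)"
      by (intro stable_add that stable_mult assms g)
    then have "stable h A (int (nat (x mod int g)))"
      using r by (simp add: minus_div_mult_eq_mod)
    then have "g \<le> nat (x mod int g)"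
      using r(1) Least_le[of "\<lambda>g. 0 < g \<and> stable h A (int g)" "nat (x mod int g)"]
      unfolding g_def[symmetric] by simp
    then show False using r by linarith
  qed
  show ?thesis
  proof (rule that[OF g(1)])
    show "g dvd h" using dvd[OF \<open>stable h A (int h)\<close>] by simp
    show "stable h A x \<longleftrightarrow> int g dvd x" for x
      using dvd stable_mult[OF assms g(2)] by (auto simp: dvd_def mult.commute)
  qed
qed

lemma mod_translate_inj: "inj_on (\<lambda>v. (v + x) mod int h) {0..<int h}"
proof (rule inj_onI)
  fix u v assume "u \<in> {0..<int h}" "v \<in> {0..<int h}" "(u + x) mod int h = (v + x) mod int h"
  then have "int h dvd u - v" by (metis mod_eq_dvd_iff add_diff_cancel_right)
  then have "u mod int h = v mod int h" by (simp add: mod_eq_dvd_iff)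
  then show "u = v" using \<open>u \<in> _\<close> \<open>v \<in> _\<close> by simp
qed

text \<open>Adding a two-element set enlarges \<open>A\<close> unless the difference of the two
  elements is a period. In the prime case this replaces the Cauchy-Davenport theorem.\<close>

lemma card_translate_union:
  assumes "A \<subseteq> {0..<int h}" "\<not> stable h A (y - x)"
  shows "card A < card ((\<lambda>v. (v + x) mod int h) ` A \<union> (\<lambda>v. (v + y) mod int h) ` A)"
    (is "_ < card (?X \<union> ?Y)")
proof -
  have fin: "finite A" using assms(1) finite_subset by blast
  have cX: "card ?X = card A"
    using card_image[OF inj_on_subset[OF mod_translate_inj assms(1)]] .
  obtain v where v: "v \<in> A" "(v + (y - x)) mod int h \<notin> A" using assms(2) by (auto simp: stable_def)
  have "(v + y) mod int h \<notin> ?X"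
  proof
    assume "(v + y) mod int h \<in> ?X"
    then obtain u where u: "u \<in> A" "(v + y) mod int h = (u + x) mod int h" by auto
    then have "int h dvd (v + (y - x)) - u" by (metis add_diff_eq diff_diff_eq diff_diff_eq2 add.commute mod_eq_dvd_iff)
    then have "(v + (y - x)) mod int h = u" using u(1) assms(1) by (simp add: mod_eq_dvd_iff[symmetric] subset_iff)
    then show False using v u by simp
  qed
  then have "?X \<subset> ?X \<union> ?Y" using v(1) by blast
  then show ?thesis using cX fin psubset_card_mono[of "?X \<union> ?Y" ?X] by simp
qed

section \<open>The Erdos-Ginzburg-Ziv theorem\<close>

text \<open>The intended sums choose one of the terms \<open>i\<close> and \<open>p - 1 + i\<close>
  for each \<open>i < j\<close>. Range and number of the indices are all that matters later: for
  \<open>j = p - 1\<close> they avoid the index \<open>2 * p - 2\<close>.\<close>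

definition subset_sums :: "nat \<Rightarrow> (nat \<Rightarrow> int) \<Rightarrow> nat \<Rightarrow> int set" where
  "subset_sums p r j = {(\<Sum>i\<in>I. r i) mod int p | I. I \<subseteq> {..<j} \<union> {p - 1..<p - 1 + j} \<and> card I = j}"

lemma subset_sums_Suc:
  assumes "j < p - 1" "i \<in> {j, p - 1 + j}" "v \<in> subset_sums p r j"
  shows "(v + r i) mod int p \<in> subset_sums p r (Suc j)"
proof -
  obtain I where I: "v = (\<Sum>i\<in>I. r i) mod int p" "I \<subseteq> {..<j} \<union> {p - 1..<p - 1 + j}" "card I = j"
    using assms(3) by (auto simp: subset_sums_def)
  have fin: "finite I" using I(2) finite_subset by blast
  have "i \<notin> I" using I(2) assms(1,2) by auto
  then have "(\<Sum>i\<in>insert i I. r i) = (\<Sum>i\<in>I. r i) + r i" "card (insert i I) = Suc j"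
    using fin I(3) by simp_all
  then have "(v + r i) mod int p = (\<Sum>i\<in>insert i I. r i) mod int p" "card (insert i I) = Suc j"
    unfolding I(1) by (simp_all add: mod_add_left_eq)
  moreover have "insert i I \<subseteq> {..<Suc j} \<union> {p - 1..<p - 1 + Suc j}"
    using I(2) assms(2) by auto
  ultimately show ?thesis unfolding subset_sums_def by blast
qed

text \<open>In a sequence that is sorted modulo \<open>p\<close>, terms number \<open>i\<close> and \<open>p - 1 + i\<close> agree modulo \<open>p\<close>
  only if \<open>p\<close> consecutive terms do. Otherwise each of these \<open>p - 1\<close> choices enlarges the set of
  sums.\<close>

lemma card_subset_sums:
  assumes "Factorial_Ring.prime p" "\<And>i. i < p - 1 \<Longrightarrow> r i mod int p \<noteq> r (p - 1 + i) mod int p" "j \<le> p - 1"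
  shows "j < card (subset_sums p r j)"
  using assms(3)
proof (induction j)
  case 0
  have "subset_sums p r 0 = {0}" by (auto simp: subset_sums_def)
  then show ?case by simp
next
  case (Suc j)
  let ?A = "subset_sums p r j"
  let ?T = "\<lambda>x. (\<lambda>v. (v + x) mod int p) ` ?A"
  have p: "0 < p" using assms(1) prime_gt_0_nat by blast
  have sub: "subset_sums p r j \<subseteq> {0..<int p}" for j
    using p by (auto simp: subset_sums_def)
  have union: "?T (r j) \<union> ?T (r (p - 1 + j)) \<subseteq> subset_sums p r (Suc j)"
    using subset_sums_Suc[of j p j] subset_sums_Suc[of j p "p - 1 + j"] Suc.prems by auto
  have card: "j < card ?A" using Suc by simp
  have fin: "finite (subset_sums p r (Suc j))" using sub finite_subset by blast
  show ?case
  proof (cases "stable p ?A (r (p - 1 + j) - r j)")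
    case False
    then have "card ?A < card (?T (r j) \<union> ?T (r (p - 1 + j)))"
      by (rule card_translate_union[OF sub])
    also have "\<dots> \<le> card (subset_sums p r (Suc j))" by (rule card_mono[OF fin union])
    finally show ?thesis using card by linarith
  next
    \<comment> \<open>A period prime to \<open>p\<close> makes every residue a period, so the
      nonempty set is already complete.\<close>
    case True
    obtain g where g: "0 < g" "g dvd p" "\<And>x. stable p ?A x \<longleftrightarrow> int g dvd x"
      using stable_generator[OF sub p] by blast
    have "\<not> int p dvd r (p - 1 + j) - r j"
      using assms(2)[of j] Suc.prems mod_eq_dvd_iff[of "r (p - 1 + j)" "int p" "r j"] by simp
    then have "g \<noteq> p" using g(3) True by blast
    then have "g = 1" using g(2) assms(1) prime_nat_iff by blast
    then have st: "stable p ?A x" for x using g by simp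
    obtain v where "v \<in> ?A" using card by (metis all_not_in_conv card.empty not_less0)
    then have "x \<in> ?A" if "x \<in> {0..<int p}" for x
    proof -
      have "(v + (x - v)) mod int p \<in> ?A"
        using st[of "x - v"] \<open>v \<in> ?A\<close> unfolding stable_def by blast
      then show ?thesis using that by simp
    qed
    then have "?A = {0..<int p}" using sub by blast
    then have "card (?T (r j)) = p"
      using card_image[OF mod_translate_inj[of "r j" p]] by simp
    then have "p \<le> card (subset_sums p r (Suc j))"
      using union fin card_mono[of "subset_sums p r (Suc j)" "?T (r j)"] by simp
    then show ?thesis using Suc.prems p by linarith
  qed
qed

lemma sum_nths_mset:
  assumes "I \<subseteq> {..<length xs}"
  shows "image_mset (\<lambda>i. xs ! i) (mset_set I) \<subseteq># mset xs"
proof -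
  have "mset xs = mset (map ((!) xs) [0..<length xs])" by (simp only: map_nth)
  also have "\<dots> = image_mset (\<lambda>i. xs ! i) (mset_set {..<length xs})"
    unfolding lessThan_atLeast0 by simp
  finally show ?thesis
    using image_mset_subseteq_mono[OF subset_imp_msubset_mset_set[OF assms finite_lessThan]] by simp
qed

lemma erdos_ginzburg_ziv_prime:
  assumes "Factorial_Ring.prime p" "2 * p - 1 \<le> size (S :: int multiset)"
  shows "\<exists>T. T \<subseteq># S \<and> size T = p \<and> int p dvd \<Sum>\<^sub># T"
proof -
  have p: "2 \<le> p" using assms(1) prime_ge_2_nat by blast
  obtain xs0 where xs0: "mset xs0 = S" by (metis ex_mset)
  define xs where "xs = sort_key (\<lambda>x. x mod int p) xs0"
  have xs: "mset xs = S" "sorted (map (\<lambda>x. x mod int p) xs)" by (simp_all add: xs_def xs0)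
  have len: "2 * p - 1 \<le> length xs" using assms(2) xs(1) by (metis size_mset)
  have mono: "xs ! i mod int p \<le> xs ! j mod int p" if "i \<le> j" "j < length xs" for i j
    using sorted_nth_mono[OF xs(2), of i j] that by simp
  have pick: ?thesis if "I \<subseteq> {..<length xs}" "card I = p" "int p dvd (\<Sum>i\<in>I. xs ! i)" for I
  proof (intro exI conjI)
    let ?T = "image_mset (\<lambda>i. xs ! i) (mset_set I)"
    show "?T \<subseteq># S" using sum_nths_mset[OF that(1)] xs(1) by simp
    show "size ?T = p" using that(2) by simp
    show "int p dvd \<Sum>\<^sub># ?T" using that(3) by (simp add: sum_unfold_sum_mset)
  qed
  show ?thesis
  proof (cases "\<exists>i<p - 1. xs ! i mod int p = xs ! (p - 1 + i) mod int p")
    case True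
    then obtain i where i: "i < p - 1" "xs ! i mod int p = xs ! (p - 1 + i) mod int p" by blast
    have eq: "xs ! j mod int p = xs ! i mod int p" if "j \<in> {i..p - 1 + i}" for j
    proof (rule antisym)
      have "xs ! j mod int p \<le> xs ! (p - 1 + i) mod int p"
        using i(1) that len by (intro mono) auto
      then show "xs ! j mod int p \<le> xs ! i mod int p" using i(2) by linarith
      show "xs ! i mod int p \<le> xs ! j mod int p" using i(1) that len by (intro mono) auto
    qed
    have "(\<Sum>j\<in>{i..p - 1 + i}. xs ! j) mod int p = (\<Sum>j\<in>{i..p - 1 + i}. xs ! j mod int p) mod int p"
      by (simp add: mod_sum_eq)
    also have "(\<Sum>j\<in>{i..p - 1 + i}. xs ! j mod int p) = (\<Sum>j\<in>{i..p - 1 + i}. xs ! i mod int p)"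
      by (rule sum.cong[OF HOL.refl eq])
    also have "\<dots> mod int p = (int p * (xs ! i mod int p)) mod int p"
      using p by simp
    finally have "int p dvd (\<Sum>j\<in>{i..p - 1 + i}. xs ! j)" by auto
    then show ?thesis using i len p by (intro pick[of "{i..p - 1 + i}"]) auto
  next
    case False
    have sub: "subset_sums p ((!) xs) (p - 1) \<subseteq> {0..<int p}" using p by (auto simp: subset_sums_def)
    have "p - 1 < card (subset_sums p ((!) xs) (p - 1))"
      using False by (intro card_subset_sums assms(1)) auto
    then have "subset_sums p ((!) xs) (p - 1) = {0..<int p}"
      using sub by (intro card_seteq) auto
    \<comment> \<open>All residues are reached with \<open>p - 1\<close> terms, in particular the
      negative of a term that was kept out of the choice.\<close>
    moreover have "(- xs ! (2 * p - 2)) mod int p \<in> {0..<int p}" using p by simp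
    ultimately obtain I where I: "(\<Sum>i\<in>I. xs ! i) mod int p = (- xs ! (2 * p - 2)) mod int p"
      "I \<subseteq> {..<p - 1} \<union> {p - 1..<p - 1 + (p - 1)}" "card I = p - 1"
      unfolding subset_sums_def by (smt (verit, best) mem_Collect_eq)
    have fin: "finite I" using I(2) finite_subset by blast
    have new: "2 * p - 2 \<notin> I" using subsetD[OF I(2), of "2 * p - 2"] p by auto
    have "int p dvd (\<Sum>i\<in>I. xs ! i) - (- xs ! (2 * p - 2))" using I(1) by (simp only: mod_eq_dvd_iff)
    moreover have "I \<subseteq> {..<length xs}"
    proof
      fix x assume "x \<in> I"
      then have "x \<in> {..<p - 1} \<union> {p - 1..<p - 1 + (p - 1)}" using I(2) by blast
      then show "x \<in> {..<length xs}" using len p by auto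
    qed
    ultimately show ?thesis
      using fin new I(3) p len by (intro pick[of "insert (2 * p - 2) I"]) (auto simp: add.commute)
  qed
qed

text \<open>Greedy extraction: \<open>2 * d - 1\<close> terms must be present before the last block
  is taken, which accounts for the surplus \<open>d - 1\<close>.\<close>

lemma extract_blocks:
  assumes "\<And>S :: int multiset. 2 * d - 1 \<le> size S \<Longrightarrow> \<exists>T. T \<subseteq># S \<and> size T = d \<and> int d dvd \<Sum>\<^sub># T"
    and "j * d + d - 1 \<le> size S" "0 < d"
  shows "\<exists>\<T>. \<Sum>\<^sub># \<T> \<subseteq># S \<and> size \<T> = j \<and> (\<forall>T\<in>#\<T>. size T = d \<and> int d dvd \<Sum>\<^sub># T)"
  using assms(2)
proof (induction j arbitrary: S)
  case 0
  then show ?case by (intro exI[of _ "{#}"]) simp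
next
  case (Suc j)
  have "2 * d - 1 \<le> size S" using Suc.prems assms(3) by simp
  then obtain T where T: "T \<subseteq># S" "size T = d" "int d dvd \<Sum>\<^sub># T" using assms(1) by blast
  have "j * d + d - 1 \<le> size (S - T)" using Suc.prems T by (simp add: size_Diff_submset)
  then obtain \<T> where "\<Sum>\<^sub># \<T> \<subseteq># S - T" "size \<T> = j" "\<forall>T\<in>#\<T>. size T = d \<and> int d dvd \<Sum>\<^sub># T"
    using Suc.IH by blast
  then show ?case
    using T by (intro exI[of _ "add_mset T \<T>"]) (auto simp: subset_mset.le_diff_conv2 add.commute)
qed

text \<open>Blocks of \<open>a\<close> terms become single terms, their sums divided by
  \<open>a\<close>. The count is exact: \<open>2 * b - 1\<close> blocks need
  \<open>(2 * b - 1) * a + a - 1 = 2 * (a * b) - 1\<close> terms.\<close>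

lemma erdos_ginzburg_ziv_mult:
  assumes "\<And>S :: int multiset. 2 * a - 1 \<le> size S \<Longrightarrow> \<exists>T. T \<subseteq># S \<and> size T = a \<and> int a dvd \<Sum>\<^sub># T"
    and "\<And>S :: int multiset. 2 * b - 1 \<le> size S \<Longrightarrow> \<exists>T. T \<subseteq># S \<and> size T = b \<and> int b dvd \<Sum>\<^sub># T"
    and "0 < a" "0 < b" "2 * (a * b) - 1 \<le> size (S :: int multiset)"
  shows "\<exists>T. T \<subseteq># S \<and> size T = a * b \<and> int (a * b) dvd \<Sum>\<^sub># T"
proof -
  have "(2 * b - 1) * a + a - 1 \<le> size S"
    using assms(3-5) by (simp add: algebra_simps)
  then obtain \<T> where T: "\<Sum>\<^sub># \<T> \<subseteq># S" "size \<T> = 2 * b - 1"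
    "\<forall>T\<in>#\<T>. size T = a \<and> int a dvd \<Sum>\<^sub># T"
    using extract_blocks[OF assms(1)] assms(3) by blast
  let ?f = "\<lambda>T. \<Sum>\<^sub># T div int a"
  obtain M where M: "M \<subseteq># image_mset ?f \<T>" "size M = b" "int b dvd \<Sum>\<^sub># M"
    using assms(2)[of "image_mset ?f \<T>"] T(2) by auto
  obtain Q where Q: "Q \<subseteq># \<T>" "M = image_mset ?f Q" using subseteq_image_mset[OF M(1)] .
  have Q': "T \<in># Q \<Longrightarrow> size T = a \<and> int a dvd \<Sum>\<^sub># T" for T using Q(1) T(3) by (meson mset_subset_eqD)
  have "\<Sum>\<^sub># (\<Sum>\<^sub># Q) = int a * \<Sum>\<^sub># (image_mset ?f Q)" "size (\<Sum>\<^sub># Q) = size Q * a"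
    using Q' by (induction Q) (auto simp: distrib_left)
  moreover have "size Q = b" using M(2) Q(2) by simp
  moreover have "\<Sum>\<^sub># Q \<subseteq># S"
    using Q(1) T(1) by (metis subset_mset.add_increasing2 subset_mset.le_iff_add sum_mset.union subset_mset.order_trans subset_mset.zero_le)
  ultimately show ?thesis using M(3) Q(2) by (intro exI[of _ "\<Sum>\<^sub># Q"]) auto
qed

lemma erdos_ginzburg_ziv:
  assumes "0 < d"  "2 * d - 1 \<le> size (S :: int multiset)"
  shows "\<exists>T. T \<subseteq># S \<and> size T = d \<and> int d dvd \<Sum>\<^sub># T"
  using assms
proof (induction d arbitrary: S rule: less_induct)
  case (less d)
  show ?case
  proof (cases "d = 1")
    case True
    then obtain x where "x \<in># S" using less.prems by fastforce
    then show ?thesis using True by (intro exI[of _ "{#x#}"]) simp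
  next
    case False
    then obtain p b where p: "Factorial_Ring.prime p" "d = p * b" using prime_factor_nat by (metis dvdE)
    then have "0 < b" "b < d" using less.prems prime_ge_2_nat[of p] by auto
    then show ?thesis
      using erdos_ginzburg_ziv_mult[of p b S] erdos_ginzburg_ziv_prime[OF p(1)]
        less.IH less.prems p by auto
  qed
qed

text \<open>Lengths above \<open>d\<close> are needed because the exponent can be twice the order of
  the rotation subgroup.\<close>

lemma erdos_ginzburg_ziv_length:
  assumes "0 < d" "d dvd l" "l + d - 1 \<le> size (S :: int multiset)"
  shows "\<exists>T. T \<subseteq># S \<and> size T = l \<and> int d dvd \<Sum>\<^sub># T"
proof -
  obtain j where l: "l = j * d" using assms(2) by (metis dvdE mult.commute)
  then obtain \<T> where T: "\<Sum>\<^sub># \<T> \<subseteq># S" "size \<T> = j" "\<forall>T\<in>#\<T>. size T = d \<and> int d dvd \<Sum>\<^sub># T"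
    using extract_blocks[OF erdos_ginzburg_ziv, of d j S] assms(1,3) by blast
  have "size (\<Sum>\<^sub># \<T>) = size \<T> * d" "int d dvd \<Sum>\<^sub># (\<Sum>\<^sub># \<T>)"
    using T(3) by (induction \<T>) auto
  then show ?thesis using T l by blast
qed

text \<open>Multiples of \<open>g\<close> behave modulo \<open>g * d\<close> like integers modulo
  \<open>d\<close>, so \<open>d - 1\<close> surplus terms do the work of \<open>g * d - 1\<close>.
  This is the gain from a period of the signed sums.\<close>

lemma erdos_ginzburg_ziv_multiples:
  assumes "0 < d" "d dvd l" "l + d - 1 \<le> size S" "\<And>a. a \<in># S \<Longrightarrow> g dvd a"
  shows "\<exists>T. T \<subseteq># S \<and> size T = l \<and> g * int d dvd \<Sum>\<^sub># T"
proof -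
  let ?f = "\<lambda>a. a div g"
  obtain M where M: "M \<subseteq># image_mset ?f S" "size M = l" "int d dvd \<Sum>\<^sub># M"
    using erdos_ginzburg_ziv_length[OF assms(1,2), of "image_mset ?f S"] assms(3) by auto
  obtain Q where Q: "Q \<subseteq># S" "M = image_mset ?f Q" using subseteq_image_mset[OF M(1)] .
  have "a \<in># Q \<Longrightarrow> g dvd a" for a using Q(1) assms(4) by (meson mset_subset_eqD)
  then have "\<Sum>\<^sub># Q = g * \<Sum>\<^sub># (image_mset ?f Q)" by (induction Q) (auto simp: distrib_left)
  then show ?thesis using Q M by (intro exI[of _ Q]) auto
qed

section \<open>Signed sums modulo an odd number\<close>

definition signed_sums :: "int \<Rightarrow> nat \<Rightarrow> int multiset \<Rightarrow> int set" where
  "signed_sums \<delta> h U = {(\<Sum>\<^sub># V1 - \<Sum>\<^sub># V2) mod int h | V1 V2.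
     V1 + V2 \<subseteq># U \<and> even (size V1 + size V2) \<and> \<delta> dvd \<Sum>\<^sub># V1 - \<Sum>\<^sub># V2}"

lemma signed_sumsI:
  "V1 + V2 \<subseteq># U \<Longrightarrow> even (size V1 + size V2) \<Longrightarrow> \<delta> dvd \<Sum>\<^sub># V1 - \<Sum>\<^sub># V2 \<Longrightarrow>
    (\<Sum>\<^sub># V1 - \<Sum>\<^sub># V2) mod int h \<in> signed_sums \<delta> h U"
  unfolding signed_sums_def by blast

lemma signed_sumsE:
  assumes "v \<in> signed_sums \<delta> h U"
  obtains V1 V2 where "V1 + V2 \<subseteq># U" "even (size V1 + size V2)" "\<delta> dvd \<Sum>\<^sub># V1 - \<Sum>\<^sub># V2"
    "v = (\<Sum>\<^sub># V1 - \<Sum>\<^sub># V2) mod int h"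
  using assms unfolding signed_sums_def by blast

lemma signed_sums_subset: "0 < h \<Longrightarrow> signed_sums \<delta> h U \<subseteq> {0..<int h}"
  by (auto simp: signed_sums_def)

lemma zero_signed_sums: "0 \<in> signed_sums \<delta> h U"
  using signed_sumsI[of "{#}" "{#}" U \<delta> h] by simp

lemma uminus_signed_sums:
  assumes "v \<in> signed_sums \<delta> h U"
  shows "(- v) mod int h \<in> signed_sums \<delta> h U"
proof -
  obtain V1 V2 where V: "V1 + V2 \<subseteq># U" "even (size V1 + size V2)" "\<delta> dvd \<Sum>\<^sub># V1 - \<Sum>\<^sub># V2"
    "v = (\<Sum>\<^sub># V1 - \<Sum>\<^sub># V2) mod int h" using assms by (rule signed_sumsE)
  have "(\<Sum>\<^sub># V2 - \<Sum>\<^sub># V1) mod int h \<in> signed_sums \<delta> h U"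
    using V by (intro signed_sumsI) (simp_all add: add.commute dvd_diff_commute)
  moreover have "(- v) mod int h = (\<Sum>\<^sub># V2 - \<Sum>\<^sub># V1) mod int h"
    unfolding V(4) by (simp add: mod_minus_eq)
  ultimately show ?thesis by simp
qed

lemma signed_sums_add:
  assumes "v \<in> signed_sums \<delta> h U" "W1 + W2 + U \<subseteq># U'" "even (size W1 + size W2)"
    "\<delta> dvd \<Sum>\<^sub># W1 - \<Sum>\<^sub># W2"
  shows "(v + (\<Sum>\<^sub># W1 - \<Sum>\<^sub># W2)) mod int h \<in> signed_sums \<delta> h U'"
proof -
  obtain V1 V2 where V: "V1 + V2 \<subseteq># U" "even (size V1 + size V2)" "\<delta> dvd \<Sum>\<^sub># V1 - \<Sum>\<^sub># V2"
    "v = (\<Sum>\<^sub># V1 - \<Sum>\<^sub># V2) mod int h" using assms(1) by (rule signed_sumsE)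
  have *: "\<Sum>\<^sub># (V1 + W1) - \<Sum>\<^sub># (V2 + W2) = (\<Sum>\<^sub># V1 - \<Sum>\<^sub># V2) + (\<Sum>\<^sub># W1 - \<Sum>\<^sub># W2)" by simp
  have "(W1 + W2) + (V1 + V2) \<subseteq># U'"
    by (rule subset_mset.order_trans[OF subset_mset.add_left_mono[OF V(1)] assms(2)])
  then have "V1 + W1 + (V2 + W2) \<subseteq># U'" by (simp add: ac_simps)
  moreover have "even (size (V1 + W1) + size (V2 + W2))" using V(2) assms(3) by auto
  moreover have "\<delta> dvd \<Sum>\<^sub># (V1 + W1) - \<Sum>\<^sub># (V2 + W2)"
    unfolding * using V(3) assms(4) by (rule dvd_add)
  ultimately have "(\<Sum>\<^sub># (V1 + W1) - \<Sum>\<^sub># (V2 + W2)) mod int h \<in> signed_sums \<delta> h U'"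
    by (rule signed_sumsI)
  then show ?thesis unfolding * V(4) by (simp add: mod_add_left_eq)
qed

text \<open>Two further terms must bring two new sums. If \<open>v + x\<close> is new, so is its
  negative, because the set is symmetric; the two differ because \<open>h\<close> is odd and 0 is
  not new.\<close>

lemma card_signed_sums_grow:
  assumes "odd h" "{#a, a'#} + U \<subseteq># U'" "\<delta> dvd x" "x = a - a' \<or> x = a + a'"
    "\<not> stable h (signed_sums \<delta> h U) x"
  shows "card (signed_sums \<delta> h U) + 2 \<le> card (signed_sums \<delta> h U')"
proof -
  let ?A = "signed_sums \<delta> h U" and ?A' = "signed_sums \<delta> h U'"
  have h: "0 < h" using assms(1) by (simp add: odd_pos)
  have fin: "finite (signed_sums \<delta> h U)" for U
    using signed_sums_subset[OF h] finite_subset by blast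
  obtain W1 W2 where W: "{#a, a'#} = W1 + W2" "x = \<Sum>\<^sub># W1 - \<Sum>\<^sub># W2"
  proof (cases "x = a - a'")
    case True
    then show ?thesis using that[of "{#a#}" "{#a'#}"] by (simp add: add_mset_commute)
  next
    case False
    then show ?thesis using assms(4) that[of "{#a, a'#}" "{#}"] by simp
  qed
  have sW: "even (size W1 + size W2)" using W(1)[symmetric] by (simp flip: size_union)
  have in1: "(v + x) mod int h \<in> ?A'" if "v \<in> ?A" for v
    unfolding W(2) by (rule signed_sums_add[OF that]) (use assms(2,3) W sW in auto)
  have in2: "v \<in> ?A'" if "v \<in> ?A" for v
    using signed_sums_add[OF that, of "{#}" "{#}" U'] assms(2) that signed_sums_subset[OF h]
    by (metis (no_types, lifting) add.right_neutral atLeastLessThan_iff diff_zero dvd_0_right even_add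
        mod_pos_pos_trivial mset_subset_eq_add_right subset_eq subset_mset.order_trans sum_mset.empty
        add_cancel_left_left)
  obtain v where v: "v \<in> ?A" "(v + x) mod int h \<notin> ?A" using assms(5) by (auto simp: stable_def)
  let ?y = "(v + x) mod int h" and ?z = "(- ((v + x) mod int h)) mod int h"
  have zA: "?z \<notin> ?A"
  proof
    assume "?z \<in> ?A"
    then have "(- ?z) mod int h \<in> ?A" by (rule uminus_signed_sums)
    then show False using v(2) by (simp add: mod_minus_eq add.commute)
  qed
  have "?y \<noteq> ?z"
  proof
    assume "?y = ?z"
    then have "int h dvd ?y - (- ?y)" by (metis mod_eq_dvd_iff mod_mod_trivial)
    then have "int h dvd 2 * ?y" by simp
    moreover have "coprime (int h) 2" using assms(1) by (simp add: coprime_right_2_iff_odd)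
    ultimately have "int h dvd ?y" using coprime_dvd_mult_right_iff by blast
    then have "?y mod int h = 0" by (rule dvd_imp_mod_0)
    then have "?y = 0" by (simp only: mod_mod_trivial)
    then show False using v(2) zero_signed_sums by simp
  qed
  then have "card (insert ?y (insert ?z ?A)) = card ?A + 2" using v(2) zA fin by simp
  moreover have "insert ?y (insert ?z ?A) \<subseteq> ?A'"
    using in1[OF v(1)] in2 uminus_signed_sums[OF in1[OF v(1)]] by auto
  ultimately show ?thesis using card_mono[OF fin, of "insert ?y (insert ?z ?A)" U'] by simp
qed

text \<open>\<open>A\<close> is a union of classes modulo \<open>g\<close>, and each class that it
  misses consists of \<open>\<eta>\<close> residues modulo \<open>g * \<eta>\<close>. The elements
  of \<open>Z\<close> represent missed classes.\<close>

lemma card_periodic: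
  assumes "0 < g" "A \<subseteq> {0..<int (g * \<eta>)}" "\<And>x y. int g dvd x - y \<Longrightarrow> x mod int (g * \<eta>) \<in> A \<Longrightarrow> y mod int (g * \<eta>) \<in> A"
    "finite Z" "inj_on (\<lambda>x. x mod int g) Z" "\<And>x. x \<in> Z \<Longrightarrow> x mod int (g * \<eta>) \<notin> A"
  shows "card A + \<eta> * card Z \<le> g * \<eta>"
proof -
  let ?f = "\<lambda>(x, t). (x mod int g + int g * t)"
  have inj: "inj_on ?f (Z \<times> {0..<int \<eta>})"
  proof (rule inj_onI)
    fix p q assume pq: "p \<in> Z \<times> {0..<int \<eta>}" "q \<in> Z \<times> {0..<int \<eta>}" "?f p = ?f q"
    obtain x s y t where [simp]: "p = (x, s)" "q = (y, t)" by (cases p, cases q)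
    have "(x mod int g + int g * s) mod int g = (y mod int g + int g * t) mod int g" using pq(3) by simp
    then have "x mod int g = y mod int g" by simp
    moreover from this have "s = t" using pq(3) assms(1) by simp
    ultimately show "p = q" using assms(5) pq(1,2) by (auto simp: inj_on_def)
  qed
  have "?f p \<in> {0..<int (g * \<eta>)} - A" if "p \<in> Z \<times> {0..<int \<eta>}" for p
  proof -
    obtain x t where [simp]: "p = (x, t)" by (cases p)
    have t: "0 \<le> t" "t \<le> int \<eta> - 1" and x: "x \<in> Z" using that by auto
    have r: "0 \<le> x mod int g" "x mod int g < int g" using assms(1) by auto
    have "int g * t \<le> int g * (int \<eta> - 1)" using t(2) by (intro mult_left_mono) auto
    then have range: "0 \<le> ?f p" "?f p < int (g * \<eta>)"
      using r t(1) by (simp_all add: algebra_simps)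
    have "int g dvd ?f p - x" by (simp add: mod_eq_dvd_iff[symmetric])
    then have "?f p mod int (g * \<eta>) \<notin> A" using assms(3,6) x by blast
    then show ?thesis using range by simp
  qed
  then have sub: "?f ` (Z \<times> {0..<int \<eta>}) \<subseteq> {0..<int (g * \<eta>)} - A" by blast
  have cN: "card {0..<int (g * \<eta>)} = g * \<eta>"
    by (simp only: card_atLeastLessThan_int diff_zero nat_int)
  have "card Z * \<eta> = card (?f ` (Z \<times> {0..<int \<eta>}))"
    using inj by (simp add: card_image card_cartesian_product)
  also have "\<dots> \<le> card ({0..<int (g * \<eta>)} - A)" using sub by (intro card_mono) auto
  also have "\<dots> = g * \<eta> - card A" using cN card_Diff_subset[OF finite_subset[OF assms(2)] assms(2)] by simp
  finally have "card Z * \<eta> \<le> g * \<eta> - card A" .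
  moreover have "card A \<le> g * \<eta>" using card_mono[OF _ assms(2)] cN by simp
  ultimately show ?thesis by (simp add: mult.commute)
qed

text \<open>\<open>U\<close> is of maximal even size with more than \<open>size U\<close> signed sums. By maximality, any two
  remaining terms \<open>a\<close> and \<open>a'\<close> leave the set of signed sums invariant under \<open>a - a'\<close> and \<open>a + a'\<close>,
  hence under \<open>2 * a\<close>, and \<open>2\<close> is invertible modulo \<open>h\<close>.\<close>

lemma signed_sums_growth:
  fixes R :: "int multiset"
  assumes "odd h" "\<delta> dvd 2"
  obtains U g P where "U \<subseteq># R" "even (size U)" "0 < g" "g dvd h" "P 0"
    "\<forall>x y. int g dvd x - y \<longrightarrow> P x \<longrightarrow> P y"
    "\<forall>x. P x \<longrightarrow> (\<exists>V1 V2. V1 + V2 \<subseteq># U \<and> even (size V1 + size V2) \<and>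
       \<delta> dvd \<Sum>\<^sub># V1 - \<Sum>\<^sub># V2 \<and> int h dvd (\<Sum>\<^sub># V1 - \<Sum>\<^sub># V2) - x)"
    "\<forall>a a'. {#a, a'#} \<subseteq># R - U \<longrightarrow> \<delta> dvd a - a' \<longrightarrow> int g dvd a"
    "\<forall>Z. finite Z \<longrightarrow> inj_on (\<lambda>x. x mod int g) Z \<longrightarrow> (\<forall>x\<in>Z. \<not> P x) \<longrightarrow>
       size U + 1 + h div g * card Z \<le> h"
proof -
  let ?Q = "\<lambda>U. U \<subseteq># R \<and> even (size U) \<and> size U + 1 \<le> card (signed_sums \<delta> h U)"
  have h: "0 < h" using assms(1) by (simp add: odd_pos)
  have fin: "finite (signed_sums \<delta> h U)" for U
    using signed_sums_subset[OF h] finite_subset by blast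
  have "?Q {#}" using zero_signed_sums[of \<delta> h "{#}"] fin[of "{#}"]
    by (auto simp: Suc_le_eq card_gt_0_iff)
  moreover have "\<forall>U. ?Q U \<longrightarrow> size U < Suc (size R)" by (simp add: size_mset_mono less_Suc_eq_le)
  ultimately have "\<exists>U. ?Q U \<and> (\<forall>U'. ?Q U' \<longrightarrow> size U' \<le> size U)"
    by (rule ex_has_greatest_nat)
  then obtain U where U0: "?Q U \<and> (\<forall>U'. ?Q U' \<longrightarrow> size U' \<le> size U)" ..
  note U = conjunct1[OF U0] conjunct2[OF U0]
  let ?A = "signed_sums \<delta> h U"
  obtain g where g: "0 < g" "g dvd h" "\<And>x. stable h ?A x \<longleftrightarrow> int g dvd x"
    using stable_generator[OF signed_sums_subset[OF h] h] by blast
  obtain \<eta> where \<eta>: "h = g * \<eta>" using g(2) by blast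
    have per: "y mod int h \<in> ?A" if "int g dvd x - y" "x mod int h \<in> ?A" for x y
    proof -
      have "stable h ?A (y - x)" using g(3) that(1) by (simp add: dvd_diff_commute)
      then have "(x mod int h + (y - x)) mod int h \<in> ?A" using that(2) by (auto simp: stable_def)
      then show ?thesis by (simp add: mod_add_left_eq)
    qed
    have W: "int g dvd a" if pair: "{#a, a'#} \<subseteq># R - U" "\<delta> dvd a - a'" for a a'
    proof -
      have sub: "{#a, a'#} + U \<subseteq># R" using pair(1) U(1) by (simp add: subset_mset.le_diff_conv2)
      have "stable h ?A x" if x: "\<delta> dvd x" "x = a - a' \<or> x = a + a'" for x
      proof (rule ccontr)
        assume "\<not> stable h ?A x"
        from card_signed_sums_grow[OF assms(1) subset_mset.order_refl x this] U(1)
        have "?Q ({#a, a'#} + U)" using sub by simp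
        then have "size ({#a, a'#} + U) \<le> size U" by (rule U(2)[rule_format])
        then show False by simp
      qed
      moreover have "\<delta> dvd a + a'"
      proof -
        have "a + a' = (a - a') + 2 * a'" by simp
        then show ?thesis using pair(2) assms(2) by (metis dvd_add dvd_mult2)
      qed
      ultimately have "int g dvd a - a'" "int g dvd a + a'" using g(3) pair(2) by auto
      then have "int g dvd (a - a') + (a + a')" by (rule dvd_add)
      then have "int g dvd 2 * a" by simp
      moreover have "coprime (int g) 2"
        using assms(1) g(2) by (auto simp: coprime_right_2_iff_odd elim!: dvdE)
      ultimately show ?thesis using coprime_dvd_mult_right_iff by blast
    qed
    have cd: "size U + 1 + h div g * card Z \<le> h"
      if "finite Z" "inj_on (\<lambda>x. x mod int g) Z" "\<And>x. x \<in> Z \<Longrightarrow> x mod int h \<notin> ?A" for Z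
    proof -
      have "card ?A + \<eta> * card Z \<le> h"
        unfolding \<eta> using g(1) signed_sums_subset[OF h, of \<delta> U] per that
        by (intro card_periodic) (auto simp flip: \<eta>)
      then show ?thesis using U(1) g(1) \<eta> by simp
    qed
    have sm: "\<exists>V1 V2. V1 + V2 \<subseteq># U \<and> even (size V1 + size V2) \<and>
       \<delta> dvd \<Sum>\<^sub># V1 - \<Sum>\<^sub># V2 \<and> int h dvd (\<Sum>\<^sub># V1 - \<Sum>\<^sub># V2) - x" if "x mod int h \<in> ?A" for x
      using that by (elim signed_sumsE) (metis mod_eq_dvd_iff)
  show ?thesis
  \<comment> \<open>Later proofs see the signed sums only as a \<open>g\<close>-periodic predicate
    \<open>P\<close>. The last property with \<open>Z\<close> empty also gives
    \<open>size U < h\<close>.\<close>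
  proof (rule that[of U g "\<lambda>x. x mod int h \<in> ?A"])
    show "\<forall>x y. int g dvd x - y \<longrightarrow> x mod int h \<in> ?A \<longrightarrow> y mod int h \<in> ?A" using per by blast
    show "\<forall>a a'. {#a, a'#} \<subseteq># R - U \<longrightarrow> \<delta> dvd a - a' \<longrightarrow> int g dvd a" using W by blast
    show "\<forall>Z. finite Z \<longrightarrow> inj_on (\<lambda>x. x mod int g) Z \<longrightarrow> (\<forall>x\<in>Z. x mod int h \<notin> ?A) \<longrightarrow>
       size U + 1 + h div g * card Z \<le> h" using cd by blast
    show "\<forall>x. x mod int h \<in> ?A \<longrightarrow> (\<exists>V1 V2. V1 + V2 \<subseteq># U \<and> even (size V1 + size V2) \<and>
       \<delta> dvd \<Sum>\<^sub># V1 - \<Sum>\<^sub># V2 \<and> int h dvd (\<Sum>\<^sub># V1 - \<Sum>\<^sub># V2) - x)" using sm by blast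
  qed (use U(1) g zero_signed_sums in simp_all)
qed

section \<open>Ordered products of rotations and reflections\<close>

text \<open>Exponents stay unreduced, so that the same list can be read with another
  \<open>m\<close> or \<open>k\<close>. The price is associativity: for
  \<open>t = (0, True)\<close>, the exponent of \<open>t (t t)\<close> is \<open>- k\<close> and
  that of \<open>(t t) t\<close> is \<open>k\<close>. Hence \<open>elem_prod\<close> fixes the
  bracketing.\<close>

definition elem_mult :: "int \<Rightarrow> int \<times> bool \<Rightarrow> int \<times> bool \<Rightarrow> int \<times> bool" where
  "elem_mult k x y = ((if snd x then fst x - fst y else fst x + fst y) + (if snd x \<and> snd y then k else 0),
     snd x \<noteq> snd y)"

definition elem_prod :: "int \<Rightarrow> (int \<times> bool) list \<Rightarrow> int \<times> bool" where
  "elem_prod k xs = foldr (elem_mult k) xs (0, False)"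

definition has_value :: "int \<Rightarrow> (int \<times> bool) multiset \<Rightarrow> int \<Rightarrow> bool" where
  "has_value k T v \<longleftrightarrow> (\<exists>xs. mset xs = T \<and> elem_prod k xs = (v, False))"

definition elems :: "int multiset \<Rightarrow> int multiset \<Rightarrow> (int \<times> bool) multiset" where
  "elems R B = image_mset (\<lambda>i. (i, False)) R + image_mset (\<lambda>i. (i, True)) B"

lemma size_elems [simp]: "size (elems R B) = size R + size B"
  by (simp add: elems_def)

lemma elems_empty [simp]: "elems {#} {#} = {#}"
  by (simp add: elems_def)

lemma elems_add: "elems (R + R') (B + B') = elems R B + elems R' B'"
  by (simp add: elems_def)

lemma elems_mono: "R' \<subseteq># R \<Longrightarrow> B' \<subseteq># B \<Longrightarrow> elems R' B' \<subseteq># elems R B"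
  unfolding elems_def by (intro subset_mset.add_mono image_mset_subseteq_mono)

lemma elems_surj: obtains R B where "S = elems R B"
proof -
  have "\<exists>R B. S = elems R B"
  proof (induction S)
    case empty
    show ?case by (metis elems_empty)
  next
    case (add x S)
    then obtain R B where S: "S = elems R B" by blast
    obtain i b where x: "x = (i, b)" by (cases x)
    show ?case
    proof (cases b)
      case True
      then have "add_mset x S = elems R (add_mset i B)" by (simp add: S x elems_def)
      then show ?thesis by blast
    next
      case False
      then have "add_mset x S = elems (add_mset i R) B" by (simp add: S x elems_def)
      then show ?thesis by blast
    qed
  qed
  then show ?thesis using that by blast
qed

text \<open>As associativity fails, the suffix has to be a rotation; the blocks that are
  concatenated later all have such a product.\<close>

lemma elem_prod_append:
  assumes "elem_prod k ys = (j, False)"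
  shows "elem_prod k (xs @ ys) = (let (i, b) = elem_prod k xs in (if b then i - j else i + j, b))"
proof (induction xs)
  case Nil
  then show ?case using assms by (simp add: elem_prod_def)
next
  case (Cons x xs)
  then show ?case
    by (cases x; cases "elem_prod k xs") (auto simp: elem_prod_def elem_mult_def split: if_splits)
qed

lemma has_value_add: "has_value k S v \<Longrightarrow> has_value k T w \<Longrightarrow> has_value k (S + T) (v + w)"
  unfolding has_value_def using elem_prod_append by (metis (mono_tags, lifting) mset_append split_conv)

lemma has_value_empty: "has_value k {#} 0"
  by (auto simp: has_value_def elem_prod_def)

lemma has_value_rotation: "has_value k {#(a, False)#} a"
  unfolding has_value_def by (intro exI[of _ "[(a, False)]"]) (simp add: elem_prod_def elem_mult_def)

lemma has_value_rotations: "has_value k (elems R {#}) (\<Sum>\<^sub># R)"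
proof (induction R)
  case empty
  show ?case by (simp add: has_value_empty)
next
  case (add a R)
  from has_value_add[OF has_value_rotation this, of a] show ?case by (simp add: elems_def)
qed

lemma has_value_reflections: "has_value k {#(b, True), (c, True)#} (b - c + k)"
  unfolding has_value_def
  by (intro exI[of _ "[(b, True), (c, True)]"]) (simp add: elem_prod_def elem_mult_def)

text \<open>The value of an ordering in which the reflections with exponents in \<open>B1\<close> and \<open>B2\<close>
  alternate and the rotations with exponents in \<open>R2\<close> have an odd number of reflections to
  their left.\<close>

definition signed_value :: "int \<Rightarrow> int multiset \<Rightarrow> int multiset \<Rightarrow> int \<Rightarrow> bool" where
  "signed_value k R B v \<longleftrightarrow> (\<exists>R1 R2 B1 B2. R = R1 + R2 \<and> B = B1 + B2 \<and> size B1 = size B2 \<and>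
     v = \<Sum>\<^sub># R1 - \<Sum>\<^sub># R2 + \<Sum>\<^sub># B1 - \<Sum>\<^sub># B2 + k * int (size B1))"

lemma signed_valueI:
  "size B1 = size B2 \<Longrightarrow>
    signed_value k (R1 + R2) (B1 + B2) (\<Sum>\<^sub># R1 - \<Sum>\<^sub># R2 + \<Sum>\<^sub># B1 - \<Sum>\<^sub># B2 + k * int (size B1))"
  unfolding signed_value_def by blast

lemma signed_value_empty: "signed_value k {#} {#} 0"
  using signed_valueI[of "{#}" "{#}" k "{#}" "{#}"] by simp

lemma signed_value_add:
  assumes "signed_value k R B v" "signed_value k R' B' v'"
  shows "signed_value k (R + R') (B + B') (v + v')"
proof -
  obtain R1 R2 B1 B2 R1' R2' B1' B2' where
    "R = R1 + R2" "B = B1 + B2" "size B1 = size B2"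
    "v = \<Sum>\<^sub># R1 - \<Sum>\<^sub># R2 + \<Sum>\<^sub># B1 - \<Sum>\<^sub># B2 + k * int (size B1)"
    "R' = R1' + R2'" "B' = B1' + B2'" "size B1' = size B2'"
    "v' = \<Sum>\<^sub># R1' - \<Sum>\<^sub># R2' + \<Sum>\<^sub># B1' - \<Sum>\<^sub># B2' + k * int (size B1')"
    using assms unfolding signed_value_def by blast
  note * = this
  have "v + v' = \<Sum>\<^sub># (R1 + R1') - \<Sum>\<^sub># (R2 + R2') + \<Sum>\<^sub># (B1 + B1') - \<Sum>\<^sub># (B2 + B2') +
      k * int (size (B1 + B1'))"
    by (simp add: *(4,8) algebra_simps)
  moreover have "R + R' = (R1 + R1') + (R2 + R2')" "B + B' = (B1 + B1') + (B2 + B2')"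
    "size (B1 + B1') = size (B2 + B2')"
    using * by simp_all
  ultimately show ?thesis unfolding signed_value_def by blast
qed

lemma signed_value_pair:
  "signed_value k {#a, a'#} {#} (a - a')" "signed_value k {#a, a'#} {#} (a + a')"
  "signed_value k {#} {#b, b'#} (b - b' + k)"
  using signed_valueI[of "{#}" "{#}" k "{#a#}" "{#a'#}"]
    signed_valueI[of "{#}" "{#}" k "{#a, a'#}" "{#}"]
    signed_valueI[of "{#b#}" "{#b'#}" k "{#}" "{#}"]
  by (simp_all add: add_mset_commute)

lemma even_signed_value: "signed_value k R B v \<Longrightarrow> even (size B)"
  by (auto simp: signed_value_def)

text \<open>One reflection from \<open>B1\<close> and one from \<open>B2\<close> enclose all
  rotations of \<open>R2\<close>. The remaining reflections follow in pairs, and \<open>R1\<close>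
  stands outside. Without a reflection no rotation could be counted negatively.\<close>

lemma has_value_signed_value:
  assumes "signed_value k R B v" "B \<noteq> {#}"
  shows "has_value k (elems R B) v"
proof -
  obtain R1 R2 B1 B2 where *: "R = R1 + R2" "B = B1 + B2" "size B1 = size B2"
    "v = \<Sum>\<^sub># R1 - \<Sum>\<^sub># R2 + \<Sum>\<^sub># B1 - \<Sum>\<^sub># B2 + k * int (size B1)"
    using assms(1) unfolding signed_value_def by blast
  have pairs: "has_value k (elems {#} (B1 + B2)) (\<Sum>\<^sub># B1 - \<Sum>\<^sub># B2 + k * int (size B1))"
    if "size B1 = size B2" for B1 B2
    using that
  proof (induction B1 arbitrary: B2)
    case empty
    then show ?case by (simp add: has_value_empty)
  next
    case (add b B1)
    then obtain c B2' where B2: "B2 = add_mset c B2'" by (metis size_Suc_Diff1 size_eq_Suc_imp_eq_union size_add_mset)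
    then have "has_value k (elems {#} (B1 + B2')) (\<Sum>\<^sub># B1 - \<Sum>\<^sub># B2' + k * int (size B1))"
      using add by simp
    from has_value_add[OF has_value_reflections[of k b c] this] show ?case
      by (simp add: B2 elems_def algebra_simps add_mset_commute)
  qed
  have "B1 \<noteq> {#}" "B2 \<noteq> {#}" using *(2,3) assms(2) by auto
  then obtain b B1' c B2' where B: "B1 = add_mset b B1'" "B2 = add_mset c B2'"
    by (meson multiset_cases)
  obtain r2 where r2: "mset r2 = R2" by (metis ex_mset)
  have "elem_prod k (map (\<lambda>i. (i, False)) r2 @ [(c, True)]) = (sum_list r2 + c, True)"
    by (induction r2) (auto simp: elem_prod_def elem_mult_def)
  then have "elem_prod k ((b, True) # map (\<lambda>i. (i, False)) r2 @ [(c, True)]) = (b - (sum_list r2 + c) + k, False)"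
    by (simp add: elem_prod_def elem_mult_def)
  then have "has_value k (mset ((b, True) # map (\<lambda>i. (i, False)) r2 @ [(c, True)])) (b - (sum_list r2 + c) + k)"
    unfolding has_value_def by blast
  then have "has_value k (elems R2 {#b, c#}) (b - (\<Sum>\<^sub># R2 + c) + k)"
    by (simp add: elems_def sum_mset_sum_list add_mset_commute flip: r2)
  from has_value_add[OF has_value_rotations[of k R1] has_value_add[OF this pairs[of B1' B2']]]
  have "has_value k (elems R1 {#} + (elems R2 {#b, c#} + elems {#} (B1' + B2')))
    (\<Sum>\<^sub># R1 + (b - (\<Sum>\<^sub># R2 + c) + k + (\<Sum>\<^sub># B1' - \<Sum>\<^sub># B2' + k * int (size B1'))))"
    using *(3) by (simp add: B)
  moreover have "v = \<Sum>\<^sub># R1 + (b - (\<Sum>\<^sub># R2 + c) + k + (\<Sum>\<^sub># B1' - \<Sum>\<^sub># B2' + k * int (size B1')))"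
    using *(4) by (simp add: B algebra_simps)
  ultimately have "has_value k (elems R1 {#} + (elems R2 {#b, c#} + elems {#} (B1' + B2'))) v"
    by (simp only:)
  then show ?thesis by (simp add: *(1,2) B add_mset_commute flip: elems_add)
qed

text \<open>The ordering is kept, and all exponents change by multiples of \<open>n\<close>. This is
  how a sequence is viewed in a quotient group.\<close>

lemma has_value_cong:
  assumes "has_value k T v" "n dvd k - k'"
  shows "\<exists>v'. has_value k' T v' \<and> n dvd v - v'"
proof -
  have "snd (elem_prod k xs) = snd (elem_prod k' xs) \<and> n dvd fst (elem_prod k xs) - fst (elem_prod k' xs)" for xs
  proof (induction xs)
    case Nil
    show ?case by (simp add: elem_prod_def)
  next
    case (Cons x xs)
    have "n dvd (c + a) - (c + b)" "n dvd (c - a) - (c - b)" "n dvd (c - a + k) - (c - b + k')"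
      if "n dvd a - b" for a b c :: int
    proof -
      have "(c + a) - (c + b) = a - b" "(c - a) - (c - b) = - (a - b)"
        "(c - a + k) - (c - b + k') = (k - k') - (a - b)" by simp_all
      then show "n dvd (c + a) - (c + b)" "n dvd (c - a) - (c - b)" "n dvd (c - a + k) - (c - b + k')"
        using that assms(2) by (simp_all only: dvd_minus_iff dvd_diff)
    qed
    then show ?case using Cons by (auto simp: elem_prod_def elem_mult_def)
  qed
  then show ?thesis using assms(1) unfolding has_value_def
    by (metis fst_conv prod.collapse snd_conv)
qed

section \<open>Product-one subsequences of prescribed length\<close>

definition has_product_one :: "nat \<Rightarrow> int \<Rightarrow> nat \<Rightarrow> (int \<times> bool) multiset \<Rightarrow> bool" where
  "has_product_one m k l S \<longleftrightarrow> (\<exists>T v. T \<subseteq># S \<and> size T = l \<and> has_value k T v \<and> int m dvd v)"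

definition forces_product_one :: "nat \<Rightarrow> int \<Rightarrow> nat \<Rightarrow> nat \<Rightarrow> bool" where
  "forces_product_one m k N l \<longleftrightarrow> (\<forall>S. N \<le> size S \<longrightarrow> has_product_one m k l S)"

lemma has_product_one_mono: "has_product_one m k l S \<Longrightarrow> S \<subseteq># S' \<Longrightarrow> has_product_one m k l S'"
  unfolding has_product_one_def by (blast intro: subset_mset.order_trans)

lemma forces_product_oneI:
  assumes "\<And>R B. size R + size B = N \<Longrightarrow> has_product_one m k l (elems R B)"
  shows "forces_product_one m k N l"
  unfolding forces_product_one_def
proof (intro allI impI)
  fix S :: "(int \<times> bool) multiset" assume S: "N \<le> size S"
  obtain xs where xs: "mset xs = S" by (metis ex_mset)
  have "mset (take N xs) \<subseteq># S" using xs by (metis append_take_drop_id mset_append mset_subset_eq_add_left)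
  moreover obtain R B where RB: "mset (take N xs) = elems R B" by (rule elems_surj)
  moreover have "size R + size B = N" using arg_cong[OF RB, of size] arg_cong[OF xs, of size] S by simp
  ultimately show "has_product_one m k l S" using assms has_product_one_mono by metis
qed

lemma has_product_one_rotations:
  assumes "T \<subseteq># R" "size T = l" "int m dvd \<Sum>\<^sub># T"
  shows "has_product_one m k l (elems R B)"
  unfolding has_product_one_def
  by (intro exI[of _ "elems T {#}"] exI[of _ "\<Sum>\<^sub># T"])
    (use assms in \<open>auto intro: elems_mono has_value_rotations\<close>)

lemma has_product_one_signed:
  assumes "R' \<subseteq># R" "B' \<subseteq># B" "B' \<noteq> {#}" "size R' + size B' = l" "signed_value k R' B' v" "int m dvd v"
  shows "has_product_one m k l (elems R B)"
  unfolding has_product_one_def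
  by (intro exI[of _ "elems R' B'"] exI[of _ v])
    (use assms in \<open>auto intro: elems_mono has_value_signed_value\<close>)

section \<open>Rotations up to sign\<close>

text \<open>A common representative of \<open>a\<close> and \<open>- a\<close>: two rotations of the
  same class have a vanishing sum or difference modulo \<open>M\<close>, and there are
  \<open>M div 2 + 1\<close> classes.\<close>

definition pm_class :: "nat \<Rightarrow> int \<Rightarrow> int" where
  "pm_class M a = min (a mod int M) ((- a) mod int M)"

lemma pm_class_eqD:
  assumes "pm_class M a = pm_class M b"
  shows "int M dvd a - b \<or> int M dvd a + b"
proof -
  have "a mod int M = b mod int M \<or> a mod int M = (- b) mod int M \<or> (- a) mod int M = b mod int M \<or>
      (- a) mod int M = (- b) mod int M"
    using assms unfolding pm_class_def min_def by (auto split: if_splits)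
  then have "int M dvd a - b \<or> int M dvd a - (- b) \<or> int M dvd - a - b \<or> int M dvd - a - (- b)"
    by (simp only: mod_eq_dvd_iff)
  then show ?thesis
    by (metis add.commute add_uminus_conv_diff diff_minus_eq_add dvd_minus_iff minus_diff_eq uminus_add_conv_diff minus_add_distrib)
qed

lemma pm_class_range: "0 < M \<Longrightarrow> pm_class M a \<in> {0..int M div 2}"
proof -
  assume M: "0 < M"
  have "(- a) mod int M = (if a mod int M = 0 then 0 else int M - a mod int M)"
    by (rule zmod_zminus1_eq_if)
  moreover define r where "r = a mod int M"
  moreover have "0 \<le> r" "r < int M" using M by (simp_all add: r_def)
  ultimately show ?thesis unfolding pm_class_def by (auto simp: min_def)
qed

lemma rotation_pair:
  assumes "0 < M" "M div 2 + 1 < size R"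
  obtains a a' v where "{#a, a'#} \<subseteq># R" "signed_value k {#a, a'#} {#} v" "int M dvd v"
proof -
  have "pm_class M ` set_mset R \<subseteq> {0..int M div 2}" using pm_class_range[OF assms(1)] by blast
  moreover have "card {0..int M div 2} < size R" using assms by (simp add: nat_add_distrib nat_div_distrib)
  ultimately obtain a b where ab: "{#a, b#} \<subseteq># R" "pm_class M a = pm_class M b"
    using mset_pigeonhole[of "{0..int M div 2}" "pm_class M" R] by blast
  from pm_class_eqD[OF ab(2)] show ?thesis using ab(1) signed_value_pair that by blast
qed

text \<open>The last pair is taken from at least \<open>M div 2 + 2\<close> rotations, one more than
  there are classes.\<close>

lemma rotation_pairs:
  assumes "0 < M" "even c" "c + M div 2 \<le> size R"
  obtains R' v where "R' \<subseteq># R" "size R' = c" "signed_value k R' {#} v" "int M dvd v"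
proof -
  have "\<exists>R' v. R' \<subseteq># R \<and> size R' = 2 * j \<and> signed_value k R' {#} v \<and> int M dvd v"
    if "2 * j + M div 2 \<le> size R" for j
    using that
  proof (induction j arbitrary: R)
    case 0
    then show ?case using signed_value_empty by (intro exI[of _ "{#}"] exI[of _ 0]) simp
  next
    case (Suc j)
    obtain a a' v where p: "{#a, a'#} \<subseteq># R" "signed_value k {#a, a'#} {#} v" "int M dvd v"
      using rotation_pair[OF assms(1), of R k] Suc.prems by auto
    have "2 * j + M div 2 \<le> size (R - {#a, a'#})" using Suc.prems p(1) by (simp add: size_Diff_submset)
    then obtain R' v' where R': "R' \<subseteq># R - {#a, a'#}" "size R' = 2 * j" "signed_value k R' {#} v'" "int M dvd v'"
      using Suc.IH by blast
    have "{#a, a'#} + R' \<subseteq># R" using R'(1) p(1) by (intro add_subseteq_diff)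
    moreover have "signed_value k ({#a, a'#} + R') {#} (v + v')"
      using signed_value_add[OF p(2) R'(3)] by simp
    ultimately show ?case using R' p(3) by (intro exI[of _ "{#a, a'#} + R'"] exI[of _ "v + v'"]) auto
  qed
  then show ?thesis using assms(2,3) that by (metis evenE)
qed

text \<open>The reflections in \<open>B'\<close> make both signs available for each added rotation,
  so the length \<open>l\<close> can be reached with pairs of rotations that cancel.\<close>

lemma has_product_one_fill:
  assumes "V \<subseteq># R" "B' \<subseteq># B" "B' \<noteq> {#}" "signed_value k V B' v" "int m dvd v" "0 < m"
    "even l" "even (size V)" "size V + size B' \<le> l" "l + m div 2 \<le> size R + size B'"
  shows "has_product_one m k l (elems R B)"
proof -
  define c where "c = l - (size V + size B')"
  have "even c" "c + m div 2 \<le> size (R - V)"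
    using assms even_signed_value[OF assms(4)] size_mset_mono[OF assms(1)]
    by (auto simp: c_def size_Diff_submset)
  then obtain R' w where R': "R' \<subseteq># R - V" "size R' = c" "signed_value k R' {#} w" "int m dvd w"
    using rotation_pairs[OF assms(6), of c "R - V" k] by blast
  have "V + R' \<subseteq># R" using R'(1) assms(1) by (intro add_subseteq_diff)
  moreover have "signed_value k (V + R') B' (v + w)"
    using signed_value_add[OF assms(4) R'(3)] by simp
  ultimately show ?thesis
    using assms R' by (intro has_product_one_signed[of "V + R'" R B' B l k "v + w" m]) (auto simp: c_def)
qed

section \<open>Passing to the quotient by the center\<close>

text \<open>The allowance \<open>2 * l\<close> is what the first two blocks remove before the third
  is chosen. Two of the three integers \<open>v / m\<close> have the same parity.\<close>

lemma has_product_one_double: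
  assumes "\<And>S'. S' \<subseteq># S \<Longrightarrow> size S \<le> size S' + 2 * l \<Longrightarrow>
      \<exists>T v. T \<subseteq># S' \<and> size T = l \<and> has_value k T v \<and> int m dvd v"
  shows "has_product_one (2 * m) k (2 * l) S"
proof -
  obtain T1 v1 where 1: "T1 \<subseteq># S" "size T1 = l" "has_value k T1 v1" "int m dvd v1"
    using assms[of S] by auto
  obtain T2 v2 where 2: "T2 \<subseteq># S - T1" "size T2 = l" "has_value k T2 v2" "int m dvd v2"
    using assms[of "S - T1"] size_Diff_submset[OF 1(1)] 1(2) by fastforce
  have "S - T1 - T2 \<subseteq># S" by (meson diff_subset_eq_self subset_mset.order_trans)
  then obtain T3 v3 where 3: "T3 \<subseteq># S - T1 - T2" "size T3 = l" "has_value k T3 v3" "int m dvd v3"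
    using assms[of "S - T1 - T2"] size_Diff_submset[OF 1(1)] size_Diff_submset[OF 2(1)] 1(2) 2(2)
    by fastforce
  have all: "T1 + (T2 + T3) \<subseteq># S"
    by (intro add_subseteq_diff 1(1) 2(1) 3(1))
  have sub: "T1 + T2 \<subseteq># S" "T1 + T3 \<subseteq># S" "T2 + T3 \<subseteq># S"
    using mset_subset_eq_add_left[of "T1 + T2" T3] mset_subset_eq_add_left[of "T1 + T3" T2]
      mset_subset_eq_add_left[of "T2 + T3" T1]
    by (auto intro: subset_mset.order_trans[OF _ all] simp: ac_simps)
  obtain a b c where abc: "v1 = int m * a" "v2 = int m * b" "v3 = int m * c"
    using 1(4) 2(4) 3(4) by (metis dvdE)
  have "even (a + b) \<or> even (a + c) \<or> even (b + c)" by auto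
  then have "int (2 * m) dvd v1 + v2 \<or> int (2 * m) dvd v1 + v3 \<or> int (2 * m) dvd v2 + v3"
    using abc by (auto simp: mult.commute[of _ 2] simp flip: distrib_left)
  then show ?thesis
  proof (elim disjE)
    assume "int (2 * m) dvd v1 + v2"
    then show ?thesis unfolding has_product_one_def using sub(1) 1 2
      by (intro exI[of _ "T1 + T2"] exI[of _ "v1 + v2"]) (simp add: has_value_add)
  next
    assume "int (2 * m) dvd v1 + v3"
    then show ?thesis unfolding has_product_one_def using sub(2) 1 3
      by (intro exI[of _ "T1 + T3"] exI[of _ "v1 + v3"]) (simp add: has_value_add)
  next
    assume "int (2 * m) dvd v2 + v3"
    then show ?thesis unfolding has_product_one_def using sub(3) 2 3
      by (intro exI[of _ "T2 + T3"] exI[of _ "v2 + v3"]) (simp add: has_value_add)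
  qed
qed

text \<open>If \<open>m\<close> divides \<open>k\<close>, then \<open>t^2\<close> is trivial in the
  quotient, so the result for \<open>k = 0\<close> applies there; pulling it back preserves the
  value up to multiples of \<open>m\<close>.\<close>

lemma has_value_of_forces:
  assumes "forces_product_one m 0 N l" "int m dvd k" "N \<le> size S"
  obtains T v where "T \<subseteq># S" "size T = l" "has_value k T v" "int m dvd v"
proof -
  obtain T v where T: "T \<subseteq># S" "size T = l" "has_value 0 T v" "int m dvd v"
    using assms(1,3) unfolding forces_product_one_def has_product_one_def by blast
  obtain v' where v': "has_value k T v'" "int m dvd v - v'"
    using has_value_cong[OF T(3), of "int m" k] assms(2) by auto
  from v'(2) T(4) have "int m dvd v'" by (metis dvd_diff_left_iff dvd_diff_commute)
  then show ?thesis using T v'(1) that by blast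
qed

lemma forces_product_one_double:
  assumes "forces_product_one m 0 (2 * m) m" "int m dvd k"
  shows "forces_product_one (2 * m) k (4 * m) (2 * m)"
  unfolding forces_product_one_def
proof (intro allI impI has_product_one_double)
  fix S S' :: "(int \<times> bool) multiset" assume "4 * m \<le> size S" "size S \<le> size S' + 2 * m"
  then have "2 * m \<le> size S'" by simp
  then show "\<exists>T v. T \<subseteq># S' \<and> size T = m \<and> has_value k T v \<and> int m dvd v"
    using has_value_of_forces[OF assms] by metis
qed

section \<open>Dihedral groups of order twice an odd number\<close>

text \<open>Excluding all pairs inside the multiset also excludes repeated elements.\<close>

lemma mset_inj_pairs:
  assumes "\<And>a b. {#a, b#} \<subseteq># M \<Longrightarrow> f a \<noteq> f b"
  shows "inj_on f (set_mset M)" "card (set_mset M) = size M"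
proof -
  have "\<not> card (f ` set_mset M) < size M"
    using mset_pigeonhole[OF _ subset_refl, of f M] assms by auto
  moreover have "card (f ` set_mset M) \<le> card (set_mset M)" by (simp add: card_image_le)
  moreover have "card (set_mset M) \<le> size M"
    using size_mset_mono[OF mset_set_set_mset_msubset, of M] by simp
  ultimately show "card (set_mset M) = size M" "inj_on f (set_mset M)"
    by (simp_all add: eq_card_imp_inj_on)
qed

lemma member_pair:
  assumes "a \<in># M" "2 \<le> size M"
  obtains a' where "{#a, a'#} \<subseteq># M"
proof -
  obtain M' where M: "M = add_mset a M'" using assms(1) by (metis multi_member_split)
  then have "M' \<noteq> {#}" using assms(2) by auto
  then obtain a' where "a' \<in># M'" by blast
  then show ?thesis using M that[of a'] by simp
qed

lemma reflection_pair:
  assumes "0 < h" "h < size B"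
  obtains b b' where "{#b, b'#} \<subseteq># B" "int h dvd b - b'"
proof -
  have "(\<lambda>b. b mod int h) ` set_mset B \<subseteq> {0..<int h}" using assms(1) by auto
  from mset_pigeonhole[OF _ this] assms(2) obtain b b' where
    "{#b, b'#} \<subseteq># B" "b mod int h = b' mod int h" by auto
  then show ?thesis using that by (simp add: mod_eq_dvd_iff)
qed

lemma element_pair:
  assumes "0 < h" "h div 2 + 1 + h < size R + size B" "int h dvd k"
  obtains R' B' v where "R' \<subseteq># R" "B' \<subseteq># B" "size R' + size B' = 2" "signed_value k R' B' v" "int h dvd v"
proof (cases "h < size B")
  case True
  obtain b b' where "{#b, b'#} \<subseteq># B" "int h dvd b - b'" using reflection_pair[OF assms(1) True] .
  then show ?thesis
    using that[of "{#}" "{#b, b'#}" "b - b' + k"] signed_value_pair(3) assms(3) by simp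
next
  case False
  then have "h div 2 + 1 < size R" using assms(2) by simp
  then obtain a a' v where "{#a, a'#} \<subseteq># R" "signed_value k {#a, a'#} {#} v" "int h dvd v"
    using rotation_pair[OF assms(1)] by metis
  then show ?thesis using that[of "{#a, a'#}" "{#}" v] by simp
qed

lemma has_product_one_hit:
  assumes "V1 + V2 \<subseteq># R" "{#b, b'#} \<subseteq># B" "even (size V1 + size V2)"
    "int m dvd (\<Sum>\<^sub># V1 - \<Sum>\<^sub># V2) - (b' - b - k)" "0 < m" "even l"
    "size V1 + size V2 + 2 \<le> l" "l + m div 2 \<le> size R + 2"
  shows "has_product_one m k l (elems R B)"
proof (rule has_product_one_fill)
  show "signed_value k (V1 + V2) {#b, b'#} (\<Sum>\<^sub># V1 - \<Sum>\<^sub># V2 + (b - b' + k))"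
    using signed_valueI[of "{#b#}" "{#b'#}" k V1 V2] by (simp add: add_mset_commute algebra_simps)
  show "int m dvd \<Sum>\<^sub># V1 - \<Sum>\<^sub># V2 + (b - b' + k)"
    using assms(4) by (simp add: algebra_simps)
qed (use assms in auto)

text \<open>Fix \<open>b\<close> in \<open>B\<close>. The differences of the other elements with
  \<open>b\<close> all violate \<open>P\<close>, and they are distinct modulo \<open>g\<close>,
  since two congruent elements would satisfy \<open>P\<close> by periodicity. So they count as
  \<open>size B - 1\<close> missed classes, and
  \<open>\<eta> * (size B - 1) \<ge> \<eta> + size B - 2\<close>.\<close>

lemma no_hit_bound:
  assumes "0 < g" "0 < \<eta>" "P 0" "\<forall>x y. int g dvd x - y \<longrightarrow> P x \<longrightarrow> P y"
    and card: "\<forall>Z. finite Z \<longrightarrow> inj_on (\<lambda>x. x mod int g) Z \<longrightarrow> (\<forall>x\<in>Z. \<not> P x) \<longrightarrow>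
       u + 1 + \<eta> * card Z \<le> h"
    and no: "\<forall>b b'. {#b, b'#} \<subseteq># B \<longrightarrow> \<not> P (b' - b)" and "2 \<le> size B"
  shows "u + \<eta> + size B \<le> h + 1"
proof -
  obtain b where "b \<in># B" using assms(7) by fastforce
  then obtain B' where B': "B = add_mset b B'" by (metis multi_member_split)
  have ne: "(x - b) mod int g \<noteq> (y - b) mod int g" if xy: "{#x, y#} \<subseteq># B'" for x y
  proof
    assume "(x - b) mod int g = (y - b) mod int g"
    then have "int g dvd 0 - (y - x)" by (simp add: mod_eq_dvd_iff)
    then have "P (y - x)" using assms(3,4) by blast
    moreover have "{#x, y#} \<subseteq># B" using xy B' by (metis mset_subset_eq_add_right add_mset_add_single subset_mset.order_trans mset_subset_eq_add_left)
    ultimately show False using no by blast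
  qed
  let ?X = "(\<lambda>x. x - b) ` set_mset B'"
  have "inj_on (\<lambda>x. x mod int g) ?X"
    using mset_inj_pairs(1)[of B' "\<lambda>x. (x - b) mod int g", OF ne] by (auto simp: inj_on_def)
  moreover have "card ?X = size B'"
    using mset_inj_pairs(2)[of B' "\<lambda>x. (x - b) mod int g", OF ne] by (simp add: card_image)
  moreover have "\<not> P x" if x: "x \<in> ?X" for x
  proof -
    obtain y where y: "y \<in># B'" "x = y - b" using x by blast
    then have "{#b, y#} \<subseteq># B" using B' by simp
    then show ?thesis using no y(2) by blast
  qed
  ultimately have "u + 1 + \<eta> * size B' \<le> h" using card[rule_format, of ?X] by auto
  moreover obtain q where q: "size B' = Suc q" using assms(7) B' by (metis Suc_le_D size_add_mset Suc_le_mono numeral_2_eq_2)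
  moreover have "q \<le> \<eta> * q" using assms(2) by simp
  moreover have "\<eta> * size B' = \<eta> + \<eta> * q" "size B = Suc (size B')" using q B' by simp_all
  ultimately show ?thesis by linarith
qed

lemma dihedral_odd_few_reflections:
  assumes "odd h" "3 \<le> h" "size R + size B = 3 * h" "2 \<le> size B" "2 * size B \<le> h + 5"
  shows "has_product_one h 0 (2 * h) (elems R B)"
proof -
  obtain U g P where U: "U \<subseteq># R" "even (size U)" and g: "0 < g" "g dvd h" and P0: "P 0"
    and P_cong: "\<forall>x y. int g dvd x - y \<longrightarrow> P x \<longrightarrow> P y"
    and P_sum: "\<forall>x. P x \<longrightarrow> (\<exists>V1 V2. V1 + V2 \<subseteq># U \<and> even (size V1 + size V2) \<and>
       1 dvd \<Sum>\<^sub># V1 - \<Sum>\<^sub># V2 \<and> int h dvd (\<Sum>\<^sub># V1 - \<Sum>\<^sub># V2) - x)"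
    and W: "\<forall>a a'. {#a, a'#} \<subseteq># R - U \<longrightarrow> 1 dvd a - a' \<longrightarrow> int g dvd a"
    and card: "\<forall>Z. finite Z \<longrightarrow> inj_on (\<lambda>x. x mod int g) Z \<longrightarrow> (\<forall>x\<in>Z. \<not> P x) \<longrightarrow>
       size U + 1 + h div g * card Z \<le> h"
    by (rule signed_sums_growth[OF assms(1) one_dvd, of R])
  obtain \<eta> where \<eta>: "h = g * \<eta>" using g(2) by blast
  have \<eta>': "h div g = \<eta>" "0 < \<eta>" using \<eta> g(1) assms(2) by (simp, cases \<eta>, simp_all)
  show ?thesis
  proof (cases "\<exists>b b'. {#b, b'#} \<subseteq># B \<and> P (b' - b)")
    case True
    then obtain b b' where b: "{#b, b'#} \<subseteq># B" "P (b' - b)" by blast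
    obtain V1 V2 where V: "V1 + V2 \<subseteq># U" "even (size V1 + size V2)"
      "int h dvd (\<Sum>\<^sub># V1 - \<Sum>\<^sub># V2) - (b' - b)" using P_sum[rule_format, OF b(2)] by blast
    have "size U + 1 \<le> h" using card[rule_format, of "{}"] by simp
    then have "size V1 + size V2 + 2 \<le> 2 * h" using size_mset_mono[OF V(1)] assms(2) by simp
    \<comment> \<open>Equality holds for \<open>2 * size B = h + 5\<close>; this fixes the border
      between few and many reflections.\<close>
    moreover have "2 * h + h div 2 \<le> size R + 2" using assms(1,3,5) by (elim oddE) simp
    ultimately show ?thesis
      using V b U(1) assms(2) by (intro has_product_one_hit[of V1 V2 R b b']) (auto intro: subset_mset.order_trans)
  next
    case False
    have "size U + \<eta> + size B \<le> h + 1"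
      using no_hit_bound[OF g(1) \<eta>'(2) P0 P_cong, of "size U" h B] card False assms(4) \<eta>'(1) by auto
    \<comment> \<open>Exactly the \<open>\<eta> - 1\<close> surplus terms that are needed for
      multiples of \<open>g\<close> modulo \<open>h = g * \<eta>\<close>.\<close>
    then have WB: "2 * h + \<eta> - 1 \<le> size (R - U)"
      using assms(3) size_Diff_submset[OF U(1)] by linarith
    have "int g dvd a" if a: "a \<in># R - U" for a
    proof -
      have "2 \<le> size (R - U)" using WB assms(2) \<eta>' by linarith
      then obtain a' where "{#a, a'#} \<subseteq># R - U" using member_pair[OF a] by blast
      then show ?thesis using W by auto
    qed
    then obtain T where T: "T \<subseteq># R - U" "size T = 2 * h" "int g * int \<eta> dvd \<Sum>\<^sub># T"
      using erdos_ginzburg_ziv_multiples[of \<eta> "2 * h" "R - U" "int g"] \<eta>' WB \<eta> by auto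
    then show ?thesis
      using \<eta> by (intro has_product_one_rotations[of T]) (auto intro: subset_mset.order_trans)
  qed
qed

text \<open>If all residues are distinct, the set of residues and its negative share at least
  \<open>2 * size B - h \<ge> 5\<close> elements. Outside \<open>0\<close>, \<open>r\<close> and
  \<open>- r\<close> there is still a common \<open>s\<close>, and reflections with residues
  \<open>r\<close>, \<open>- r\<close>, \<open>s\<close>, \<open>- s\<close> cancel as
  \<open>b1 + b2 - b3 - b4\<close>.\<close>

lemma reflection_block:
  assumes "odd h" "h + 5 \<le> 2 * size B"
  obtains B' v where "B' \<subseteq># B" "size B' = 2 \<or> size B' = 4 \<and> 5 \<le> h" "signed_value 0 {#} B' v" "int h dvd v"
proof (cases "\<exists>b b'. {#b, b'#} \<subseteq># B \<and> int h dvd b - b'")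
  case True
  then obtain b b' where "{#b, b'#} \<subseteq># B" "int h dvd b - b'" by blast
  then show ?thesis using that[of "{#b, b'#}" "b - b'"] signed_value_pair(3)[of 0 b b'] by simp
next
  case False
  have h: "0 < h" using assms(1) by (simp add: odd_pos)
  have inj: "inj_on (\<lambda>b. b mod int h) (set_mset B)" and cB: "card (set_mset B) = size B"
    using mset_inj_pairs[of B "\<lambda>b. b mod int h"] False by (auto simp: mod_eq_dvd_iff)
  let ?X = "(\<lambda>b. b mod int h) ` set_mset B" and ?Y = "(\<lambda>b. (- b) mod int h) ` set_mset B"
  have inj': "inj_on (\<lambda>b. (- b) mod int h) (set_mset B)"
  proof (rule inj_onI)
    fix x y assume "x \<in># B" "y \<in># B" "(- x) mod int h = (- y) mod int h"
    then show "x = y" using inj by (metis inj_onD mod_minus_cong minus_minus)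
  qed
  have sub: "?X \<union> ?Y \<subseteq> {0..<int h}" using h by auto
  have "card (?X \<union> ?Y) \<le> h" using card_mono[OF _ sub] by simp
  moreover have "card ?X + card ?Y = card (?X \<union> ?Y) + card (?X \<inter> ?Y)"
    by (rule card_Un_Int) auto
  moreover have "card ?X = size B" "card ?Y = size B" using inj inj' cB by (simp_all add: card_image)
  ultimately have c5: "5 \<le> card (?X \<inter> ?Y)" using assms(2) by linarith
  have h5: "5 \<le> h" using c5 card_mono[of "{0..<int h}" "?X \<inter> ?Y"] le_infI1[of ?X "{0..<int h}" ?Y] sub by simp
  have sym: "(- r) mod int h \<in> ?X" if "r \<in> ?Y" for r
    using that by (auto simp: mod_minus_eq)
  have "4 \<le> card (?X \<inter> ?Y - {0})" using c5 diff_card_le_card_Diff[of "{0}" "?X \<inter> ?Y"] by simp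
  then have "?X \<inter> ?Y - {0} \<noteq> {}" by (metis card.empty not_numeral_le_zero)
  then obtain r where r: "r \<in> ?X \<inter> ?Y" "r \<noteq> 0" by blast
  have "card {0, r, (- r) mod int h} \<le> 3" by (simp add: card_insert_if)
  then have "2 \<le> card (?X \<inter> ?Y - {0, r, (- r) mod int h})"
    using c5 diff_card_le_card_Diff[of "{0, r, (- r) mod int h}" "?X \<inter> ?Y"] by simp
  then have "?X \<inter> ?Y - {0, r, (- r) mod int h} \<noteq> {}" by (metis card.empty not_numeral_le_zero)
  then obtain s where s: "s \<in> ?X \<inter> ?Y" "s \<noteq> 0" "s \<noteq> r" "s \<noteq> (- r) mod int h" by blast
  have self: "x \<noteq> (- x) mod int h" if "x \<in> ?X" "x \<noteq> 0" for x
  proof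
    assume x: "x = (- x) mod int h"
    have x0: "x mod int h = x" using that(1) by auto
    then have "x mod int h = (- x) mod int h" using x by simp
    then have "int h dvd x - (- x)" by (simp only: mod_eq_dvd_iff)
    then have "int h dvd 2 * x" by simp
    moreover have "coprime (int h) 2" using assms(1) by (simp add: coprime_right_2_iff_odd)
    ultimately have "int h dvd x" using coprime_dvd_mult_right_iff by blast
    then show False using x0 that(2) by simp
  qed
  obtain b1 where b1: "b1 \<in># B" "b1 mod int h = r" using r(1) by blast
  obtain b3 where b3: "b3 \<in># B" "b3 mod int h = s" using s(1) by blast
  have "(- r) mod int h \<in> ?X" "(- s) mod int h \<in> ?X" using sym r(1) s(1) by blast+
  then obtain b2 b4 where b24: "b2 \<in># B" "b2 mod int h = (- r) mod int h"
    "b4 \<in># B" "b4 mod int h = (- s) mod int h"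
    by (elim imageE) metis
  note b = b1(1) b24(1) b3(1) b24(3) b1(2) b24(2) b3(2) b24(4)
  have rs: "r mod int h = r" "s mod int h = s" using r(1) s(1) by auto
  have sr: "(- s) mod int h \<noteq> r"
  proof
    assume "(- s) mod int h = r"
    from arg_cong[OF this, of "\<lambda>x. (- x) mod int h"] have "s mod int h = (- r) mod int h"
      by (simp add: mod_minus_eq)
    then show False using s(4) rs by simp
  qed
  have sr': "(- s) mod int h \<noteq> (- r) mod int h"
  proof
    assume "(- s) mod int h = (- r) mod int h"
    from arg_cong[OF this, of "\<lambda>x. (- x) mod int h"] have "s mod int h = r mod int h"
      by (simp add: mod_minus_eq)
    then show False using s(3) rs by simp
  qed
  have ne: "r \<noteq> (- r) mod int h" "s \<noteq> (- s) mod int h" using self r s by blast+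
  have "b1 \<noteq> b2" using b(5,6) ne(1) by metis
  moreover have "b1 \<noteq> b3" using b(5,7) s(3) by metis
  moreover have "b1 \<noteq> b4" using b(5,8) sr by metis
  moreover have "b2 \<noteq> b3" using b(6,7) s(4) by metis
  moreover have "b2 \<noteq> b4" using b(6,8) sr' by metis
  moreover have "b3 \<noteq> b4" using b(7,8) ne(2) by metis
  ultimately have "{#b1, b2, b3, b4#} \<subseteq># B" using b(1-4) by (simp add: insert_subset_eq_iff in_diff_count)
  moreover have "signed_value 0 {#} {#b1, b2, b3, b4#} (b1 + b2 - b3 - b4)"
    using signed_valueI[of "{#b1, b2#}" "{#b3, b4#}" 0 "{#}" "{#}"] by (simp add: add_mset_commute algebra_simps)
  moreover have "int h dvd b1 + b2 - b3 - b4"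
  proof -
    have "int h dvd b1 - r" "int h dvd b2 - (- r)" "int h dvd b3 - s" "int h dvd b4 - (- s)"
      by (simp_all only: mod_eq_dvd_iff[symmetric] b(5-8) rs)
    then have "int h dvd ((b1 - r) + (b2 - (- r))) - ((b3 - s) + (b4 - (- s)))"
      by (meson dvd_diff dvd_add)
    then show ?thesis by (simp add: algebra_simps)
  qed
  ultimately show ?thesis using h5 by (intro that[of "{#b1, b2, b3, b4#}"]) auto
qed

text \<open>If no pair cancels and there are few reflections, the rotations represent every class up
  to sign. One of them then balances \<open>b - b'\<close>, and a rotation of value 0 is added to
  make the size even.\<close>

lemma dihedral_odd_block:
  assumes "odd h" "3 \<le> h" "h + 2 \<le> size R + size B"
  obtains R' B' v where "R' \<subseteq># R" "B' \<subseteq># B" "size R' + size B' = 2 \<or> size R' + size B' = 4"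
    "signed_value 0 R' B' v" "int h dvd v"
proof -
  have h: "0 < h" "h = 2 * (h div 2) + 1" using assms by auto
  consider "\<exists>a a'. {#a, a'#} \<subseteq># R \<and> pm_class h a = pm_class h a'"
    | "\<exists>b b'. {#b, b'#} \<subseteq># B \<and> int h dvd b - b'"
    | "h + 5 \<le> 2 * size B"
    | "\<And>a a'. {#a, a'#} \<subseteq># R \<Longrightarrow> pm_class h a \<noteq> pm_class h a'"
      "\<And>b b'. {#b, b'#} \<subseteq># B \<Longrightarrow> \<not> int h dvd b - b'" "2 * size B < h + 5"
    by (meson not_le)
  then show ?thesis
  proof cases
    case 1
    then obtain a a' where a: "{#a, a'#} \<subseteq># R" "pm_class h a = pm_class h a'" by blast
    from pm_class_eqD[OF a(2)] show ?thesis
      using a(1) signed_value_pair[of 0 a a'] that[of "{#a, a'#}" "{#}"] by auto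
  next
    case 2
    then obtain b b' where "{#b, b'#} \<subseteq># B" "int h dvd b - b'" by blast
    then show ?thesis using signed_value_pair(3)[of 0 b b'] that[of "{#}" "{#b, b'#}" "b - b'"] by simp
  next
    case 3
    obtain B' v where "B' \<subseteq># B" "size B' = 2 \<or> size B' = 4 \<and> 5 \<le> h" "signed_value 0 {#} B' v" "int h dvd v"
      using reflection_block[OF assms(1) 3] .
    then show ?thesis using that[of "{#}" B' v] by auto
  next
    case 4
    have range: "pm_class h ` set_mset R \<subseteq> {0..int h div 2}" using pm_class_range[OF h(1)] by blast
    have cX: "card {0..int h div 2} = h div 2 + 1" by (simp add: nat_add_distrib nat_div_distrib)
    have "size B \<le> h div 2 + 2" using 4(3) h(2) by linarith
    then have "card {0..int h div 2} \<le> size R" using cX assms(3) h(2) by linarith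
    then have surj: "pm_class h ` set_mset R = {0..int h div 2}"
      using mset_pigeonhole_tight[OF _ range _ 4(1)] by simp
    have "size R \<le> h div 2 + 1"
      using mset_pigeonhole[OF _ range] 4(1) cX by (metis finite_atLeastAtMost_int not_le)
    then have "2 \<le> size B" using assms(2,3) h(2) by linarith
    moreover from this obtain b where "b \<in># B" by fastforce
    ultimately obtain b' where b: "{#b, b'#} \<subseteq># B" using member_pair by metis
    have "pm_class h 0 \<in> pm_class h ` set_mset R" "pm_class h (b - b') \<in> pm_class h ` set_mset R"
      unfolding surj using pm_class_range[OF h(1)] by auto
    then obtain r0 r where r: "r0 \<in># R" "pm_class h r0 = pm_class h 0" "r \<in># R" "pm_class h r = pm_class h (b - b')"
      by (metis imageE)
    have "r0 \<noteq> r" using r(2,4) pm_class_eqD[of h "b - b'" 0] 4(2)[OF b] by auto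
    then have sub: "{#r0, r#} \<subseteq># R" using r(1,3) by (simp add: insert_subset_eq_iff in_diff_count)
    have r0: "int h dvd r0" using pm_class_eqD[OF r(2)] by simp
    from pm_class_eqD[OF r(4)] show ?thesis
    proof
      assume "int h dvd r - (b - b')"
      with r0 have "int h dvd r0 - (r - (b - b'))" by (rule dvd_diff)
      moreover have "signed_value 0 {#r0, r#} {#b, b'#} (r0 - (r - (b - b')))"
        using signed_value_add[OF signed_value_pair(1)[of 0 r0 r] signed_value_pair(3)[of 0 b b']]
        by (simp add: algebra_simps)
      ultimately show ?thesis using sub b that[of "{#r0, r#}" "{#b, b'#}"] by simp
    next
      assume "int h dvd r + (b - b')"
      with r0 have "int h dvd r0 + (r + (b - b'))" by (rule dvd_add)
      moreover have "signed_value 0 {#r0, r#} {#b, b'#} (r0 + (r + (b - b')))"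
        using signed_value_add[OF signed_value_pair(2)[of 0 r0 r] signed_value_pair(3)[of 0 b b']]
        by (simp add: algebra_simps)
      ultimately show ?thesis using sub b that[of "{#r0, r#}" "{#b, b'#}"] by simp
    qed
  qed
qed

text \<open>Blocks of size 4 may miss \<open>c\<close> by 2; the gap is closed with a pair that was set aside.\<close>

lemma dihedral_odd_blocks:
  assumes "odd h" "3 \<le> h" "even c" "c + h \<le> size R + size B + 2"
  shows "\<exists>R' B' v. R' \<subseteq># R \<and> B' \<subseteq># B \<and> (size R' + size B' = c \<or> size R' + size B' + 2 = c) \<and>
    signed_value 0 R' B' v \<and> int h dvd v"
  using assms(3,4)
proof (induction c arbitrary: R B rule: less_induct)
  case (less c)
  show ?case
  proof (cases "c < 4")
    case True
    then have "c = 0 \<or> c = 2" using less.prems(1) by presburger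
    then show ?thesis using signed_value_empty
      by (intro exI[of _ "{#}"] exI[of _ 0]) auto
  next
    case False
    then obtain R1 B1 v1 where 1: "R1 \<subseteq># R" "B1 \<subseteq># B" "size R1 + size B1 = 2 \<or> size R1 + size B1 = 4"
      "signed_value 0 R1 B1 v1" "int h dvd v1"
      using dihedral_odd_block[OF assms(1,2), of R B] less.prems by auto
    define c' where "c' = c - (size R1 + size B1)"
    have s: "even (size R1 + size B1)" "0 < size R1 + size B1" "size R1 + size B1 \<le> c"
      using 1(3) False by (elim disjE; simp del: even_add)+
    have "c' < c" "even c'" using s less.prems(1) False by (auto simp: c'_def)
    moreover have "c' + h \<le> size (R - R1) + size (B - B1) + 2"
      using s(3) less.prems(2) size_mset_mono[OF 1(1)] size_mset_mono[OF 1(2)]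
      by (simp add: c'_def size_Diff_submset 1(1,2))
    ultimately
    obtain R2 B2 v2 where 2: "R2 \<subseteq># R - R1" "B2 \<subseteq># B - B1"
      "size R2 + size B2 = c' \<or> size R2 + size B2 + 2 = c'" "signed_value 0 R2 B2 v2" "int h dvd v2"
      using less.IH by metis
    have "R1 + R2 \<subseteq># R" "B1 + B2 \<subseteq># B" using 1 2 by (auto intro: add_subseteq_diff)
    moreover have "size (R1 + R2) + size (B1 + B2) = c \<or> size (R1 + R2) + size (B1 + B2) + 2 = c"
      using 1(3) 2(3) False by (auto simp: c'_def)
    ultimately show ?thesis
      using signed_value_add[OF 1(4) 2(4)] dvd_add[OF 1(5) 2(5)]
      by (intro exI[of _ "R1 + R2"] exI[of _ "B1 + B2"] exI[of _ "v1 + v2"] conjI)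
  qed
qed

lemma dihedral_odd_many_reflections:
  assumes "odd h" "3 \<le> h" "size R + size B = 3 * h" "h + 5 \<le> 2 * size B"
  shows "has_product_one h 0 (2 * h) (elems R B)"
proof -
  obtain B0 v0 where B0: "B0 \<subseteq># B" "size B0 = 2 \<or> size B0 = 4 \<and> 5 \<le> h" "signed_value 0 {#} B0 v0" "int h dvd v0"
    using reflection_block[OF assms(1,4)] .
  \<comment> \<open>Here it matters that blocks of four occur only for \<open>h \<ge> 5\<close>: for
    \<open>h = 3\<close> they would leave five elements, too few to force a pair.\<close>
  have "h div 2 + 1 + h < size R + size (B - B0)"
    using B0(2) assms(1-3) size_Diff_submset[OF B0(1)] size_mset_mono[OF B0(1)] by (elim oddE) auto
  then obtain R1 B1 v1 where 1: "R1 \<subseteq># R" "B1 \<subseteq># B - B0" "size R1 + size B1 = 2"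
    "signed_value 0 R1 B1 v1" "int h dvd v1"
    using element_pair[of h R "B - B0" 0] assms(2) by auto
  define c where "c = 2 * h - size B0"
  have "even c" using B0(2) by (auto simp: c_def)
  moreover have "c + h \<le> size (R - R1) + size (B - B0 - B1) + 2"
    using B0(2) 1(3) assms(2,3) size_mset_mono[OF B0(1)] size_mset_mono[OF 1(1)] size_mset_mono[OF 1(2)]
      size_Diff_submset[OF B0(1)] size_Diff_submset[OF 1(1)] size_Diff_submset[OF 1(2)]
    unfolding c_def by linarith
  ultimately obtain R2 B2 v2 where 2: "R2 \<subseteq># R - R1" "B2 \<subseteq># B - B0 - B1"
    "size R2 + size B2 = c \<or> size R2 + size B2 + 2 = c" "signed_value 0 R2 B2 v2" "int h dvd v2"
    using dihedral_odd_blocks[OF assms(1,2)] by blast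
  have sub: "R1 + R2 \<subseteq># R" "B0 + (B1 + B2) \<subseteq># B" using B0 1 2 by (auto intro!: add_subseteq_diff)
  have ne: "B0 \<noteq> {#}" "size B0 \<le> 2 * h" using B0(2) assms(2) by auto
  from 2(3) show ?thesis
  proof
    assume "size R2 + size B2 = c"
    then show ?thesis
      using sub ne signed_value_add[OF B0(3) 2(4)] B0(4) 2(5)
      by (intro has_product_one_signed[of R2 R "B0 + B2" B "2 * h" 0 "v0 + v2" h])
        (auto simp: c_def intro: subset_mset.order_trans[OF _ sub(1)] subset_mset.order_trans[OF _ sub(2)])
  next
    assume "size R2 + size B2 + 2 = c"
    then show ?thesis
      using sub ne signed_value_add[OF B0(3) signed_value_add[OF 1(4) 2(4)]] B0(4) 1(3,5) 2(5)
      by (intro has_product_one_signed[of "R1 + R2" R "B0 + (B1 + B2)" B "2 * h" 0 "v0 + (v1 + v2)" h])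
        (auto simp: c_def)
  qed
qed

lemma forces_product_one_dihedral_odd:
  assumes "odd h" "3 \<le> h"
  shows "forces_product_one h 0 (3 * h) (2 * h)"
proof (rule forces_product_oneI)
  fix R B :: "int multiset" assume N: "size R + size B = 3 * h"
  consider "size B \<le> 1" | "2 \<le> size B" "2 * size B \<le> h + 5" | "h + 5 \<le> 2 * size B" by linarith
  then show "has_product_one h 0 (2 * h) (elems R B)"
  proof cases
    case 1
    then have "2 * h + h - 1 \<le> size R" using N by linarith
    then obtain T where "T \<subseteq># R" "size T = 2 * h" "int h dvd \<Sum>\<^sub># T"
      using erdos_ginzburg_ziv_length[of h "2 * h" R] assms(2) by auto
    then show ?thesis by (rule has_product_one_rotations)
  next
    case 2
    then show ?thesis using dihedral_odd_few_reflections assms N by blast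
  next
    case 3
    then show ?thesis using dihedral_odd_many_reflections assms N by blast
  qed
qed

section \<open>Dihedral groups of order divisible by four\<close>

lemma pair_members: "{#a, b#} \<subseteq># M \<Longrightarrow> a \<in># M" "{#a, b#} \<subseteq># M \<Longrightarrow> b \<in># M"
  by (auto dest: mset_subset_eqD)

lemma even_sum_mset_same_parity:
  assumes "\<And>a b. a \<in># T \<Longrightarrow> b \<in># T \<Longrightarrow> even (a - b)" "even (size T)"
  shows "even (\<Sum>\<^sub># T :: int)"
proof -
  have "even (\<Sum>\<^sub># T - int (size T) * c)" if "\<And>a. a \<in># T \<Longrightarrow> even (a - c)" for c
    using that by (induction T) (auto simp: algebra_simps)
  moreover have "T = {#} \<or> (\<exists>c. c \<in># T)" by auto
  ultimately show ?thesis using assms by (metis dvd_diff_left_iff dvd_mult2 even_of_nat sum_mset.empty dvd_0_right)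
qed

text \<open>Modulo \<open>2 * h\<close>, reflections with an odd difference can only be balanced by
  rotations with an odd sum. So signed sums are formed modulo \<open>h\<close> from even sums, and
  an odd contribution comes separately from two rotations of opposite parity outside
  \<open>U\<close>.\<close>

lemma dihedral_double_odd_few_reflections:
  assumes "odd h" "3 \<le> h" "size R + size B = 4 * h" "2 \<le> size B" "size B \<le> h + 2"
  shows "has_product_one (2 * h) 0 (2 * h) (elems R B)"
proof -
  obtain U g P where U: "U \<subseteq># R" "even (size U)" and g: "0 < g" "g dvd h" and P0: "P 0"
    and P_cong: "\<forall>x y. int g dvd x - y \<longrightarrow> P x \<longrightarrow> P y"
    and P_sum: "\<forall>x. P x \<longrightarrow> (\<exists>V1 V2. V1 + V2 \<subseteq># U \<and> even (size V1 + size V2) \<and>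
       2 dvd \<Sum>\<^sub># V1 - \<Sum>\<^sub># V2 \<and> int h dvd (\<Sum>\<^sub># V1 - \<Sum>\<^sub># V2) - x)"
    and W: "\<forall>a a'. {#a, a'#} \<subseteq># R - U \<longrightarrow> 2 dvd a - a' \<longrightarrow> int g dvd a"
    and card: "\<forall>Z. finite Z \<longrightarrow> inj_on (\<lambda>x. x mod int g) Z \<longrightarrow> (\<forall>x\<in>Z. \<not> P x) \<longrightarrow>
       size U + 1 + h div g * card Z \<le> h"
    by (rule signed_sums_growth[OF assms(1) dvd_refl, of R])
  obtain \<eta> where \<eta>: "h = g * \<eta>" using g(2) by blast
  have \<eta>': "h div g = \<eta>" "0 < \<eta>" "\<eta> \<le> h" using \<eta> g(1) assms(2) by (simp, cases \<eta>, simp_all)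
  have Uh: "size U + 1 \<le> h" using card[rule_format, of "{}"] by simp
  have cop: "coprime (int h) 2" using assms(1) by (simp add: coprime_right_2_iff_odd)
  have dvd2h: "int (2 * h) dvd x" if "int h dvd x" "even x" for x
    using divides_mult[OF that(2,1)] cop by (simp add: coprime_commute)
  have fill: "2 * h + (2 * h) div 2 \<le> size R + 2" using assms(3,5) by simp
  let ?W = "R - U"
  have sW: "size ?W = size R - size U" "size U \<le> size R"
    using size_Diff_submset[OF U(1)] size_mset_mono[OF U(1)] by simp_all
  consider (hit1) b b' where "{#b, b'#} \<subseteq># B" "even (b' - b)" "P (b' - b)"
    | (hit2) b b' w w' where "{#b, b'#} \<subseteq># B" "odd (b' - b)" "{#w, w'#} \<subseteq># ?W" "odd (w + w')"
        "P (b' - b - (w + w'))"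
    | (no) "\<And>b b'. {#b, b'#} \<subseteq># B \<Longrightarrow> even (b' - b) \<Longrightarrow> \<not> P (b' - b)"
      "\<And>b b' w w'. {#b, b'#} \<subseteq># B \<Longrightarrow> odd (b' - b) \<Longrightarrow> {#w, w'#} \<subseteq># ?W \<Longrightarrow> odd (w + w') \<Longrightarrow>
        \<not> P (b' - b - (w + w'))"
    by blast
  then show ?thesis
  proof cases
    case hit1
    obtain V1 V2 where V: "V1 + V2 \<subseteq># U" "even (size V1 + size V2)" "2 dvd \<Sum>\<^sub># V1 - \<Sum>\<^sub># V2"
      "int h dvd (\<Sum>\<^sub># V1 - \<Sum>\<^sub># V2) - (b' - b)" using P_sum[rule_format, OF hit1(3)] by blast
    show ?thesis
    proof (rule has_product_one_hit)
      show "V1 + V2 \<subseteq># R" by (rule subset_mset.order_trans[OF V(1) U(1)])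
      show "int (2 * h) dvd (\<Sum>\<^sub># V1 - \<Sum>\<^sub># V2) - (b' - b - 0)"
        using V(3,4) hit1(2) by (intro dvd2h) auto
      show "size V1 + size V2 + 2 \<le> 2 * h" using size_mset_mono[OF V(1)] Uh assms(2) by simp
    qed (use hit1(1) V(2) assms(2) fill in simp_all)
  next
    case hit2
    obtain V1 V2 where V: "V1 + V2 \<subseteq># U" "even (size V1 + size V2)" "2 dvd \<Sum>\<^sub># V1 - \<Sum>\<^sub># V2"
      "int h dvd (\<Sum>\<^sub># V1 - \<Sum>\<^sub># V2) - (b' - b - (w + w'))" using P_sum[rule_format, OF hit2(5)] by blast
    show ?thesis
    proof (rule has_product_one_hit)
      have "(V1 + V2) + {#w, w'#} \<subseteq># U + ?W" by (rule subset_mset.add_mono[OF V(1) hit2(3)])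
      then show "(V1 + {#w, w'#}) + V2 \<subseteq># R" using U(1) by (simp add: ac_simps)
      show "int (2 * h) dvd (\<Sum>\<^sub># (V1 + {#w, w'#}) - \<Sum>\<^sub># V2) - (b' - b - 0)"
        using V(3,4) hit2(2,4) by (intro dvd2h) (auto simp: algebra_simps)
      show "size (V1 + {#w, w'#}) + size V2 + 2 \<le> 2 * h"
        using size_mset_mono[OF V(1)] Uh assms(2) by simp
      show "even (size (V1 + {#w, w'#}) + size V2)" using V(2) by simp
    qed (use hit2(1) assms(2) fill in simp_all)
  next
    case no
    \<comment> \<open>An even number of terms of one parity has an even sum, so only the modulus
      \<open>h\<close> remains to be treated.\<close>
    have same_parity: ?thesis if W': "W' \<subseteq># ?W" "\<And>a b. a \<in># W' \<Longrightarrow> b \<in># W' \<Longrightarrow> even (a - b)"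
      "2 * h + \<eta> - 1 \<le> size W'" for W'
    proof -
      have "int g dvd a" if a: "a \<in># W'" for a
      proof -
        have "2 \<le> size W'" using W'(3) assms(2) \<eta>'(2) by linarith
        then obtain a' where a': "{#a, a'#} \<subseteq># W'" using member_pair[OF a] by blast
        then have "a' \<in># W'" by (rule pair_members)
        then have "even (a - a')" by (intro W'(2) a)
        then show ?thesis using W subset_mset.order_trans[OF a' W'(1)] by blast
      qed
      then obtain T where T: "T \<subseteq># W'" "size T = 2 * h" "int g * int \<eta> dvd \<Sum>\<^sub># T"
        using erdos_ginzburg_ziv_multiples[of \<eta> "2 * h" W' "int g"] \<eta>' W'(3) \<eta> by auto
      have "even (\<Sum>\<^sub># T)"
        using T(1,2) W'(2) by (intro even_sum_mset_same_parity) (auto dest: mset_subset_eqD)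
      then have "int (2 * h) dvd \<Sum>\<^sub># T" using T(3) \<eta> by (intro dvd2h) auto
      moreover have "T \<subseteq># R" using T(1) W'(1) by (meson diff_subset_eq_self subset_mset.order_trans)
      ultimately show ?thesis using T(2) by (intro has_product_one_rotations)
    qed
    have bound: "size U + \<eta> + size B' \<le> h + 1"
      if B': "B' \<subseteq># B" "2 \<le> size B'" "\<And>a b. a \<in># B' \<Longrightarrow> b \<in># B' \<Longrightarrow> even (a - b)" for B'
    proof -
      have "\<not> P (b' - b)" if bb: "{#b, b'#} \<subseteq># B'" for b b'
      proof -
        have "b \<in># B'" "b' \<in># B'" using bb by (auto dest: pair_members)
        then have "even (b' - b)" by (intro B'(3))
        then show ?thesis using no(1)[of b b'] subset_mset.order_trans[OF bb B'(1)] by blast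
      qed
      then show ?thesis
        using no_hit_bound[OF g(1) \<eta>'(2) P0 P_cong, of "size U" h B'] card B'(2) \<eta>'(1) by auto
    qed
    show ?thesis
    proof (cases "(\<exists>w w'. {#w, w'#} \<subseteq># ?W \<and> odd (w + w')) \<and> (\<forall>w\<in>#?W. int g dvd w)")
      \<comment> \<open>Since \<open>g\<close> divides \<open>w + w'\<close>, periodicity carries
        the failure of \<open>P\<close> over to odd differences, and all of \<open>B\<close> enters
        \<open>no_hit_bound\<close>. Both parities occur, so the Erdos-Ginzburg-Ziv theorem is
        applied with \<open>2 * \<eta>\<close>.\<close>
      case True
      then obtain w w' where w: "{#w, w'#} \<subseteq># ?W" "odd (w + w')" by blast
      then have "w \<in># ?W" "w' \<in># ?W" using pair_members[OF w(1)] by blast+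
      then have gw: "int g dvd w + w'" using True by (intro dvd_add) auto
      have "\<not> P (b' - b)" if bb: "{#b, b'#} \<subseteq># B" for b b'
      proof (cases "even (b' - b)")
        case False
        then have "\<not> P (b' - b - (w + w'))" using no(2)[OF bb _ w] by blast
        moreover have "int g dvd (b' - b) - (b' - b - (w + w'))" using gw by simp
        ultimately show ?thesis using P_cong by blast
      qed (use no(1) bb in blast)
      then have "size U + \<eta> + size B \<le> h + 1"
        using no_hit_bound[OF g(1) \<eta>'(2) P0 P_cong, of "size U" h B] card assms(4) \<eta>'(1) by auto
      then have "2 * h + 2 * \<eta> - 1 \<le> size ?W" using sW assms(3) \<eta>'(3) by linarith
      then obtain T where T: "T \<subseteq># ?W" "size T = 2 * h" "int g * int (2 * \<eta>) dvd \<Sum>\<^sub># T"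
        using erdos_ginzburg_ziv_multiples[of "2 * \<eta>" "2 * h" ?W "int g"] \<eta>' True \<eta> by auto
      moreover have "T \<subseteq># R" using T(1) by (meson diff_subset_eq_self subset_mset.order_trans)
      ultimately show ?thesis using \<eta> by (intro has_product_one_rotations[of T]) (auto simp: ac_simps)
    next
      case False
      \<comment> \<open>Remaining rotations of equal parity are divisible by \<open>g\<close>, so a
        rotation that is not is alone in its parity class. It is given up; in return
        \<open>g > 1\<close>, hence \<open>\<eta> < h\<close>.\<close>
      obtain W' where W': "W' \<subseteq># ?W" "\<And>a b. a \<in># W' \<Longrightarrow> b \<in># W' \<Longrightarrow> even (a - b)"
        "size W' = size ?W \<or> size W' + 1 = size ?W \<and> \<eta> < h"
      proof (cases "\<exists>w w'. {#w, w'#} \<subseteq># ?W \<and> odd (w + w')")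
        case True
        then obtain w where w: "w \<in># ?W" "\<not> int g dvd w" using False by blast
        define C where "C = filter_mset (\<lambda>a. even (a - w)) ?W"
        define D where "D = filter_mset (\<lambda>a. odd (a - w)) ?W"
        have C: "a \<in># C \<longleftrightarrow> a \<in># ?W \<and> even (a - w)" and D: "a \<in># D \<longleftrightarrow> a \<in># ?W \<and> odd (a - w)" for a
          unfolding C_def D_def set_mset_filter by auto
        have CD: "C \<subseteq># ?W" "D \<subseteq># ?W" "?W = C + D"
          unfolding C_def D_def by (rule multiset_filter_subset multiset_partition)+
        have wC: "w \<in># C" using w(1) C by simp
        have "size C \<le> 1"
        proof (rule ccontr)
          assume "\<not> size C \<le> 1"
          then obtain a' where a': "{#w, a'#} \<subseteq># C" using member_pair[OF wC] by auto
          then have "a' \<in># C" by (rule pair_members)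
          then have "even (w - a')" using C by simp
          then show False using W w(2) subset_mset.order_trans[OF a' CD(1)] by blast
        qed
        moreover have "size C \<noteq> 0" using wC by auto
        moreover have "size ?W = size C + size D" using arg_cong[OF CD(3), of size] by simp
        ultimately have sD: "size D + 1 = size ?W" by linarith
        have "\<eta> < h" using w(2) \<eta> \<eta>'(2) g(1) by (cases "g = 1") auto
        with sD have "size D = size ?W \<or> size D + 1 = size ?W \<and> \<eta> < h" by blast
        moreover have "even (a - b)" if "a \<in># D" "b \<in># D" for a b using that D by auto
        ultimately show ?thesis by (intro that[OF CD(2)])
      next
        case False
        have "even (a - b)" if "a \<in># ?W" "b \<in># ?W" for a b
        proof (cases "a = b")
          case ab: False
          then have "{#a, b#} \<subseteq># ?W" using that by (simp add: insert_subset_eq_iff in_diff_count)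
          then have "even (a + b)" using False by blast
          then show ?thesis by simp
        qed simp
        then show ?thesis by (rule that[OF subset_mset.order_refl _ disjI1[OF HOL.refl]])
      qed
      have "2 * h + \<eta> - 1 \<le> size W'"
      \<comment> \<open>Two reflections may have different parities and then \<open>bound\<close>
        does not apply, but \<open>size U < h\<close> suffices. Otherwise the larger parity class of
        \<open>B\<close> has at least two elements.\<close>
      proof (cases "size B = 2")
        case True
        then show ?thesis using W'(3) Uh assms(3) sW \<eta>'(3) by linarith
      next
        case False
        let ?E = "filter_mset even B" and ?O = "filter_mset odd B"
        have "size B = size ?E + size ?O" by (metis multiset_partition size_union)
        then obtain B' where B': "B' \<subseteq># B" "size B \<le> 2 * size B'" "\<And>a b. a \<in># B' \<Longrightarrow> b \<in># B' \<Longrightarrow> even (a - b)"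
        proof (cases "size ?O \<le> size ?E")
          case True
          then show ?thesis using \<open>size B = _\<close> by (intro that[OF multiset_filter_subset[of even]]) simp_all
        next
          case False
          then show ?thesis using \<open>size B = _\<close> by (intro that[OF multiset_filter_subset[of odd]]) simp_all
        qed
        have "size U + \<eta> + size B' \<le> h + 1"
          using bound[OF B'(1) _ B'(3)] B'(2) False assms(4) by linarith
        then show ?thesis using W'(3) assms sW B'(2) False by linarith
      qed
      then show ?thesis using same_parity W'(1,2) by blast
    qed
  qed
qed

section \<open>Families of disjoint pairs\<close>

text \<open>Each pair carries a chosen signed value, which the pair alone does not determine. Modulo
  \<open>2 * h\<close> this value is 0 or \<open>h\<close>, the central factor to be
  balanced.\<close>

definition pair_family ::
  "nat \<Rightarrow> int \<Rightarrow> int multiset \<Rightarrow> int multiset \<Rightarrow> (int multiset \<times> int multiset \<times> int) list \<Rightarrow> bool" where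
  "pair_family h k R B ps \<longleftrightarrow> (\<Sum>(r, b, v)\<leftarrow>ps. r) \<subseteq># R \<and> (\<Sum>(r, b, v)\<leftarrow>ps. b) \<subseteq># B \<and>
     (\<forall>(r, b, v)\<in>set ps. size r + size b = 2 \<and> signed_value k r b v \<and> int h dvd v)"

lemma pair_family_Nil: "pair_family h k R B []"
  by (simp add: pair_family_def)

lemma pair_family_Cons:
  assumes "pair_family h k R B ps" "r \<subseteq># R - (\<Sum>(r, b, v)\<leftarrow>ps. r)" "b \<subseteq># B - (\<Sum>(r, b, v)\<leftarrow>ps. b)"
    "size r + size b = 2" "signed_value k r b v" "int h dvd v"
  shows "pair_family h k R B ((r, b, v) # ps)"
  using assms add_subseteq_diff[of "\<Sum>(r, b, v)\<leftarrow>ps. r" R r] add_subseteq_diff[of "\<Sum>(r, b, v)\<leftarrow>ps. b" B b]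
  by (auto simp: pair_family_def add.commute)

lemma pair_family_total:
  assumes "pair_family h k R B ps"
  shows "signed_value k (\<Sum>(r, b, v)\<leftarrow>ps. r) (\<Sum>(r, b, v)\<leftarrow>ps. b) (\<Sum>(r, b, v)\<leftarrow>ps. v)"
    "size (\<Sum>(r, b, v)\<leftarrow>ps. r) + size (\<Sum>(r, b, v)\<leftarrow>ps. b) = 2 * length ps"
    "int h dvd (\<Sum>(r, b, v)\<leftarrow>ps. v)"
proof -
  have "\<forall>(r, b, v)\<in>set ps. size r + size b = 2 \<and> signed_value k r b v \<and> int h dvd v"
    using assms by (simp add: pair_family_def)
  then have "signed_value k (\<Sum>(r, b, v)\<leftarrow>ps. r) (\<Sum>(r, b, v)\<leftarrow>ps. b) (\<Sum>(r, b, v)\<leftarrow>ps. v) \<and>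
    size (\<Sum>(r, b, v)\<leftarrow>ps. r) + size (\<Sum>(r, b, v)\<leftarrow>ps. b) = 2 * length ps \<and>
    int h dvd (\<Sum>(r, b, v)\<leftarrow>ps. v)"
    by (induction ps) (auto simp: signed_value_empty intro: signed_value_add)
  then show "signed_value k (\<Sum>(r, b, v)\<leftarrow>ps. r) (\<Sum>(r, b, v)\<leftarrow>ps. b) (\<Sum>(r, b, v)\<leftarrow>ps. v)"
    "size (\<Sum>(r, b, v)\<leftarrow>ps. r) + size (\<Sum>(r, b, v)\<leftarrow>ps. b) = 2 * length ps"
    "int h dvd (\<Sum>(r, b, v)\<leftarrow>ps. v)" by blast+
qed

lemma pair_family_reflection:
  assumes "pair_family h k R B ps" "0 < h" "int h dvd k" "h + size (\<Sum>(r, b, v)\<leftarrow>ps. b) < size B"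
  obtains p where "pair_family h k R B (p # ps)"
    "size (\<Sum>(r, b, v)\<leftarrow>p # ps. b) = size (\<Sum>(r, b, v)\<leftarrow>ps. b) + 2"
proof -
  let ?B = "B - (\<Sum>(r, b, v)\<leftarrow>ps. b)"
  have "h < size ?B" using assms(1,4) by (simp add: pair_family_def size_Diff_submset)
  then obtain b b' where b: "{#b, b'#} \<subseteq># ?B" "int h dvd b - b'"
    using reflection_pair[OF assms(2)] by blast
  then have "pair_family h k R B (({#}, {#b, b'#}, b - b' + k) # ps)"
    using assms(1,3) signed_value_pair(3) by (intro pair_family_Cons) auto
  then show ?thesis by (rule that) simp
qed

lemma pair_family_extend:
  assumes "pair_family h k R B ps" "0 < h" "int h dvd k" "length ps \<le> j"
    "2 * j + h div 2 + h \<le> size R + size B"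
  obtains ps' where "pair_family h k R B ps'" "length ps' = j" "set ps \<subseteq> set ps'"
    "size (\<Sum>(r, b, v)\<leftarrow>ps. b) \<le> size (\<Sum>(r, b, v)\<leftarrow>ps'. b)"
proof -
  have "\<exists>ps'. pair_family h k R B ps' \<and> length ps' = j \<and> set ps \<subseteq> set ps' \<and>
      size (\<Sum>(r, b, v)\<leftarrow>ps. b) \<le> size (\<Sum>(r, b, v)\<leftarrow>ps'. b)"
    using assms(4,5)
  proof (induction j rule: dec_induct)
    case base
    then show ?case using assms(1) by blast
  next
    case (step j)
    then obtain ps' where ps': "pair_family h k R B ps'" "length ps' = j" "set ps \<subseteq> set ps'"
      "size (\<Sum>(r, b, v)\<leftarrow>ps. b) \<le> size (\<Sum>(r, b, v)\<leftarrow>ps'. b)" by auto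
    let ?r = "\<Sum>(r, b, v)\<leftarrow>ps'. r" and ?b = "\<Sum>(r, b, v)\<leftarrow>ps'. b"
    have sub: "?r \<subseteq># R" "?b \<subseteq># B" using ps'(1) by (simp_all add: pair_family_def)
    have "2 * j + 2 + h div 2 + h \<le> size R + size B" using step.prems by simp
    then have "h div 2 + 1 + h < size (R - ?r) + size (B - ?b)"
      using pair_family_total(2)[OF ps'(1)] ps'(2) size_Diff_submset[OF sub(1)]
        size_Diff_submset[OF sub(2)] size_mset_mono[OF sub(1)] size_mset_mono[OF sub(2)] by linarith
    then obtain r b v where "r \<subseteq># R - ?r" "b \<subseteq># B - ?b" "size r + size b = 2" "signed_value k r b v" "int h dvd v"
      using element_pair[OF assms(2) _ assms(3)] by metis
    then have "pair_family h k R B ((r, b, v) # ps')" using ps'(1) by (intro pair_family_Cons)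
    then show ?case using ps' by (intro exI[of _ "(r, b, v) # ps'"]) auto
  qed
  then show ?thesis using that by blast
qed

text \<open>The dropped pair contains at most two of the three reflections, so the signs of the
  remaining pairs can still be realised.\<close>

lemma has_product_one_drop:
  assumes "pair_family h k R B ps" "(r, b, v) \<in> set ps" "int m dvd (\<Sum>(r, b, v)\<leftarrow>ps. v) - v"
    "3 \<le> size (\<Sum>(r, b, v)\<leftarrow>ps. b)" "l + 2 = 2 * length ps"
  shows "has_product_one m k l (elems R B)"
proof -
  obtain xs ys where ps: "ps = xs @ (r, b, v) # ys" using assms(2) by (meson split_list)
  let ?qs = "xs @ ys"
  have sums: "(\<Sum>(r, b, v)\<leftarrow>ps. r) = r + (\<Sum>(r, b, v)\<leftarrow>?qs. r)"
    "(\<Sum>(r, b, v)\<leftarrow>ps. b) = b + (\<Sum>(r, b, v)\<leftarrow>?qs. b)"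
    "(\<Sum>(r, b, v)\<leftarrow>ps. v) = v + (\<Sum>(r, b, v)\<leftarrow>?qs. v)"
    by (simp_all add: ps ac_simps)
  have fam: "pair_family h k R B ?qs"
    using assms(1) unfolding pair_family_def sums
    by (auto simp: ps dest: subset_mset.order_trans[OF mset_subset_eq_add_right])
  have "size b \<le> 2" using assms(1,2) by (auto simp: pair_family_def)
  then have "(\<Sum>(r, b, v)\<leftarrow>?qs. b) \<noteq> {#}" using assms(4) sums(2) by auto
  moreover have "size (\<Sum>(r, b, v)\<leftarrow>?qs. r) + size (\<Sum>(r, b, v)\<leftarrow>?qs. b) = l"
    using pair_family_total(2)[OF fam] assms(5) by (simp add: ps)
  moreover have "int m dvd (\<Sum>(r, b, v)\<leftarrow>?qs. v)" using assms(3) sums(3) by simp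
  ultimately show ?thesis
    using fam pair_family_total(1)[OF fam] unfolding pair_family_def
    by (intro has_product_one_signed) auto
qed

lemma sum_list_dvd: "(\<And>x. x \<in> set xs \<Longrightarrow> (d :: int) dvd f x) \<Longrightarrow> d dvd (\<Sum>x\<leftarrow>xs. f x)"
  by (induction xs) auto

text \<open>If the total is an odd multiple of \<open>h\<close>, some pair has an odd multiple of
  \<open>h\<close> as its value, and dropping it leaves an even one.\<close>

lemma pair_family_drop_odd:
  assumes "pair_family h k R B ps" "0 < h" "\<not> int (2 * h) dvd (\<Sum>(r, b, v)\<leftarrow>ps. v)"
    "3 \<le> size (\<Sum>(r, b, v)\<leftarrow>ps. b)" "l + 2 = 2 * length ps"
  shows "has_product_one (2 * h) k l (elems R B)"
proof -
  have "\<exists>p\<in>set ps. \<not> int (2 * h) dvd (case p of (r, b, v) \<Rightarrow> v)"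
    using assms(3) sum_list_dvd[of ps "int (2 * h)" "\<lambda>p. case p of (r, b, v) \<Rightarrow> v"] by blast
  then obtain r b v where p: "(r, b, v) \<in> set ps" "\<not> int (2 * h) dvd v" by auto
  have "int h dvd v" using assms(1) p(1) by (auto simp: pair_family_def)
  then obtain c where c: "v = int h * c" ..
  obtain s where s: "(\<Sum>(r, b, v)\<leftarrow>ps. v) = int h * s" using pair_family_total(3)[OF assms(1)] by auto
  have "odd c" "odd s" using p(2) assms(3) by (auto simp: c s)
  then have "int (2 * h) dvd (\<Sum>(r, b, v)\<leftarrow>ps. v) - v"
    unfolding c s by (auto simp flip: right_diff_distrib)
  then show ?thesis using has_product_one_drop[OF assms(1) p(1)] assms(4,5) by blast
qed

text \<open>Among the \<open>h + 1\<close> pairs there is one of value \<open>0\<close> modulo \<open>2 * h\<close>, so whatever the total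
  value is modulo \<open>2 * h\<close>, some pair of that value can be dropped. Two pairs of reflections ensure
  that a reflection remains.\<close>

lemma dihedral_double_odd_many_reflections:
  assumes "odd h" "3 \<le> h" "size R + size B = 4 * h" "h + 3 \<le> size B"
  shows "has_product_one (2 * h) 0 (2 * h) (elems R B)"
proof -
  have h: "0 < h" using assms(2) by simp
  \<comment> \<open>Modulo \<open>2 * h\<close> there are \<open>h + 1\<close> classes of rotations
    up to sign and \<open>2 * h\<close> of reflections, together fewer than
    \<open>4 * h\<close>.\<close>
  obtain r0 b0 v0 where p0: "r0 \<subseteq># R" "b0 \<subseteq># B" "size r0 + size b0 = 2" "signed_value 0 r0 b0 v0"
    "int (2 * h) dvd v0"
    using element_pair[of "2 * h" R B 0] assms(2,3) by auto
  have fam0: "pair_family h 0 R B [(r0, b0, v0)]"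
    using p0 by (intro pair_family_Cons pair_family_Nil) auto
  obtain ps where ps: "pair_family h 0 R B ps" "(r0, b0, v0) \<in> set ps" "length ps \<le> 3"
    "3 \<le> size (\<Sum>(r, b, v)\<leftarrow>ps. b)"
  proof (cases "b0 = {#}")
    case True
    obtain p1 where p1: "pair_family h 0 R B [p1, (r0, b0, v0)]"
      "size (\<Sum>(r, b, v)\<leftarrow>[p1, (r0, b0, v0)]. b) = size (\<Sum>(r, b, v)\<leftarrow>[(r0, b0, v0)]. b) + 2"
      using pair_family_reflection[OF fam0 h] assms(4) True by auto
    obtain p2 where "pair_family h 0 R B [p2, p1, (r0, b0, v0)]"
      "size (\<Sum>(r, b, v)\<leftarrow>[p2, p1, (r0, b0, v0)]. b) = size (\<Sum>(r, b, v)\<leftarrow>[p1, (r0, b0, v0)]. b) + 2"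
      using pair_family_reflection[OF p1(1) h] p1(2) assms(4) True by auto
    then show ?thesis using p1(2) by (intro that[of "[p2, p1, (r0, b0, v0)]"]) auto
  next
    case False
    have "1 \<le> size b0" "size b0 \<le> 2" using False p0(3) by (auto simp: Suc_le_eq nonempty_has_size)
    then have "h + size (\<Sum>(r, b, v)\<leftarrow>[(r0, b0, v0)]. b) < size B" using assms(4) by simp
    then obtain p1 where p1: "pair_family h 0 R B [p1, (r0, b0, v0)]"
      "size (\<Sum>(r, b, v)\<leftarrow>[p1, (r0, b0, v0)]. b) = size (\<Sum>(r, b, v)\<leftarrow>[(r0, b0, v0)]. b) + 2"
      using pair_family_reflection[OF fam0 h] by auto
    then show ?thesis using \<open>1 \<le> size b0\<close> by (intro that[of "[p1, (r0, b0, v0)]"]) auto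
  qed
  have "2 * (h + 1) + h div 2 + h \<le> size R + size B" using assms(1-3) by (elim oddE) simp
  then obtain qs where qs: "pair_family h 0 R B qs" "length qs = h + 1" "set ps \<subseteq> set qs"
    "size (\<Sum>(r, b, v)\<leftarrow>ps. b) \<le> size (\<Sum>(r, b, v)\<leftarrow>qs. b)"
    using pair_family_extend[OF ps(1) h, of "h + 1"] ps(3) assms(2) by auto
  show ?thesis
  proof (cases "int (2 * h) dvd (\<Sum>(r, b, v)\<leftarrow>qs. v)")
    case True
    then have "int (2 * h) dvd (\<Sum>(r, b, v)\<leftarrow>qs. v) - v0" using p0(5) by (rule dvd_diff)
    then show ?thesis using has_product_one_drop[OF qs(1)] ps(2,4) qs(2-4) by auto
  next
    case False
    show ?thesis by (rule pair_family_drop_odd[OF qs(1) h False]) (use ps(4) qs in auto)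
  qed
qed

lemma forces_product_one_dihedral_double_odd:
  assumes "odd h" "3 \<le> h"
  shows "forces_product_one (2 * h) 0 (4 * h) (2 * h)"
proof (rule forces_product_oneI)
  fix R B :: "int multiset" assume N: "size R + size B = 4 * h"
  consider "size B \<le> 1" | "2 \<le> size B" "size B \<le> h + 2" | "h + 3 \<le> size B" by linarith
  then show "has_product_one (2 * h) 0 (2 * h) (elems R B)"
  proof cases
    case 1
    then have "2 * h + 2 * h - 1 \<le> size R" using N by linarith
    then obtain T where "T \<subseteq># R" "size T = 2 * h" "int (2 * h) dvd \<Sum>\<^sub># T"
      using erdos_ginzburg_ziv_length[of "2 * h" "2 * h" R] assms(2) by auto
    then show ?thesis by (rule has_product_one_rotations)
  next
    case 2
    then show ?thesis using dihedral_double_odd_few_reflections assms N by blast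
  next
    case 3
    then show ?thesis using dihedral_double_odd_many_reflections assms N by blast
  qed
qed

text \<open>If at most three of the four classes modulo the center occur, any four elements contain
  two of one class, and doubling works. If all four occur, take one element of each: both choices of
  sign for the odd rotation give even values, which differ by 2 modulo 4.\<close>

lemma forces_product_one_order_eight:
  assumes "even k"
  shows "forces_product_one 4 k 8 4"
proof (rule forces_product_oneI)
  fix R B :: "int multiset" assume N: "size R + size B = 8"
  let ?f = "\<lambda>x :: int \<times> bool. (fst x mod 2, snd x)" and ?X = "{0, 1 :: int} \<times> (UNIV :: bool set)"
  have R: "i \<in># R \<longleftrightarrow> (i, False) \<in># elems R B" and B: "i \<in># B \<longleftrightarrow> (i, True) \<in># elems R B" for i
    by (auto simp: elems_def)
  have sub: "?f ` set_mset (elems R B) \<subseteq> ?X" by auto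
  have cX: "card ?X = 4" by (simp add: card_cartesian_product)
  show "has_product_one 4 k 4 (elems R B)"
  proof (cases "?f ` set_mset (elems R B) = ?X")
    case True
    have ex: "\<exists>i. (i, b) \<in># elems R B \<and> i mod 2 = j" if "j \<in> {0, 1}" for j b
    proof -
      have "(j, b) \<in> ?f ` set_mset (elems R B)" unfolding True using that by simp
      then show ?thesis by auto
    qed
    obtain a0 a1 b0 b1 where "a0 \<in># R" "a1 \<in># R" "b0 \<in># B" "b1 \<in># B"
      and par: "a0 mod 2 = 0" "a1 mod 2 = 1" "b0 mod 2 = 0" "b1 mod 2 = 1"
      using ex[of 0 False] ex[of 1 False] ex[of 0 True] ex[of 1 True] R B by auto
    moreover from par have "a0 \<noteq> a1" "b0 \<noteq> b1" by auto
    ultimately have mem: "{#a0, a1#} \<subseteq># R" "{#b0, b1#} \<subseteq># B"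
      by (simp_all add: insert_subset_eq_iff in_diff_count)
    let ?v = "a0 - a1 + (b0 - b1 + k)" and ?w = "a0 + a1 + (b0 - b1 + k)"
    have sv: "signed_value k {#a0, a1#} {#b0, b1#} ?v" "signed_value k {#a0, a1#} {#b0, b1#} ?w"
      using signed_value_add[OF signed_value_pair(1) signed_value_pair(3)]
        signed_value_add[OF signed_value_pair(2) signed_value_pair(3)] by simp_all
    have "4 dvd ?v \<or> 4 dvd ?w" using par assms by presburger
    then show ?thesis
      using has_product_one_signed[OF mem _ _ sv(1), of 4 4] has_product_one_signed[OF mem _ _ sv(2), of 4 4]
      by auto
  next
    case False
    then have c3: "card (?f ` set_mset (elems R B)) < 4"
      using psubset_card_mono[of ?X "?f ` set_mset (elems R B)"] sub cX by auto
    have "has_product_one (2 * 2) k (2 * 2) (elems R B)"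
    proof (rule has_product_one_double)
      fix S' assume S': "S' \<subseteq># elems R B" "size (elems R B) \<le> size S' + 2 * 2"
      have "?f ` set_mset S' \<subseteq> ?f ` set_mset (elems R B)" using set_mset_mono[OF S'(1)] by blast
      moreover have "card (?f ` set_mset (elems R B)) < size S'" using c3 S'(2) N by simp
      ultimately obtain x y where xy: "{#x, y#} \<subseteq># S'" "?f x = ?f y"
        using mset_pigeonhole[of "?f ` set_mset (elems R B)" ?f S'] finite_imageI[OF finite_set_mset] by blast
      obtain i j b where [simp]: "x = (i, b)" "y = (j, b)" using xy(2) by (cases x, cases y) auto
      have "i mod 2 = j mod 2" using xy(2) by simp
      then have par: "even (i + j)" "even (i - j + k)" using assms by presburger+
      have "has_value k {#x, y#} (if b then i - j + k else i + j)"
        using has_value_reflections[of k i j] has_value_add[OF has_value_rotation[of k i] has_value_rotation[of k j]]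
        by (cases b) (auto simp: add_mset_commute)
      then show "\<exists>T v. T \<subseteq># S' \<and> size T = 2 \<and> has_value k T v \<and> int 2 dvd v"
        using xy(1) par by (intro exI[of _ "{#x, y#}"] exI[of _ "if b then i - j + k else i + j"]) auto
    qed
    then show ?thesis by simp
  qed
qed

lemma forces_product_one_dihedral_even:
  assumes "even m" "4 \<le> m"
  shows "forces_product_one m 0 (2 * m) m"
  using assms
proof (induction m rule: less_induct)
  case (less m)
  then obtain h where h: "m = 2 * h" "2 \<le> h" by (elim evenE) auto
  have "odd h \<and> 3 \<le> h \<or> h = 2 \<or> even h \<and> 4 \<le> h" using h(2) by presburger
  then consider "odd h" "3 \<le> h" | "h = 2" | "even h" "4 \<le> h" by blast
  then show ?case
  proof cases
    case 1
    then show ?thesis using forces_product_one_dihedral_double_odd by (simp add: h)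
  next
    case 2
    then show ?thesis using forces_product_one_order_eight[of 0] by (simp add: h)
  next
    case 3
    then show ?thesis using less.IH[of h] forces_product_one_double[of h 0] by (simp add: h)
  qed
qed

section \<open>Dicyclic groups\<close>

text \<open>One of \<open>2 * n + 1\<close> pairs is dropped. If the total is an even multiple of
  \<open>n\<close>, the values cannot all be odd multiples, because the number of pairs is odd; so a
  pair of value 0 modulo \<open>2 * n\<close> is available. The two given pairs ensure that a
  reflection remains.\<close>

lemma dicyclic_odd_two_pairs:
  assumes "odd n" "3 \<le> n" "size R + size B = 6 * n" "{#b, b'#} \<subseteq># B" "int n dvd b - b'"
    "{#c, c'#} \<subseteq># B - {#b, b'#}" "int n dvd c - c'"
  shows "has_product_one (2 * n) (int n) (4 * n) (elems R B)"
proof -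
  let ?p = "({#}, {#b, b'#}, b - b' + int n)" and ?q = "({#}, {#c, c'#}, c - c' + int n)"
  have n: "0 < n" using assms(2) by simp
  have 1: "pair_family n (int n) R B [?q]"
    using assms(6,7) signed_value_pair(3) subset_mset.order_trans[OF assms(6) diff_subset_eq_self]
    by (intro pair_family_Cons pair_family_Nil) auto
  have "{#c, c'#} + {#b, b'#} \<subseteq># B"
    using add_subseteq_diff[OF assms(4,6)] by (simp add: add.commute)
  then have "{#b, b'#} \<subseteq># B - {#c, c'#}" 
    by (metis add_diff_cancel_left' subset_mset.le_diff_conv2 add.commute mset_subset_eq_add_left subset_mset.order_trans)
  then have 2: "pair_family n (int n) R B [?p, ?q]"
    using assms(5) signed_value_pair(3) by (intro pair_family_Cons[OF 1]) auto
  have "2 * (2 * n + 1) + n div 2 + n \<le> size R + size B" using assms(1-3) by (elim oddE) simp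
  then obtain ps where ps: "pair_family n (int n) R B ps" "length ps = 2 * n + 1"
    "size (\<Sum>(r, b, v)\<leftarrow>[?p, ?q]. b) \<le> size (\<Sum>(r, b, v)\<leftarrow>ps. b)"
    using pair_family_extend[OF 2 n, of "2 * n + 1"] assms(2) by auto
  show ?thesis
  proof (cases "int (2 * n) dvd (\<Sum>(r, b, v)\<leftarrow>ps. v)")
    case False
    show ?thesis by (rule pair_family_drop_odd[OF ps(1) n False]) (use ps in auto)
  next
    case True
    have "\<exists>(r, b, v)\<in>set ps. int (2 * n) dvd v"
    proof (rule ccontr)
      assume "\<not> ?thesis"
      then have no: "\<not> int (2 * n) dvd v" if "(r, b, v) \<in> set ps" for r b v using that by auto
      have "int (2 * n) dvd (\<Sum>(r, b, v)\<leftarrow>ps. v - int n)"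
      proof (rule sum_list_dvd)
        fix x assume x: "x \<in> set ps"
        obtain r b v where [simp]: "x = (r, b, v)" by (cases x)
        have "int n dvd v" using ps(1) x by (auto simp: pair_family_def)
        then obtain a where a: "v = int n * a" ..
        have "odd a" using no[of r b v] x a by auto
        then have "2 * int n dvd int n * (a - 1)" by (simp add: mult.commute)
        then show "int (2 * n) dvd (case x of (r, b, v) \<Rightarrow> v - int n)"
          by (simp add: a right_diff_distrib)
      qed
      moreover have "(\<Sum>(r, b, v)\<leftarrow>ps. v - int n) = (\<Sum>(r, b, v)\<leftarrow>ps. v) - int (length ps) * int n"
        by (induction ps) (auto simp: algebra_simps)
      ultimately have "int (2 * n) dvd int (length ps) * int n" using True by (simp add: dvd_diff_right_iff)
      then have "int 2 * int n dvd int (length ps) * int n" by simp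
      then have "int 2 dvd int (length ps)" using n by (simp only: dvd_mult_cancel_right) auto
      then show False using ps(2) by simp
    qed
    then obtain r b v where p: "(r, b, v) \<in> set ps" "int (2 * n) dvd v" by auto
    show ?thesis
      by (rule has_product_one_drop[OF ps(1) p(1) dvd_diff[OF True p(2)]]) (use ps in auto)
  qed
qed

text \<open>Multiples of \<open>n\<close> form a group of order two modulo \<open>2 * n\<close>, so
  one surplus rotation is enough.\<close>

lemma has_product_one_multiples:
  assumes "odd n" "3 \<le> n" "5 * n \<le> size R + 2" "\<And>a. a \<in># R \<Longrightarrow> int n dvd a"
  shows "has_product_one (2 * n) k (4 * n) (elems R B)"
proof -
  obtain T where "T \<subseteq># R" "size T = 4 * n" "int n * int 2 dvd \<Sum>\<^sub># T"
    using erdos_ginzburg_ziv_multiples[of 2 "4 * n" R "int n"] assms by auto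
  then show ?thesis by (intro has_product_one_rotations) (auto simp: mult.commute)
qed

text \<open>The reflections other than \<open>b\<close> and \<open>b'\<close> represent each residue modulo \<open>n\<close>. So there are
  reflections \<open>x\<close> and \<open>y\<close> congruent to \<open>b + (a + a')\<close> and \<open>b - (a + a')\<close>, and one of the blocks
  \<open>b, b', x, y\<close> and \<open>a, a', b, x\<close> and \<open>a, a', b, y\<close> has an even value.\<close>

lemma dicyclic_odd_critical:
  assumes "odd n" "3 \<le> n" "size R + size B = 6 * n" "size B = n + 2" "{#b, b'#} \<subseteq># B" "int n dvd b - b'"
    and no_pair: "\<And>c c'. {#c, c'#} \<subseteq># B - {#b, b'#} \<Longrightarrow> \<not> int n dvd c - c'"
  shows "has_product_one (2 * n) (int n) (4 * n) (elems R B)"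
proof -
  let ?B = "B - {#b, b'#}"
  have cop: "coprime (int n) 2" using assms(1) by (simp add: coprime_right_2_iff_odd)
  have dvd2n: "int (2 * n) dvd x" if "int n dvd x" "even x" for x
    using divides_mult[OF that(2,1)] cop by (simp add: coprime_commute)
  have sB: "size ?B = n" using assms(4,5) by (simp add: size_Diff_submset)
  \<comment> \<open>Here \<open>size R = 5 * n - 2\<close>, so two reflections meet the last
    condition with equality.\<close>
  have fill: ?thesis
    if "V \<subseteq># R" "B' \<subseteq># B" "B' \<noteq> {#}" "signed_value (int n) V B' v" "int n dvd v" "even v" "even (size V)"
      "size V + size B' \<le> 4" "n + 4 * n \<le> size R + size B'" for V B' v
    using that assms(2) dvd2n by (intro has_product_one_fill[of V R B' B "int n" v]) auto
  show ?thesis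
  proof (cases "even (b - b')")
    \<comment> \<open>As \<open>n\<close> is odd, an odd multiple of \<open>n\<close> plus
      \<open>n\<close> vanishes modulo \<open>2 * n\<close>: the pair is already a block.\<close>
    case False
    then show ?thesis
      using assms fill[of "{#}" "{#b, b'#}" "b - b' + int n"] signed_value_pair(3) by simp
  next
    case even_b: True
    show ?thesis
    proof (cases "\<exists>a a'. {#a, a'#} \<subseteq># R \<and> \<not> int n dvd a + a'")
      case False
      have "int n dvd a" if a: "a \<in># R" for a
      proof -
        have s3: "3 \<le> size R" using assms(2-4) by linarith
        then obtain a' where a': "{#a, a'#} \<subseteq># R" using member_pair[OF a] by auto
        then have "0 < size (R - {#a, a'#})" using s3 by (simp add: size_Diff_submset)
        then obtain a'' where "a'' \<in># R - {#a, a'#}" by (metis multiset_nonemptyE nonempty_has_size)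
        then have "{#a, a'#} + {#a''#} \<subseteq># R" using a' by (intro add_subseteq_diff) auto
        then have "{#a, a'#} \<subseteq># R" "{#a, a''#} \<subseteq># R" "{#a', a''#} \<subseteq># R"
          by (auto intro: subset_mset.order_trans[rotated] simp: add_mset_commute)
        then have "int n dvd a + a'" "int n dvd a + a''" "int n dvd a' + a''" using False by blast+
        then have "int n dvd (a + a') + (a + a'') - (a' + a'')" by (meson dvd_add dvd_diff)
        then have "int n dvd 2 * a" by simp
        then show ?thesis using cop coprime_dvd_mult_right_iff by blast
      qed
      then show ?thesis using has_product_one_multiples assms(1-4) by simp
    next
      case True
      then obtain a a' where a: "{#a, a'#} \<subseteq># R" "\<not> int n dvd a + a'" by blast
      have "(\<lambda>c. c mod int n) ` set_mset ?B = {0..<int n}"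
        using assms(2) sB no_pair by (intro mset_pigeonhole_tight) (auto simp: mod_eq_dvd_iff)
      then have all: "\<exists>c\<in>#?B. int n dvd c - x" for x
      proof -
        have "x mod int n \<in> (\<lambda>c. c mod int n) ` set_mset ?B"
          using \<open>_ = {0..<int n}\<close> assms(2) by simp
        then show ?thesis by (metis (no_types, lifting) imageE mod_eq_dvd_iff)
      qed
      obtain x where x: "x \<in># ?B" "int n dvd x - (b + (a + a'))" using all by blast
      obtain y where y: "y \<in># ?B" "int n dvd y - (b - (a + a'))" using all by blast
      have "x \<noteq> y"
      proof
        assume "x = y"
        have "int n dvd (y - (b - (a + a'))) - (x - (b + (a + a')))" using dvd_diff[OF y(2) x(2)] .
        then have "int n dvd 2 * (a + a')" using \<open>x = y\<close> by simp
        then show False using a(2) cop coprime_dvd_mult_right_iff by blast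
      qed
      then have "{#x, y#} \<subseteq># ?B" using x(1) y(1) by (simp add: insert_subset_eq_iff in_diff_count)
      from add_subseteq_diff[OF assms(5) this] have sub: "{#b, x#} + {#b', y#} \<subseteq># B"
        by (simp add: add_mset_commute)
      have bx: "{#b, x#} \<subseteq># B" "{#b, y#} \<subseteq># B"
        using sub by (auto intro: subset_mset.order_trans[rotated] simp: add_mset_commute)
      show ?thesis
      proof (cases "even (x + y)")
        case True
        let ?v = "(b - x + int n) + (b' - y + int n)"
        have "signed_value (int n) {#} ({#b, x#} + {#b', y#}) ?v"
          using signed_value_add[OF signed_value_pair(3) signed_value_pair(3)] by fastforce
        moreover have "int n dvd ?v"
        proof -
          have "?v = 2 * int n - (b - b') - (x - (b + (a + a'))) - (y - (b - (a + a')))" by simp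
          then show ?thesis using assms(6) x(2) y(2) by (metis dvd_diff dvd_triv_right)
        qed
        moreover have "even ?v" using True even_b by auto
        ultimately show ?thesis
          using sub assms(2-4) by (intro fill[of "{#}" "{#b, x#} + {#b', y#}" ?v]) auto
      next
        case False
        let ?v = "(a + a') + (b - x + int n)" and ?w = "(a + a') + (y - b + int n)"
        have sv: "signed_value (int n) {#a, a'#} {#b, x#} ?v" "signed_value (int n) {#a, a'#} {#b, y#} ?w"
          using signed_value_add[OF signed_value_pair(2)[of "int n" a a'] signed_value_pair(3)[of "int n" b x]]
            signed_value_add[OF signed_value_pair(2)[of "int n" a a'] signed_value_pair(3)[of "int n" y b]]
          by (simp_all add: add_mset_commute)
        have "?v = int n - (x - (b + (a + a')))" "?w = int n + (y - (b - (a + a')))" by simp_all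
        then have dv: "int n dvd ?v" "int n dvd ?w" using x(2) y(2) by (metis dvd_diff dvd_add dvd_refl)+
        \<comment> \<open>\<open>?v + ?w\<close> has the parity of \<open>x + y\<close>, which is
          odd here.\<close>
        have "even ?v \<or> even ?w" using False by auto
        then show ?thesis
        proof
          assume "even ?v"
          then show ?thesis
            using a(1) bx(1) assms(2-4) sv(1) dv(1) by (intro fill[of "{#a, a'#}" "{#b, x#}" ?v]) auto
        next
          assume "even ?w"
          then show ?thesis
            using a(1) bx(2) assms(2-4) sv(2) dv(2) by (intro fill[of "{#a, a'#}" "{#b, y#}" ?w]) auto
        qed
      qed
    qed
  qed
qed

text \<open>There are four blocks of \<open>n\<close> rotations with sum \<open>0\<close> or \<open>n\<close> modulo \<open>2 * n\<close>. If these sums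
  differ, two of three suitable blocks complement a block of size \<open>2 * n\<close> obtained from the
  dihedral quotient.\<close>

lemma dicyclic_odd_few_reflections:
  assumes "odd n" "3 \<le> n" "size R + size B = 6 * n" "size B \<le> n + 1"
  shows "has_product_one (2 * n) (int n) (4 * n) (elems R B)"
proof -
  have n: "0 < n" using assms(2) by simp
  \<comment> \<open>At least \<open>5 * n - 1\<close> rotations remain, just enough for four
    blocks.\<close>
  have "4 * n + n - 1 \<le> size R" using assms by linarith
  then obtain \<T> where T: "\<Sum>\<^sub># \<T> \<subseteq># R" "size \<T> = 4" "\<forall>T\<in>#\<T>. size T = n \<and> int n dvd \<Sum>\<^sub># T"
    using extract_blocks[OF erdos_ginzburg_ziv[OF n], of 4 R] n by auto
  let ?f = "\<lambda>T. \<Sum>\<^sub># T div int n"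
  have f: "\<Sum>\<^sub># T = int n * ?f T" if "T \<in># \<T>" for T using T(3) that by simp
  show ?thesis
  proof (cases "\<exists>T\<in>#\<T>. \<exists>T'\<in>#\<T>. odd (?f T - ?f T')")
    case False
    then have "even (\<Sum>\<^sub># (image_mset ?f \<T>))"
      using T(2) by (intro even_sum_mset_same_parity) auto
    moreover have "\<Sum>\<^sub># (\<Sum>\<^sub># \<S>) = int n * \<Sum>\<^sub># (image_mset ?f \<S>) \<and> size (\<Sum>\<^sub># \<S>) = n * size \<S>"
      if "\<S> \<subseteq># \<T>" for \<S>
      using that
    proof (induction \<S>)
      case (add T \<S>)
      then have "T \<in># \<T>" "\<S> \<subseteq># \<T>" by (auto simp: insert_subset_eq_iff dest: subset_mset.order_trans[OF _ diff_subset_eq_self])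
      then show ?case using add.IH f[of T] T(3) by (auto simp: distrib_left)
    qed simp
    ultimately have "int (2 * n) dvd \<Sum>\<^sub># (\<Sum>\<^sub># \<T>)" "size (\<Sum>\<^sub># \<T>) = 4 * n"
      using T(2) by auto
    then show ?thesis using T(1) by (intro has_product_one_rotations)
  next
    case True
    then obtain T1 T2 where 1: "T1 \<in># \<T>" "T2 \<in># \<T>" "odd (?f T1 - ?f T2)" by blast
    then have "{#T1, T2#} \<subseteq># \<T>" by (auto simp: insert_subset_eq_iff in_diff_count)
    then obtain \<S> where S: "\<T> = {#T1, T2#} + \<S>" by (auto simp: subset_mset.le_iff_add)
    then have "\<S> \<noteq> {#}" using T(2) by auto
    then obtain T3 \<S>' where "\<S> = add_mset T3 \<S>'" by (meson multiset_cases)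
    with S have T123: "\<T> = {#T1, T2, T3#} + \<S>'" by simp
    then have sub: "T1 + (T2 + T3) \<subseteq># R"
      using T(1) by (auto intro: subset_mset.order_trans[rotated] simp: ac_simps)
    have T': "size T1 = n" "size T2 = n" "size T3 = n" using T(3) T123 by auto
    \<comment> \<open>This is the number of elements for which the dihedral quotient of order
      \<open>2 * n\<close> yields a block of length \<open>2 * n\<close>.\<close>
    have "3 * n \<le> size (elems (R - (T1 + (T2 + T3))) B)"
      using assms(3) T' size_mset_mono[OF sub] by (simp add: size_Diff_submset[OF sub])
    then obtain Q v where Q: "Q \<subseteq># elems (R - (T1 + (T2 + T3))) B" "size Q = 2 * n"
      "has_value (int n) Q v" "int n dvd v"
      using has_value_of_forces[OF forces_product_one_dihedral_odd[OF assms(1,2)]] by (metis dvd_refl)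
    obtain c where c: "v = int n * c" using Q(4) ..
    have combine: ?thesis if "U \<subseteq># T1 + (T2 + T3)" "size U = 2 * n" "\<Sum>\<^sub># U = int n * d" "even (c + d)" for U d
    proof -
      have "Q + elems U {#} \<subseteq># elems (R - (T1 + (T2 + T3))) B + elems (T1 + (T2 + T3)) {#}"
        using Q(1) that(1) by (intro subset_mset.add_mono elems_mono) auto
      also have "\<dots> = elems R B" using sub by (simp flip: elems_add)
      finally have "Q + elems U {#} \<subseteq># elems R B" .
      moreover have "has_value (int n) (Q + elems U {#}) (v + \<Sum>\<^sub># U)"
        using Q(3) has_value_rotations by (rule has_value_add)
      moreover have "int (2 * n) dvd v + \<Sum>\<^sub># U"
        using that(3,4) by (auto simp: c mult.commute[of 2] simp flip: distrib_left)
      ultimately show ?thesis unfolding has_product_one_def using Q(2) that(2)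
        by (intro exI[of _ "Q + elems U {#}"] exI[of _ "v + \<Sum>\<^sub># U"]) auto
    qed
    have sums: "\<Sum>\<^sub># T1 = int n * ?f T1" "\<Sum>\<^sub># T2 = int n * ?f T2" "\<Sum>\<^sub># T3 = int n * ?f T3"
      using f T123 by auto
    \<comment> \<open>The last two sums differ by an odd number, so one of them is even.\<close>
    have "even (c + (?f T1 + ?f T2)) \<or> even (c + (?f T1 + ?f T3)) \<or> even (c + (?f T2 + ?f T3))"
      using 1(3) by auto
    then show ?thesis
    proof (elim disjE)
      assume "even (c + (?f T1 + ?f T2))"
      then show ?thesis using sums T'
        by (intro combine[of "T1 + T2" "?f T1 + ?f T2"]) (simp_all add: distrib_left)
    next
      assume "even (c + (?f T1 + ?f T3))"
      then show ?thesis using sums T'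
        by (intro combine[of "T1 + T3" "?f T1 + ?f T3"]) (simp_all add: distrib_left)
    next
      assume "even (c + (?f T2 + ?f T3))"
      then show ?thesis using sums T'
        by (intro combine[of "T2 + T3" "?f T2 + ?f T3"]) (simp_all add: distrib_left)
    qed
  qed
qed

lemma forces_product_one_dicyclic_odd:
  assumes "odd n" "3 \<le> n"
  shows "forces_product_one (2 * n) (int n) (6 * n) (4 * n)"
proof (rule forces_product_oneI)
  fix R B :: "int multiset" assume N: "size R + size B = 6 * n"
  show "has_product_one (2 * n) (int n) (4 * n) (elems R B)"
  proof (cases "size B \<le> n + 1")
    case True
    then show ?thesis using dicyclic_odd_few_reflections assms N by blast
  next
    case False
    then obtain b b' where b: "{#b, b'#} \<subseteq># B" "int n dvd b - b'"
      using reflection_pair[of n B] assms(2) by auto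
    show ?thesis
    proof (cases "\<exists>c c'. {#c, c'#} \<subseteq># B - {#b, b'#} \<and> int n dvd c - c'")
      case True
      then show ?thesis using dicyclic_odd_two_pairs assms N b by blast
    next
      case no: False
      have "\<not> n < size (B - {#b, b'#})"
        using no reflection_pair[of n "B - {#b, b'#}"] assms(2) by auto
      then have "size B = n + 2" using False size_Diff_submset[OF b(1)] size_mset_mono[OF b(1)] by simp
      then show ?thesis using dicyclic_odd_critical assms N b no by blast
    qed
  qed
qed

lemma forces_product_one_dicyclic_even:
  assumes "even n" "2 \<le> n"
  shows "forces_product_one (2 * n) (int n) (4 * n) (2 * n)"
proof (cases "n = 2")
  case True
  then show ?thesis using forces_product_one_order_eight[of 2] by simp
next
  case False
  then have "4 \<le> n" using assms by presburger
  then show ?thesis using forces_product_one_double forces_product_one_dihedral_even assms(1) by simp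
qed

section \<open>Transfer to the presented groups\<close>

text \<open>Only the relations are assumed: normal forms multiply correctly but might coincide,
  which \<open>twisted_full\<close> excludes by prescribing the order. Both the presented group and
  its isomorphic copy are instances.\<close>

locale twisted = group G for G (structure) +
  fixes a t :: 'a and m k :: nat
  assumes a [simp]: "a \<in> carrier G" and t [simp]: "t \<in> carrier G" and m_pos: "0 < m"
    and a_pow: "a [^] m = \<one>" and t_t: "t \<otimes> t = a [^] k" and t_a: "t \<otimes> a = inv a \<otimes> t"
begin

definition elt :: "int \<times> bool \<Rightarrow> 'a" where
  "elt p = a [^] fst p \<otimes> (if snd p then t else \<one>)"

lemma elt_closed [simp]: "elt p \<in> carrier G"
  by (simp add: elt_def)

lemma t_a_int_pow: "t \<otimes> a [^] (j :: int) = a [^] (- j) \<otimes> t"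
proof -
  have t_inv_a: "t \<otimes> inv a = a \<otimes> t"
  proof -
    have "a \<otimes> t \<otimes> a = t" using t_a by (metis a t m_assoc inv_closed l_inv_ex inv_solve_left m_closed)
    then show ?thesis by (metis a t inv_solve_right m_closed)
  qed
  have pos: "t \<otimes> a [^] n = inv a [^] n \<otimes> t" for n :: nat
  proof (induction n)
    case (Suc n)
    have "t \<otimes> a [^] Suc n = (t \<otimes> a [^] n) \<otimes> a" by (simp add: m_assoc)
    also have "\<dots> = inv a [^] n \<otimes> (t \<otimes> a)" by (simp add: Suc m_assoc)
    also have "\<dots> = inv a [^] Suc n \<otimes> t" by (simp add: t_a m_assoc)
    finally show ?case .
  qed simp
  have inv_pow: "t \<otimes> inv a [^] n = a [^] n \<otimes> t" for n :: nat
  proof (induction n)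
    case (Suc n)
    have "t \<otimes> inv a [^] Suc n = (t \<otimes> inv a [^] n) \<otimes> inv a" by (simp add: m_assoc)
    also have "\<dots> = a [^] n \<otimes> (t \<otimes> inv a)" by (simp add: Suc m_assoc)
    also have "\<dots> = a [^] Suc n \<otimes> t" by (simp add: t_inv_a m_assoc)
    finally show ?case .
  qed simp
  show ?thesis
  proof (cases j)
    case (nonneg n)
    then show ?thesis using pos[of n] by (simp add: int_pow_int int_pow_neg_int nat_pow_inv)
  next
    case (neg n)
    have "t \<otimes> inv (a [^] Suc n) = a [^] Suc n \<otimes> t"
      using inv_pow[of "Suc n"] unfolding nat_pow_inv[OF a] .
    then show ?thesis unfolding neg int_pow_neg_int[OF a] minus_minus int_pow_int .
  qed
qed

lemma elt_mult: "elt p \<otimes> elt q = elt (elem_mult (int k) p q)"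
proof -
  obtain i b where p: "p = (i, b)" by (cases p)
  obtain j c where q: "q = (j, c)" by (cases q)
  show ?thesis
  proof (cases b)
    case False
    then show ?thesis by (simp add: p q elt_def elem_mult_def int_pow_mult m_assoc)
  next
    case True
    have "elt p \<otimes> elt q = a [^] i \<otimes> ((t \<otimes> a [^] j) \<otimes> (if c then t else \<one>))"
      using True by (simp add: p q elt_def m_assoc)
    also have "\<dots> = a [^] i \<otimes> (a [^] (- j) \<otimes> (t \<otimes> (if c then t else \<one>)))"
      by (simp add: t_a_int_pow m_assoc)
    also have "\<dots> = a [^] (i - j) \<otimes> (t \<otimes> (if c then t else \<one>))"
      using int_pow_mult[OF a, of i "- j"] by (simp add: m_assoc)
    also have "\<dots> = elt (elem_mult (int k) p q)"
      using True int_pow_mult[OF a, of "i - j" "int k"] 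
      by (cases c) (simp_all add: p q elt_def elem_mult_def t_t int_pow_int)
    finally show ?thesis .
  qed
qed

lemma elt_zero: "elt (0, False) = \<one>"
  by (simp add: elt_def)

lemma foldr_elt: "foldr (\<otimes>) (map elt xs) \<one> = elt (elem_prod (int k) xs)"
  by (induction xs) (simp_all add: elt_zero elt_mult elem_prod_def)

lemma elt_cong: "int m dvd i - j \<Longrightarrow> elt (i, b) = elt (j, b)"
proof -
  assume "int m dvd i - j"
  then obtain c where c: "i = j + int m * c" by (metis dvdE diff_add_cancel add.commute)
  have "a [^] (int m * c) = \<one>" using a_pow by (simp flip: int_pow_pow add: int_pow_int)
  then show ?thesis using c by (simp add: elt_def int_pow_mult)
qed

text \<open>Words may contain the formal inverse of \<open>\<tau>\<close>, so this letter needs a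
  normal form as well.\<close>

lemma elt_uminus_k_t: "elt (- int k, True) = inv t"
proof -
  have "elt (- int k, True) \<otimes> elt (0, True) = \<one>"
    by (simp add: elt_mult elem_mult_def elt_zero)
  then show ?thesis by (intro inv_equality[symmetric]) (simp_all add: elt_def)
qed

end

locale twisted_full = twisted +
  assumes generated: "carrier G \<subseteq> range elt" and order: "order G = 2 * m"
begin

lemma elt_cases:
  assumes "x \<in> carrier G"
  obtains i b where "x = elt (i, b)"
  using assms generated by (metis image_iff subsetD surj_pair)

text \<open>The \<open>2 * m\<close> normal forms with reduced exponents cover a group of order
  \<open>2 * m\<close>, so no two of them coincide.\<close>

lemma elt_eq_one_iff: "elt (i, b) = \<one> \<longleftrightarrow> int m dvd i \<and> \<not> b"
proof
  assume one: "elt (i, b) = \<one>"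
  let ?D = "{0..<int m} \<times> (UNIV :: bool set)"
  have mod: "elt (j, c) = elt (j mod int m, c)" for j c by (rule elt_cong) (simp add: minus_mod_eq_mult_div)
  have "carrier G = elt ` ?D"
  proof (intro equalityI subsetI)
    fix x assume "x \<in> carrier G"
    then obtain j c where "x = elt (j, c)" by (rule elt_cases)
    then show "x \<in> elt ` ?D" using mod[of j c] m_pos by (intro image_eqI[of _ _ "(j mod int m, c)"]) auto
  qed auto
  then have "card (elt ` ?D) = card ?D" using order by (simp add: order_def card_cartesian_product)
  then have inj: "inj_on elt ?D" by (intro eq_card_imp_inj_on) auto
  have "elt (i mod int m, b) = elt (0, False)" using one mod[of i b] by (simp add: elt_zero)
  then have "(i mod int m, b) = (0, False)" using m_pos by (intro inj_onD[OF inj]) auto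
  then show "int m dvd i \<and> \<not> b" by auto
next
  assume "int m dvd i \<and> \<not> b"
  then show "elt (i, b) = \<one>" using elt_cong[of i 0 False] by (simp add: elt_zero)
qed

lemma elt_square_pow: "(elt (i, True) \<otimes> elt (i, True)) [^] (n :: nat) = elt (int (k * n), False)"
proof -
  have "elt (i, True) \<otimes> elt (i, True) = a [^] k"
    by (simp add: elt_mult elem_mult_def) (simp add: elt_def int_pow_int)
  then show ?thesis by (simp add: elt_def nat_pow_pow int_pow_int del: of_nat_mult)
qed

lemma pow_two_times: "x \<in> carrier G \<Longrightarrow> x [^] (2 * n :: nat) = (x \<otimes> x) [^] n"
proof -
  assume x: "x \<in> carrier G"
  then have "x \<otimes> x = x [^] (2 :: nat)" by (simp add: numeral_2_eq_2)
  then show ?thesis using x by (simp add: nat_pow_pow)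
qed

text \<open>The order of \<open>a\<close> gives the divisor \<open>m\<close>. Reflections all have
  the square \<open>a^k\<close>, and their odd powers are reflections again, which gives the other
  two conditions.\<close>

lemma group_exponent_eq:
  assumes "m dvd e" "even e" "m dvd k * (e div 2)"
    and least: "\<And>d. m dvd d \<Longrightarrow> even d \<Longrightarrow> m dvd k * (d div 2) \<Longrightarrow> e dvd d"
  shows "group_exponent G = e"
proof (rule dvd_antisym)
  have "ord x dvd e" if xG: "x \<in> carrier G" for x
  proof -
    obtain i b where x: "x = elt (i, b)" using xG by (rule elt_cases)
    have "x [^] e = \<one>"
    proof (cases b)
      case True
      have "x [^] e = (x \<otimes> x) [^] (e div 2)" using pow_two_times[of x "e div 2"] xG assms(2) by simp
      also have "\<dots> = elt (int (k * (e div 2)), False)" using True x elt_square_pow by simp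
      also have "\<dots> = \<one>" unfolding elt_eq_one_iff using assms(3) by (simp flip: of_nat_mult)
      finally show ?thesis .
    next
      case False
      then have "x [^] e = elt (i * int e, False)"
        using int_pow_pow[of a i "int e"] by (simp add: x elt_def int_pow_int)
      also have "\<dots> = \<one>" unfolding elt_eq_one_iff using assms(1) by simp
      finally show ?thesis .
    qed
    then show ?thesis using pow_eq_id xG by blast
  qed
  then show "group_exponent G dvd e" unfolding group_exponent_def by (auto intro: Lcm_least)
next
  let ?L = "group_exponent G"
  have one: "x [^] ?L = \<one>" if "x \<in> carrier G" for x
    using that pow_eq_id unfolding group_exponent_def by (simp add: dvd_Lcm)
  have t': "t = elt (0, True)" by (simp add: elt_def)
  have sq: "t [^] (2 * n) = elt (int (k * n), False)" for n
    using pow_two_times[of t n] elt_square_pow[of 0 n] by (simp flip: t')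
  have "elt (int ?L, False) = \<one>" using one[OF a] by (simp add: elt_def int_pow_int)
  then have "m dvd ?L" by (simp add: elt_eq_one_iff)
  moreover have ev: "even ?L"
  proof (rule ccontr)
    assume "odd ?L"
    then have "t [^] ?L = t [^] (2 * (?L div 2)) \<otimes> t" by (metis nat_pow_Suc odd_two_times_div_two_succ Suc_eq_plus1)
    also have "\<dots> = elt (int (k * (?L div 2)), True)" unfolding sq by (simp add: elt_def)
    finally have "elt (int (k * (?L div 2)), True) = \<one>" using one[OF t] by simp
    then show False unfolding elt_eq_one_iff by simp
  qed
  moreover have "m dvd k * (?L div 2)"
  proof -
    have "elt (int (k * (?L div 2)), False) = \<one>" using sq[of "?L div 2"] one[OF t] ev by simp
    then show ?thesis unfolding elt_eq_one_iff by (simp only: of_nat_dvd_iff)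
  qed
  ultimately show "e dvd ?L" by (rule least)
qed

lemma s_property_forces:
  assumes "forces_product_one m (int k) N (group_exponent G)"
  shows "s_property G N"
  unfolding s_property_def
proof (intro allI impI, elim conjE)
  fix S assume S: "sequence_over G S" "N \<le> size S"
  define c where "c x = (SOME p. elt p = x)" for x
  have "elt (c x) = x" if "x \<in># S" for x
  proof -
    have "x \<in> carrier G" using that S(1) by (auto simp: sequence_over_def)
    then have "\<exists>p. elt p = x" by (metis elt_cases)
    then show ?thesis unfolding c_def by (rule someI_ex)
  qed
  then have cS: "image_mset elt (image_mset c S) = S"
    by (simp add: image_mset.compositionality comp_def cong: image_mset_cong)
  obtain T v where T: "T \<subseteq># image_mset c S" "size T = group_exponent G" "has_value (int k) T v" "int m dvd v"
    using assms S(2) unfolding forces_product_one_def has_product_one_def by (metis size_image_mset)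
  obtain xs where xs: "mset xs = T" "elem_prod (int k) xs = (v, False)" using T(3) unfolding has_value_def by blast
  have "product_one G (image_mset elt T)"
    unfolding product_one_def
    by (intro exI[of _ "map elt xs"]) (use xs T(4) in \<open>simp add: foldr_elt elt_eq_one_iff\<close>)
  moreover have "image_mset elt T \<subseteq># S" using image_mset_subseteq_mono[OF T(1), of elt] cS by simp
  ultimately show "\<exists>T. T \<subseteq># S \<and> size T = group_exponent G \<and> product_one G T"
    using T(2) by (intro exI[of _ "image_mset elt T"]) simp
qed

text \<open>A product-one subsequence contains an even number of reflections, hence not the single
  one present. The number of copies of \<open>a\<close> in it is a multiple of \<open>m\<close>
  below \<open>m\<close>, hence 0, and the copies of 1 are one too few.\<close>

lemma not_s_property:
  assumes "l < group_exponent G + m"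
  shows "\<not> s_property G l"
proof
  assume sp: "s_property G l"
  let ?e = "group_exponent G"
  let ?C = "replicate_mset (?e - 1) (0, False) + replicate_mset (m - 1) (1, False) + {#(0 :: int, True)#}"
  have "?e dvd order G"
    unfolding group_exponent_def by (auto intro: Lcm_least ord_dvd_group_order)
  then have e: "0 < ?e" using order m_pos dvd_pos_nat[of "2 * m" ?e] by simp
  have "sequence_over G (image_mset elt ?C)" by (auto simp: sequence_over_def)
  moreover have "l \<le> size (image_mset elt ?C)" using assms e m_pos by simp
  ultimately obtain T where T: "T \<subseteq># image_mset elt ?C" "size T = ?e" "product_one G T"
    using sp unfolding s_property_def by blast
  obtain Q where Q: "Q \<subseteq># ?C" "T = image_mset elt Q" using subseteq_image_mset[OF T(1)] .
  obtain xs where xs: "mset xs = T" "foldr (\<otimes>) xs \<one> = \<one>" using T(3) unfolding product_one_def by blast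
  \<comment> \<open>The ordering is lifted to exponent pairs, where \<open>?C\<close> can be
    counted; \<open>elt\<close> itself is not injective.\<close>
  obtain ys where ys: "mset ys = Q" "map elt ys = xs"
    using xs(1) Q(2)
  proof (induction xs arbitrary: Q T thesis)
    case (Cons x xs)
    from Cons.prems(2,3) have "image_mset elt Q = add_mset x (mset xs)" by simp
    then obtain y Q' where Q': "Q = add_mset y Q'" "elt y = x" "image_mset elt Q' = mset xs"
      by (metis msed_map_invR)
    then obtain ys where "mset ys = Q'" "map elt ys = xs" using Cons.IH by metis
    then show ?case using Q' Cons.prems(1)[of "y # ys"] by simp
  qed simp
  have one: "elt (elem_prod (int k) ys) = \<one>" using xs(2) ys(2) foldr_elt by metis
  have parity: "snd (elem_prod (int k) zs) \<longleftrightarrow> odd (size (filter_mset snd (mset zs)))" for zs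
    by (induction zs) (auto simp: elem_prod_def elem_mult_def)
  have sum: "fst (elem_prod (int k) zs) = \<Sum>\<^sub># (image_mset fst (mset zs))" if "\<forall>z\<in>set zs. \<not> snd z" for zs
    using that by (induction zs) (auto simp: elem_prod_def elem_mult_def)
  have "size (filter_mset snd Q) \<le> size (filter_mset snd ?C)"
    using Q(1) by (intro size_mset_mono multiset_filter_mono)
  also have "\<dots> = 1" by simp
  finally have le: "size (filter_mset snd Q) \<le> 1" .
  have dvd: "even (size (filter_mset snd Q))" "int m dvd fst (elem_prod (int k) ys)"
  proof -
    have "elt (fst (elem_prod (int k) ys), snd (elem_prod (int k) ys)) = \<one>" using one by simp
    then have "int m dvd fst (elem_prod (int k) ys) \<and> \<not> snd (elem_prod (int k) ys)"
      by (rule iffD1[OF elt_eq_one_iff])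
    then show "even (size (filter_mset snd Q))" "int m dvd fst (elem_prod (int k) ys)"
      using parity[of ys] ys(1) by simp_all
  qed
  have "x = 0" if "x \<le> 1" "even x" for x :: nat using that by presburger
  from this[OF le dvd(1)] have "size (filter_mset snd Q) = 0" .
  then have "set_mset (filter_mset snd Q) = {}" by simp
  then have no: "\<forall>z\<in>#Q. \<not> snd z" unfolding set_mset_filter by blast
  then have "(0, True) \<notin># Q" by auto
  then have "count Q (0, True) = 0" by (simp add: not_in_iff)
  have "Q = replicate_mset (count Q (0, False)) (0, False) + replicate_mset (count Q (1, False)) (1, False)"
  proof (rule multiset_eqI)
    fix x
    have "count Q x \<le> count ?C x" by (rule mset_subset_eq_count[OF Q(1)])
    then show "count Q x = count (replicate_mset (count Q (0, False)) (0, False) + replicate_mset (count Q (1, False)) (1, False)) x"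
      using \<open>count Q (0, True) = 0\<close> by (auto split: if_splits)
  qed
  then obtain i j where ij: "Q = replicate_mset i (0, False) + replicate_mset j (1, False)"
    "i = count Q (0, False)" "j = count Q (1, False)" by blast
  have "i \<le> ?e - 1" "j \<le> m - 1"
    using mset_subset_eq_count[OF Q(1), of "(0, False)"] mset_subset_eq_count[OF Q(1), of "(1, False)"] ij(2,3)
    by simp_all
  moreover have "fst (elem_prod (int k) ys) = int j"
    using sum[of ys] no ys(1) arg_cong[OF ij(1), of "\<lambda>M. \<Sum>\<^sub># (image_mset fst M)"] by auto
  then have "m dvd j" using dvd(2) by simp
  ultimately have "j = 0" using m_pos by (metis One_nat_def Suc_pred less_Suc_eq_le nat_dvd_not_less neq0_conv)
  then have "size Q = i" using arg_cong[OF ij(1), of size] by simp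
  then show False using T(2) Q(2) \<open>i \<le> ?e - 1\<close> e by simp
qed

lemma s_inv_eq:
  assumes "forces_product_one m (int k) (group_exponent G + m) (group_exponent G)"
  shows "s_inv G = group_exponent G + m"
  unfolding s_inv_def
  using s_property_forces[OF assms] not_s_property by (intro Least_equality) (auto simp: not_less[symmetric])

end

text \<open>Every letter is a normal form and products of normal forms are normal forms, so they
  exhaust the presented group. The isomorphism carries relations, normal forms and order over to
  \<open>G\<close>.\<close>

lemma twisted_full_presented:
  fixes G :: "('a, 'b) monoid_scheme"
  assumes "0 < m" "m dvd 2 * k"
    and R: "R = {(replicate m \<alpha>, []), ([\<tau>, \<tau>], replicate k \<alpha>), ([\<tau>, \<alpha>], [\<alpha>_inv, \<tau>])}"
    and G: "group G" "G \<cong> presented_group R"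
  shows "\<exists>a t. twisted_full G a t m k"
proof -
  let ?H = "presented_group R" and ?c = "word_class R"
  interpret H: group ?H by (rule group_presented_group)
  have one: "\<one>\<^bsub>?H\<^esub> = ?c []" and carrier: "carrier ?H = range ?c"
    by (simp_all add: presented_group_def)
  have pow: "?c [\<alpha>] [^]\<^bsub>?H\<^esub> n = ?c (replicate n \<alpha>)" for n :: nat
    by (induction n) (simp_all add: one mult_presented_group replicate_append_same)
  have cl: "?c w \<in> carrier ?H" for w by (simp add: carrier)
  have inv: "?c [(x, \<not> b)] = inv\<^bsub>?H\<^esub> ?c [(x, b)]" for x b
  proof (rule H.inv_equality[symmetric])
    show "?c [(x, \<not> b)] \<otimes>\<^bsub>?H\<^esub> ?c [(x, b)] = \<one>\<^bsub>?H\<^esub>"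
      using word_eq.cancel[of R x "\<not> b"] by (simp add: one mult_presented_group word_class_eq_iff)
  qed (simp_all add: cl)
  have rel: "?c u = ?c v" if "(u, v) \<in> R" for u v
    using word_eq.rel[OF that] by (simp add: word_class_eq_iff)
  have rels: "?c (replicate m \<alpha>) = ?c []" "?c [\<tau>, \<tau>] = ?c (replicate k \<alpha>)" "?c [\<tau>, \<alpha>] = ?c [\<alpha>_inv, \<tau>]"
    by (rule rel, simp add: R)+
  interpret H: twisted ?H "?c [\<alpha>]" "?c [\<tau>]" m k
  proof
    show "?c [\<tau>] \<otimes>\<^bsub>?H\<^esub> ?c [\<alpha>] = inv\<^bsub>?H\<^esub> ?c [\<alpha>] \<otimes>\<^bsub>?H\<^esub> ?c [\<tau>]"
      using rels(3) inv[of Alpha True] by (simp add: mult_presented_group flip: inv)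
  qed (use assms(1) rels in \<open>simp_all add: cl pow one mult_presented_group\<close>)
  have letter: "\<exists>p. ?c [x] = H.elt p" for x
  proof -
    obtain y b where x: "x = (y, b)" by (cases x)
    have "?c [\<alpha>] = H.elt (1, False)" "?c [\<tau>] = H.elt (0, True)" "?c [\<alpha>_inv] = H.elt (- 1, False)"
      "?c [(Tau, False)] = H.elt (- int k, True)"
      using inv[of Alpha True] inv[of Tau True] H.elt_uminus_k_t H.int_pow_neg_int[of "?c [\<alpha>]" 1]
      by (simp_all add: H.elt_def cl)
    then show ?thesis unfolding x by (cases y; cases b) auto
  qed
  have gen: "\<exists>p. ?c w = H.elt p" for w
  proof (induction w)
    case Nil
    show ?case using H.elt_zero one by metis
  next
    case (Cons x w)
    have "?c (x # w) = ?c [x] \<otimes>\<^bsub>?H\<^esub> ?c w" by (simp add: mult_presented_group)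
    then show ?case using Cons letter[of x] H.elt_mult by metis
  qed
  have "?H \<cong> G" using H.iso_sym G by (metis group.iso_sym)
  then obtain \<phi> where \<phi>: "\<phi> \<in> iso ?H G" unfolding is_iso_def by blast
  interpret \<phi>: group_hom ?H G \<phi>
    using \<phi> G(1) H.group_axioms by (simp add: group_hom_def group_hom_axioms_def iso_def)
  have bij: "bij_betw \<phi> (carrier ?H) (carrier G)" using \<phi> by (simp add: iso_def)
  interpret T: twisted G "\<phi> (?c [\<alpha>])" "\<phi> (?c [\<tau>])" m k
  proof
    show "\<phi> (?c [\<alpha>]) [^]\<^bsub>G\<^esub> m = \<one>\<^bsub>G\<^esub>"
      using H.a_pow by (metis \<phi>.hom_nat_pow \<phi>.hom_one cl)
    show "\<phi> (?c [\<tau>]) \<otimes>\<^bsub>G\<^esub> \<phi> (?c [\<tau>]) = \<phi> (?c [\<alpha>]) [^]\<^bsub>G\<^esub> k"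
      using H.t_t by (metis \<phi>.hom_nat_pow \<phi>.hom_mult cl)
    show "\<phi> (?c [\<tau>]) \<otimes>\<^bsub>G\<^esub> \<phi> (?c [\<alpha>]) = inv\<^bsub>G\<^esub> \<phi> (?c [\<alpha>]) \<otimes>\<^bsub>G\<^esub> \<phi> (?c [\<tau>])"
      using H.t_a by (metis \<phi>.hom_inv \<phi>.hom_mult cl H.inv_closed)
  qed (use assms(1) cl in simp_all)
  have elt: "T.elt p = \<phi> (H.elt p)" for p
    by (simp add: T.elt_def H.elt_def \<phi>.hom_int_pow cl)
  have "twisted_full G (\<phi> (?c [\<alpha>])) (\<phi> (?c [\<tau>])) m k"
  proof
    show "carrier G \<subseteq> range T.elt"
    proof
      fix x assume "x \<in> carrier G"
      then obtain w where "x = \<phi> (?c w)" using bij by (auto simp: bij_betw_def carrier)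
      then show "x \<in> range T.elt" using gen[of w] elt by auto
    qed
    show "order G = 2 * m"
      using order_presented_group[OF assms(1,2) R] bij_betw_same_card[OF bij] by (simp add: order_def)
  qed
  then show ?thesis by blast
qed

theorem theorem1p1:
  fixes n :: nat and G :: "('a, 'b) monoid_scheme"
  assumes "group G"
  shows "(n \<ge> 3 \<and> G \<cong> dihedral_group n \<longrightarrow>
            s_inv G = (if odd n then 3 * n else 2 * n)) \<and>
         (n \<ge> 2 \<and> G \<cong> dicyclic_group n \<longrightarrow>
            s_inv G = (if odd n then 6 * n else 4 * n))"
proof (intro conjI impI)
  assume *: "n \<ge> 3 \<and> G \<cong> dihedral_group n"
  then obtain a t where "twisted_full G a t n 0"
    using twisted_full_presented[of n 0, OF _ _ HOL.refl assms] by (auto simp: dihedral_group_def)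
  then interpret twisted_full G a t n 0 .
  show "s_inv G = (if odd n then 3 * n else 2 * n)"
  proof (cases "odd n")
    case True
    \<comment> \<open>For odd \<open>n\<close> the reflections contribute a factor 2 that the orders
      of the rotations lack.\<close>
    have "2 * n dvd d" if "n dvd d" "even d" for d
      using that True by (intro divides_mult) (auto simp: coprime_left_2_iff_odd)
    then have "group_exponent G = 2 * n" by (intro group_exponent_eq) auto
    then show ?thesis using s_inv_eq forces_product_one_dihedral_odd[of n] * True by simp
  next
    case False
    then have "group_exponent G = n" by (intro group_exponent_eq) auto
    moreover have "4 \<le> n" using conjunct1[OF *] False by presburger
    ultimately show ?thesis using s_inv_eq forces_product_one_dihedral_even[of n] False by (simp add: mult_2)
  qed
next
  assume *: "n \<ge> 2 \<and> G \<cong> dicyclic_group n"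
  then obtain a t where "twisted_full G a t (2 * n) n"
    using twisted_full_presented[of "2 * n" n, OF _ _ HOL.refl assms] by (auto simp: dicyclic_group_def)
  then interpret twisted_full G a t "2 * n" n .
  show "s_inv G = (if odd n then 6 * n else 4 * n)"
  proof (cases "odd n")
    case True
    \<comment> \<open>The last condition expresses that reflections have order 4; the factor
      \<open>n\<close> comes from the rotations and is prime to 4.\<close>
    have "4 * n dvd d" if "2 * n dvd d" "even d" "2 * n dvd n * (d div 2)" for d
    proof -
      have "2 dvd d div 2" using that(3) * by (simp add: mult.commute[of 2])
      then have "4 dvd d" using that(2) by presburger
      moreover have "n dvd d" using that(1) by (rule dvd_mult_right)
      moreover have "coprime 4 n" using True coprime_power_left_iff[of 2 2 n] by (simp add: coprime_left_2_iff_odd)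
      ultimately show ?thesis by (intro divides_mult)
    qed
    then have "group_exponent G = 4 * n" by (intro group_exponent_eq) auto
    moreover have "3 \<le> n" using conjunct1[OF *] True by presburger
    ultimately show ?thesis using s_inv_eq forces_product_one_dicyclic_odd[of n] True by simp
  next
    case False
    \<comment> \<open>For even \<open>n\<close> the order 4 of the reflections already divides
      \<open>2 * n\<close>.\<close>
    then have "group_exponent G = 2 * n" by (intro group_exponent_eq) auto
    then show ?thesis using s_inv_eq forces_product_one_dicyclic_even[of n] * False by simp
  qed
qed

end
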